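(* Let $\mathbb K$ be a field of characteristic $0$, and let $I$ (finite), $P=\bigsqcup_{i\in I}P_i$, weights $w_p$, finite sets of insertion places $E_p$, insertion exponent vectors $\mu_e\in\mathbb K^I$ and 1-cocycles $\Lambda_p:\mathbb K[\mathbf L_p]\to\mathbb K[L]$ ($p\in P$) be as in the context, with associated coefficients $a_{p,\alpha}$. The unique solution $\mathbf G(x,L)=(G_i(x,L))_{i\in I}$, $G_i(x,L)\in\mathbb K[L][[x]]$, of the Dyson--Schwinger system $$G_i(x,L)=1+\sum_{p\in P_i}x^{w_p}\,\Lambda_p\Big(\prod_{e\in E_p}\mathbf G(x,L_e)^{\mu_e}\Big)\qquad(i\in I)$$ is $$G_i(x,L)=1+\sum_{t}\Big(\prod_{v\in t}\ \prod_{e\in E_{d(v)}}\mu_e^{\underline{\mathbf{od}(v,e)}}\Big)\sum_{\tau\in\mathrm{Tub}(t)}\mathrm{mel}(\tau)\sum_{k=1}^{b(\tau)}a_{d(t),\beta^k(\tau)}\frac{x^{w(t)}L^k}{|\mathrm{Aut}(t)|\,k!},$$ where the outer sum is over all isomorphism classes of $(P,\mathcal E)$-trees $t$ whose root decoration lies in $P_i$.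
   Context: **Data.** $\mathbb K$ is a field of characteristic $0$; $I$ is a finite set; $P$ is a set partitioned as $P=\bigsqcup_{i\in I}P_i$. Each $p\in P$ has a weight $w_p\in\mathbb Z_{\ge1}$, with only finitely many elements of each weight, and a finite set $E_p$ of insertion places (the sets $E_p$ are regarded as disjoint); $\mathcal E=\{E_p\}_{p\in P}$. Each $e\in E_p$ has an insertion exponent vector $\mu_e=(\mu_{e,j})_{j\in I}\in\mathbb K^I$. For a vector $\mathbf G=(G_j)_{j\in I}$, $\mathbf G^{\mu_e}=\prod_{j\in I}G_j^{\mu_{e,j}}$; powers of series in $x$ with constant term $1$ are defined by the binomial series. $\Lambda_p$ of a series in $x$ means apply $\Lambda_p$ to each coefficient of $x^n$. **1-cocycles.** $\mathbb K[L]$ is the Hopf algebra with $\Delta L=L\otimes1+1\otimes L$. Put $\mathbf L_p=(L_e)_{e\in E_p}$; $\mathbb K[\mathbf L_p]\cong\mathbb K[L]^{\otimes E_p}$ is a left $\mathbb K[L]$-comodule via $\delta(\mathbf L^\alpha)=\sum_{\beta\le\alpha}\binom{\alpha}{\beta}L^{|\alpha|-|\beta|}\otimes\mathbf L^\beta$. A 1-cocycle is a linear map $\Lambda:\mathbb K[\mathbf L_p]\to\mathbb K[L]$ with $\Delta\Lambda=\Lambda\otimes1+(\mathrm{id}\otimes\Lambda)\delta$. Every 1-cocycle has the form $\Lambda_pf=\int_0^LA_p(\partial/\partial u_e:e\in E_p)f(\mathbf u)\big|_{u_e=u\ \forall e}\,du$ for a unique $A_p\in\mathbb K[[\mathbf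 L_p]]$; write $A_p(\mathbf L_p)=\sum_{\alpha\in\mathbb Z_{\ge0}^{E_p}}a_{p,\alpha}\binom{|\alpha|}{\alpha}\mathbf L_p^\alpha$ with $\binom{|\alpha|}{\alpha}$ the multinomial coefficient. **Trees.** A rooted tree is regarded as a finite poset with a greatest element, the root, in which each element is covered by at most one element; elements are vertices, covering relations are edges, the vertices covered by $v$ are its children. A $(P,\mathcal E)$-tree is a rooted tree with each vertex $v$ decorated by some $d(v)\in P$, and each edge from a parent $v$ to a child decorated by an element of $E_{d(v)}$. $d(t)$ is the decoration of the root $\mathrm{rt}\,t$; $w(t)=\sum_{v\in t}w_{d(v)}$; $\mathrm{Aut}(t)$ is the group of automorphisms preserving vertex and edge decorations. For $v\in t$, $e\in E_{d(v)}$, $j\in I$, let $\mathrm{od}_j(v,e)$ be the number of children of $v$ with decoration in $P_j$ joined to $v$ by an edge decorated $e$; $\mathbf{od}(v,e)=(\mathrm{od}_j(v,e))_{j\in I}$. Falling factorials: $a^{\underline k}=\prod_{j=0}^{k-1}(a-j)$, and $\mu_e^{\underline{\mathbf n}}=\prod_{j\in I}\mu_{e,j}^{\underline{n_j}}$. **Tubings.** A tube of $t$ is a nonempty set of vertices inducing a connected subgraph; a tubing is a set of tubes any two of which are disjoint or nested. $\mathrm{Tub}(t)$ is the set of binary tubings, i.e. inclusion-maximal tubings. In a binary tubing $\tau$, $t\in\tau$ and every non-singleton tube $X\in\tau$ has exactly two maximal proper subtubes in $\tau$; they partition $X$, one is a downset of $X$ (a lower tube), the other an upset of $X$ (an upper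 tube); $t$ itself counts as a lower tube. If $t'\in\tau$ is an upper tube and $t''$ is the corresponding lower tube ($t'\cup t''\in\tau$), the type of $t'$ is the decoration of the first edge on the path from the root of $t'$ to the root of $t''$. For a vertex $v$ and $e\in E_{d(v)}$, $\mathrm{rk}_e(\tau,v)$ is the number of upper tubes of type $e$ in $\tau$ with root $v$, and $\mathbf{rk}(\tau,v)=(\mathrm{rk}_e(\tau,v))_{e\in E_{d(v)}}$. $b(\tau)$ is the number of tubes of $\tau$ containing $\mathrm{rt}\,t$. For $1\le k\le b(\tau)$, $\beta^k(\tau)\in\mathbb Z_{\ge0}^{E_{d(t)}}$ has $e$-component the number of upper tubes of type $e$ containing $\mathrm{rt}\,t$, excluding the outermost $k-1$ upper tubes containing $\mathrm{rt}\,t$. The Mellin monomial is $\mathrm{mel}(\tau)=\prod_{v\in t,\,v\ne\mathrm{rt}\,t}a_{d(v),\mathbf{rk}(\tau,v)}$. *)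

theory Defs
  imports
    "HOL-Library.Poly_Mapping"
    "HOL-Library.FuncSet"
    "HOL-Computational_Algebra.Computational_Algebra"
    "HOL-Analysis.Infinite_Sum"
begin

section \<open>Polynomials in finitely many variables and 1-cocycles\<close>

text \<open>
  Exponent vectors indexed by insertion places are finitely supported functions; \<open>K[L\<^sub>p]\<close> is the
  set of polynomials whose variables all lie in \<open>E\<^sub>p\<close>.
\<close>

type_synonym 'e expo = "'e \<Rightarrow>\<^sub>0 nat"
type_synonym ('e, 'k) mpoly = "'e expo \<Rightarrow>\<^sub>0 'k"

definition mpolys :: "'e set \<Rightarrow> ('e, 'k::zero) mpoly set" where
  "mpolys Ep = {f. \<forall>\<alpha>\<in>Poly_Mapping.keys f. Poly_Mapping.keys \<alpha> \<subseteq> Ep}"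

definition mconst :: "'k \<Rightarrow> ('e, 'k::zero) mpoly" where
  "mconst c = Poly_Mapping.single 0 c"

definition expo_size :: "'e expo \<Rightarrow> nat" where
  "expo_size \<alpha> = (\<Sum>e\<in>Poly_Mapping.keys \<alpha>. Poly_Mapping.lookup \<alpha> e)"

definition expo_le :: "'e expo \<Rightarrow> 'e expo \<Rightarrow> bool" where
  "expo_le \<beta> \<alpha> \<longleftrightarrow> (\<forall>e. Poly_Mapping.lookup \<beta> e \<le> Poly_Mapping.lookup \<alpha> e)"

definition expo_binom :: "'e expo \<Rightarrow> 'e expo \<Rightarrow> nat" where
  "expo_binom \<alpha> \<beta> =
     (\<Prod>e\<in>Poly_Mapping.keys \<alpha>. Poly_Mapping.lookup \<alpha> e choose Poly_Mapping.lookup \<beta> e)"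

definition multinom :: "'e expo \<Rightarrow> 'k::field_char_0" where
  "multinom \<alpha> = fact (expo_size \<alpha>) / (\<Prod>e\<in>Poly_Mapping.keys \<alpha>. fact (Poly_Mapping.lookup \<alpha> e))"

definition ffact :: "'k::comm_ring_1 \<Rightarrow> nat \<Rightarrow> 'k" where
  "ffact a k = (\<Prod>j<k. a - of_nat j)"

text \<open>
  For a vector space \<open>V\<close> we identify \<open>K[L] \<otimes> V\<close> with \<open>V[L]\<close>: the tensor \<open>L\<^sup>n \<otimes> v\<close> is
  \<open>monom v n\<close>. Thus in \<open>K[L] \<otimes> K[L] = K[L][L]\<close> the outer variable \<open>[:0, 1:]\<close> is \<open>L \<otimes> 1\<close>,
  the inner variable \<open>[:[:0, 1:]:]\<close> is \<open>1 \<otimes> L\<close>, and \<open>id \<otimes> \<Lambda>\<close> applies \<open>\<Lambda>\<close> to each coefficient.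
\<close>

definition coproduct :: "'k::comm_ring_1 poly \<Rightarrow> 'k poly poly" where
  "coproduct f = poly (map_poly (\<lambda>c. [:[:c:]:]) f) ([:0, 1:] + [:[:0, 1:]:])"

definition tensor_one :: "'k::comm_ring_1 poly \<Rightarrow> 'k poly poly" where
  "tensor_one f = map_poly (\<lambda>c. [:c:]) f"

definition id_tensor :: "('v::zero \<Rightarrow> 'k poly) \<Rightarrow> 'v poly \<Rightarrow> 'k::comm_ring_1 poly poly" where
  "id_tensor \<Lambda> F = map_poly \<Lambda> F"

definition coaction :: "('e, 'k::comm_ring_1) mpoly \<Rightarrow> ('e, 'k) mpoly poly" where
  "coaction f = (\<Sum>\<alpha>\<in>Poly_Mapping.keys f. \<Sum>\<beta> | expo_le \<beta> \<alpha>.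
     monom (Poly_Mapping.single \<beta> (Poly_Mapping.lookup f \<alpha> * of_nat (expo_binom \<alpha> \<beta>)))
       (expo_size \<alpha> - expo_size \<beta>))"

definition one_cocycle :: "'e set \<Rightarrow> (('e, 'k::comm_ring_1) mpoly \<Rightarrow> 'k poly) \<Rightarrow> bool" where
  "one_cocycle Ep \<Lambda> \<longleftrightarrow>
     (\<forall>f\<in>mpolys Ep. \<forall>g\<in>mpolys Ep. \<Lambda> (f + g) = \<Lambda> f + \<Lambda> g) \<and>
     (\<forall>c. \<forall>f\<in>mpolys Ep. \<Lambda> (mconst c * f) = smult c (\<Lambda> f)) \<and>
     (\<forall>f\<in>mpolys Ep. coproduct (\<Lambda> f) = tensor_one (\<Lambda> f) + id_tensor \<Lambda> (coaction f))"

subsection \<open>The coefficients of a 1-cocycle\<close>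

definition mpoly_deriv :: "'e expo \<Rightarrow> ('e, 'k::comm_ring_1) mpoly \<Rightarrow> ('e, 'k) mpoly" where
  \<comment> \<open>the iterated partial derivative \<open>\<Prod>\<^sub>e (\<partial>/\<partial>u\<^sub>e)\<^bsup>\<gamma>\<^sub>e\<^esup>\<close>; the falling factorials make the terms
      with some \<open>\<gamma>\<^sub>e > \<alpha>\<^sub>e\<close> vanish\<close>
  "mpoly_deriv \<gamma> f = (\<Sum>\<alpha>\<in>Poly_Mapping.keys f. Poly_Mapping.single (\<alpha> - \<gamma>)
     (Poly_Mapping.lookup f \<alpha> *
      (\<Prod>e\<in>Poly_Mapping.keys \<gamma>. ffact (of_nat (Poly_Mapping.lookup \<alpha> e)) (Poly_Mapping.lookup \<gamma> e))))"

definition diff_op :: "('e expo \<Rightarrow> 'k::comm_ring_1) \<Rightarrow> ('e, 'k) mpoly \<Rightarrow> ('e, 'k) mpoly" where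
  \<comment> \<open>\<open>A(\<partial>/\<partial>u\<^sub>e : e \<in> E\<^sub>p) f\<close> for the power series \<open>A\<close> with the given coefficients; only finitely many
      summands are nonzero\<close>
  "diff_op A f = (\<Sum>\<gamma>. mconst (A \<gamma>) * mpoly_deriv \<gamma> f)"

definition set_equal :: "('e, 'k::comm_ring_1) mpoly \<Rightarrow> 'k poly" where
  \<comment> \<open>the substitution \<open>u\<^sub>e = u\<close> for all \<open>e\<close>\<close>
  "set_equal f = (\<Sum>\<alpha>\<in>Poly_Mapping.keys f. monom (Poly_Mapping.lookup f \<alpha>) (expo_size \<alpha>))"

definition poly_integral :: "'k::field_char_0 poly \<Rightarrow> 'k poly" where
  \<comment> \<open>\<open>f \<mapsto> \<integral>\<^sub>0\<^sup>L f(u) du\<close>\<close>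
  "poly_integral f = (\<Sum>n\<le>degree f. monom (coeff f n / of_nat (Suc n)) (Suc n))"

definition represents_cocycle ::
    "'e set \<Rightarrow> (('e, 'k::field_char_0) mpoly \<Rightarrow> 'k poly) \<Rightarrow> ('e expo \<Rightarrow> 'k) \<Rightarrow> bool" where
  "represents_cocycle Ep \<Lambda> a \<longleftrightarrow>
     (\<forall>\<alpha>. \<not> Poly_Mapping.keys \<alpha> \<subseteq> Ep \<longrightarrow> a \<alpha> = 0) \<and>
     (\<forall>f\<in>mpolys Ep. \<Lambda> f = poly_integral (set_equal (diff_op (\<lambda>\<alpha>. a \<alpha> * multinom \<alpha>) f)))"

definition cocycle_coeffs ::
    "'e set \<Rightarrow> (('e, 'k::field_char_0) mpoly \<Rightarrow> 'k poly) \<Rightarrow> 'e expo \<Rightarrow> 'k" where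
  "cocycle_coeffs Ep \<Lambda> = (THE a. represents_cocycle Ep \<Lambda> a)"


section \<open>The Dyson--Schwinger system\<close>

definition subst_var :: "'e \<Rightarrow> 'k poly \<Rightarrow> ('e, 'k::comm_ring_1) mpoly" where
  \<comment> \<open>\<open>f(L) \<mapsto> f(L\<^sub>e)\<close>\<close>
  "subst_var e f = (\<Sum>n\<le>degree f. Poly_Mapping.single (Poly_Mapping.single e n) (coeff f n))"

definition fps_map :: "('a \<Rightarrow> 'b) \<Rightarrow> 'a fps \<Rightarrow> 'b fps" where
  "fps_map h F = Abs_fps (\<lambda>n. h (fps_nth F n))"

definition fps_cpow :: "('e, 'k::field_char_0) mpoly fps \<Rightarrow> 'k \<Rightarrow> ('e, 'k) mpoly fps" where
  \<comment> \<open>the binomial series \<open>\<Sum>\<^sub>k (c choose k) (F - 1)\<^sup>k\<close>, for \<open>F\<close> with constant term 1\<close>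
  "fps_cpow F c = fps_map mconst (fps_binomial c) oo (F - 1)"

definition insertion_product ::
    "'i set \<Rightarrow> ('e \<Rightarrow> 'i \<Rightarrow> 'k) \<Rightarrow> 'e set \<Rightarrow> ('i \<Rightarrow> 'k poly fps) \<Rightarrow> ('e, 'k::field_char_0) mpoly fps" where
  "insertion_product I \<mu> Ep G = (\<Prod>e\<in>Ep. \<Prod>j\<in>I. fps_cpow (fps_map (subst_var e) (G j)) (\<mu> e j))"

text \<open>
  Infinite sums in \<open>K[L][[x]]\<close> refer to the \<open>x\<close>-adic topology, which is the library's topology on
  \<^typ>\<open>'k poly fps\<close>. As all weights are positive, the equations force the series \<open>G i\<close> to have
  constant term 1, so their powers are meaningful.
\<close>

definition dse_solution ::
    "'i set \<Rightarrow> ('i \<Rightarrow> 'p set) \<Rightarrow> ('p \<Rightarrow> nat) \<Rightarrow> ('p \<Rightarrow> 'e set) \<Rightarrow> ('e \<Rightarrow> 'i \<Rightarrow> 'k)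
      \<Rightarrow> ('p \<Rightarrow> ('e, 'k) mpoly \<Rightarrow> 'k poly) \<Rightarrow> ('i \<Rightarrow> 'k::field_char_0 poly fps) \<Rightarrow> bool" where
  "dse_solution I P w E \<mu> \<Lambda> G \<longleftrightarrow>
     (\<forall>i\<in>I. G i = 1 + (\<Sum>\<^sub>\<infinity>p\<in>P i. fps_X ^ w p * fps_map (\<Lambda> p) (insertion_product I \<mu> (E p) G)))"


section \<open>Decorated rooted trees\<close>

text \<open>
  \<open>(u, v) \<in> ord t\<close> means \<open>u \<le> v\<close>. The decoration of the edge from a parent \<open>v\<close> to a child \<open>u\<close> is
  \<open>edec t v u\<close>; the values of \<open>dec\<close> and \<open>edec\<close> outside of vertices and edges are irrelevant.
\<close>

record ('v, 'p, 'e) dtree =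
  verts :: "'v set"
  ord :: "'v rel"
  dec :: "'v \<Rightarrow> 'p"
  edec :: "'v \<Rightarrow> 'v \<Rightarrow> 'e"

definition covers :: "('v, 'p, 'e) dtree \<Rightarrow> 'v \<Rightarrow> 'v \<Rightarrow> bool" where
  \<comment> \<open>\<open>v\<close> covers \<open>u\<close>\<close>
  "covers t v u \<longleftrightarrow> u \<noteq> v \<and> (u, v) \<in> ord t \<and>
     \<not> (\<exists>z. z \<noteq> u \<and> z \<noteq> v \<and> (u, z) \<in> ord t \<and> (z, v) \<in> ord t)"

definition children :: "('v, 'p, 'e) dtree \<Rightarrow> 'v \<Rightarrow> 'v set" where
  "children t v = {u. covers t v u}"

definition rooted_tree :: "('v, 'p, 'e) dtree \<Rightarrow> bool" where
  "rooted_tree t \<longleftrightarrow> finite (verts t) \<and> partial_order_on (verts t) (ord t) \<and>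
     (\<exists>r\<in>verts t. \<forall>v\<in>verts t. (v, r) \<in> ord t) \<and>
     (\<forall>u v v'. covers t v u \<and> covers t v' u \<longrightarrow> v = v')"

definition decorated_tree :: "'p set \<Rightarrow> ('p \<Rightarrow> 'e set) \<Rightarrow> ('v, 'p, 'e) dtree \<Rightarrow> bool" where
  "decorated_tree PP E t \<longleftrightarrow> rooted_tree t \<and> (\<forall>v\<in>verts t. dec t v \<in> PP) \<and>
     (\<forall>v u. covers t v u \<longrightarrow> edec t v u \<in> E (dec t v))"

definition top_elem :: "('v, 'p, 'e) dtree \<Rightarrow> 'v set \<Rightarrow> 'v" where
  \<comment> \<open>the root of the subtree on the vertex set \<open>X\<close>\<close>
  "top_elem t X = (THE r. r \<in> X \<and> (\<forall>v\<in>X. (v, r) \<in> ord t))"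

definition root :: "('v, 'p, 'e) dtree \<Rightarrow> 'v" where
  "root t = top_elem t (verts t)"

definition weight :: "('p \<Rightarrow> nat) \<Rightarrow> ('v, 'p, 'e) dtree \<Rightarrow> nat" where
  "weight w t = (\<Sum>v\<in>verts t. w (dec t v))"

definition tree_isos :: "('v, 'p, 'e) dtree \<Rightarrow> ('u, 'p, 'e) dtree \<Rightarrow> ('v \<Rightarrow> 'u) set" where
  \<comment> \<open>the maps are normalised outside of \<open>verts s\<close>, so that they can be counted\<close>
  "tree_isos s t = {\<phi> \<in> verts s \<rightarrow>\<^sub>E verts t. bij_betw \<phi> (verts s) (verts t) \<and>
     (\<forall>u\<in>verts s. \<forall>v\<in>verts s. (u, v) \<in> ord s \<longleftrightarrow> (\<phi> u, \<phi> v) \<in> ord t) \<and>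
     (\<forall>v\<in>verts s. dec t (\<phi> v) = dec s v) \<and>
     (\<forall>u v. covers s v u \<longrightarrow> edec t (\<phi> v) (\<phi> u) = edec s v u)}"

definition Aut :: "('v, 'p, 'e) dtree \<Rightarrow> ('v \<Rightarrow> 'v) set" where
  "Aut t = tree_isos t t"

definition tree_classes :: "'p set \<Rightarrow> ('p \<Rightarrow> 'e set) \<Rightarrow> 'p set \<Rightarrow> (nat, 'p, 'e) dtree set set" where
  \<comment> \<open>isomorphism classes of trees with root decoration in \<open>Q\<close>; every finite tree is isomorphic to one
      whose vertices are natural numbers\<close>
  "tree_classes PP E Q =
     (let T = {t. decorated_tree PP E t \<and> dec t (root t) \<in> Q}
      in T // {(s, t). s \<in> T \<and> t \<in> T \<and> tree_isos s t \<noteq> {}})"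

definition od :: "('i \<Rightarrow> 'p set) \<Rightarrow> ('v, 'p, 'e) dtree \<Rightarrow> 'v \<Rightarrow> 'e \<Rightarrow> 'i \<Rightarrow> nat" where
  "od P t v e j = card {u \<in> children t v. dec t u \<in> P j \<and> edec t v u = e}"

definition insertion_factor ::
    "'i set \<Rightarrow> ('i \<Rightarrow> 'p set) \<Rightarrow> ('p \<Rightarrow> 'e set) \<Rightarrow> ('e \<Rightarrow> 'i \<Rightarrow> 'k) \<Rightarrow> ('v, 'p, 'e) dtree \<Rightarrow> 'k::comm_ring_1" where
  "insertion_factor I P E \<mu> t =
     (\<Prod>v\<in>verts t. \<Prod>e\<in>E (dec t v). \<Prod>j\<in>I. ffact (\<mu> e j) (od P t v e j))"


section \<open>Binary tubings\<close>

definition tube :: "('v, 'p, 'e) dtree \<Rightarrow> 'v set \<Rightarrow> bool" where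
  "tube t X \<longleftrightarrow> X \<noteq> {} \<and> X \<subseteq> verts t \<and>
     (\<forall>u\<in>X. \<forall>v\<in>X. (u, v) \<in> {(a, b). a \<in> X \<and> b \<in> X \<and> (covers t a b \<or> covers t b a)}\<^sup>*)"

definition tubing :: "('v, 'p, 'e) dtree \<Rightarrow> 'v set set \<Rightarrow> bool" where
  "tubing t \<tau> \<longleftrightarrow> (\<forall>X\<in>\<tau>. tube t X) \<and> (\<forall>X\<in>\<tau>. \<forall>Y\<in>\<tau>. X \<inter> Y = {} \<or> X \<subseteq> Y \<or> Y \<subseteq> X)"

definition Tub :: "('v, 'p, 'e) dtree \<Rightarrow> 'v set set set" where
  "Tub t = {\<tau>. tubing t \<tau> \<and> (\<forall>\<sigma>. tubing t \<sigma> \<and> \<tau> \<subseteq> \<sigma> \<longrightarrow> \<sigma> = \<tau>)}"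

definition max_subtubes :: "'v set set \<Rightarrow> 'v set \<Rightarrow> 'v set set" where
  "max_subtubes \<tau> X = {Y \<in> \<tau>. Y \<subset> X \<and> \<not> (\<exists>Z\<in>\<tau>. Y \<subset> Z \<and> Z \<subset> X)}"

definition upper_lower :: "('v, 'p, 'e) dtree \<Rightarrow> 'v set set \<Rightarrow> 'v set \<Rightarrow> 'v set \<Rightarrow> bool" where
  \<comment> \<open>\<open>A\<close> is an upper tube of \<open>\<tau>\<close> with corresponding lower tube \<open>B\<close>\<close>
  "upper_lower t \<tau> A B \<longleftrightarrow> A \<noteq> B \<and> A \<union> B \<in> \<tau> \<and> max_subtubes \<tau> (A \<union> B) = {A, B} \<and>
     (\<forall>a\<in>A. \<forall>x\<in>A \<union> B. (a, x) \<in> ord t \<longrightarrow> x \<in> A) \<and>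
     (\<forall>b\<in>B. \<forall>x\<in>A \<union> B. (x, b) \<in> ord t \<longrightarrow> x \<in> B)"

definition pair_type :: "('v, 'p, 'e) dtree \<Rightarrow> 'v set \<Rightarrow> 'v set \<Rightarrow> 'e" where
  \<comment> \<open>the first edge on the path from the root of \<open>A\<close> down to the root of \<open>B\<close> leads to the child of the
      former that lies above (or equals) the latter\<close>
  "pair_type t A B =
     edec t (top_elem t A) (THE c. c \<in> children t (top_elem t A) \<and> (top_elem t B, c) \<in> ord t)"

definition upper_tubes :: "('v, 'p, 'e) dtree \<Rightarrow> 'v set set \<Rightarrow> 'v set set" where
  "upper_tubes t \<tau> = {A. \<exists>B. upper_lower t \<tau> A B}"

definition upper_tubes_of_type :: "('v, 'p, 'e) dtree \<Rightarrow> 'v set set \<Rightarrow> 'e \<Rightarrow> 'v set set" where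
  "upper_tubes_of_type t \<tau> e = {A. \<exists>B. upper_lower t \<tau> A B \<and> pair_type t A B = e}"

definition rk :: "('v, 'p, 'e) dtree \<Rightarrow> 'v set set \<Rightarrow> 'v \<Rightarrow> 'e \<Rightarrow> nat" where
  "rk t \<tau> v e = card {A \<in> upper_tubes_of_type t \<tau> e. top_elem t A = v}"

definition rk_vec :: "('p \<Rightarrow> 'e set) \<Rightarrow> ('v, 'p, 'e) dtree \<Rightarrow> 'v set set \<Rightarrow> 'v \<Rightarrow> 'e expo" where
  "rk_vec E t \<tau> v = (\<Sum>e\<in>E (dec t v). Poly_Mapping.single e (rk t \<tau> v e))"

definition bnum :: "('v, 'p, 'e) dtree \<Rightarrow> 'v set set \<Rightarrow> nat" where
  "bnum t \<tau> = card {X \<in> \<tau>. root t \<in> X}"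

definition beta_vec :: "('p \<Rightarrow> 'e set) \<Rightarrow> ('v, 'p, 'e) dtree \<Rightarrow> 'v set set \<Rightarrow> nat \<Rightarrow> 'e expo" where
  \<comment> \<open>the upper tubes containing the root form a chain; \<open>A\<close> is not among the outermost \<open>k - 1\<close> of them
      iff at least \<open>k - 1\<close> of them properly contain \<open>A\<close>\<close>
  "beta_vec E t \<tau> k = (\<Sum>e\<in>E (dec t (root t)). Poly_Mapping.single e
     (card {A \<in> upper_tubes_of_type t \<tau> e. root t \<in> A \<and>
              k - 1 \<le> card {A' \<in> upper_tubes t \<tau>. root t \<in> A' \<and> A \<subset> A'}}))"

definition mel ::
    "('p \<Rightarrow> 'e set) \<Rightarrow> ('p \<Rightarrow> 'e expo \<Rightarrow> 'k) \<Rightarrow> ('v, 'p, 'e) dtree \<Rightarrow> 'v set set \<Rightarrow> 'k::comm_ring_1" where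
  "mel E a t \<tau> = (\<Prod>v\<in>verts t - {root t}. a (dec t v) (rk_vec E t \<tau> v))"

definition tree_term ::
    "'i set \<Rightarrow> ('i \<Rightarrow> 'p set) \<Rightarrow> ('p \<Rightarrow> nat) \<Rightarrow> ('p \<Rightarrow> 'e set) \<Rightarrow> ('e \<Rightarrow> 'i \<Rightarrow> 'k)
      \<Rightarrow> ('p \<Rightarrow> 'e expo \<Rightarrow> 'k) \<Rightarrow> ('v, 'p, 'e) dtree \<Rightarrow> 'k::field_char_0 poly fps" where
  "tree_term I P w E \<mu> a t =
     fps_const (smult (insertion_factor I P E \<mu> t)
       (\<Sum>\<tau>\<in>Tub t. smult (mel E a t \<tau>)
         (\<Sum>k=1..bnum t \<tau>. monom (a (dec t (root t)) (beta_vec E t \<tau> k)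
            / (of_nat (card (Aut t)) * fact k)) k)))
     * fps_X ^ weight w t"

end

theory Submission
  imports
    Defs
    "HOL-Combinatorics.Multiset_Permutations"
    "HOL-Library.Nat_Bijection"
    "HOL-Library.Sublist"
begin

text \<open>
  For a tube \<open>X\<close> of a tree with root \<open>r\<close> let \<open>\<psi>(X)\<close> be its sum over binary tubings, a polynomial in
  \<open>L\<close>, and let \<open>F(X)\<close> be the product of the polynomials \<open>\<psi>(X\<^sub>c)(L\<^sub>e)\<close> over the branches \<open>X\<^sub>c\<close> of \<open>X\<close>
  at \<open>r\<close>, where \<open>e\<close> decorates the edge from \<open>r\<close> to \<open>c\<close>. A binary tubing of \<open>X\<close> is a choice of an edge
  to be cut together with binary tubings of the two parts. With \<open>\<sigma>(X)\<close> the linear coefficient of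
  \<open>\<psi>(X)\<close> this gives \<open>\<psi>(X)' = \<sigma>(X) + \<Sum>\<^sub>v \<sigma>(X\<^sub>v) \<psi>(X - X\<^sub>v)\<close>, hence also
  \<open>\<partial>F(X)/\<partial>L\<^sub>e = \<Sum>\<^sub>v \<sigma>(X\<^sub>v) F(X - X\<^sub>v)\<close>, the sum being over the \<open>v\<close> below an edge of \<open>r\<close>
  decorated \<open>e\<close>. A 1-cocycle \<open>\<Lambda>\<close> is determined by the linear functional \<open>f \<mapsto> [L] \<Lambda>(f)\<close> and by
  \<open>(n + 1)! [L\<^sup>n\<^sup>+\<^sup>1] \<Lambda>(f) = [L] \<Lambda>(D\<^sup>n f)\<close> with \<open>D = \<Sum>\<^sub>e \<partial>/\<partial>L\<^sub>e\<close>. Comparing the two recursions yields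
  \<open>\<psi>(X) = \<Lambda>(F(X))\<close> by induction on the size of \<open>X\<close>.

  The sum over isomorphism classes, weighted by \<open>1 / |Aut(t)|\<close>, becomes a sum over planar trees, weighted
  by the reciprocals of the factorials of the numbers of children, since \<open>Aut(t)\<close> acts freely on the
  orderings of \<open>t\<close>. For planar trees, \<open>\<psi> = \<Lambda> \<circ> F\<close> turns the coefficients of the system into the
  expansion of a product of binomial series as a sum over lists of children. Uniqueness holds because
  the coefficient of \<open>x\<^sup>n\<close> on the right-hand side only involves lower coefficients.
\<close>

subsection \<open>Rooted trees and their tubes\<close>

text \<open>The derivative recursion leaves the linear coefficient \<sigma>(X) undetermined, so a
  second recursion is needed for it; the same cut yields both. For L^k with k \<ge> 2 the upper tube
  created by the cut is among those excluded from \<beta>^k, and the coefficients at the root are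
  unaffected. For k = 1 it is counted and adds the unit vector of its type to the exponent. This
  leads from the root family a to its shifts \<alpha> \<mapsto> a(\<alpha> + e), so everything is
  proved for an arbitrary root family c. On the side of polynomials, c becomes the functional
  L^\<alpha> \<mapsto> |\<alpha>|! c(\<alpha>), and the shift of c by e becomes the derivative by
  L_e. For planar trees, the falling factorials come from the binomial series by marking the number
  of children with an auxiliary variable and differentiating: the first child of a list is then
  split off, and the factorial of the number of children pays for the choice of an order.\<close>

locale rtree =
  fixes t :: "('v, 'p, 'e) dtree"
  assumes rooted: "rooted_tree t"
begin

lemma finite_verts: "finite (verts t)"
  using rooted by (auto simp: rooted_tree_def)

lemma ord_order: "partial_order_on (verts t) (ord t)"
  using rooted by (auto simp: rooted_tree_def)

lemma ord_verts: "(u, v) \<in> ord t \<Longrightarrow> u \<in> verts t \<and> v \<in> verts t"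
  using partial_order_onD(4)[OF ord_order] by auto

lemma ord_refl: "v \<in> verts t \<Longrightarrow> (v, v) \<in> ord t"
  using partial_order_onD(1)[OF ord_order] by (auto simp: refl_on_def)

lemma ord_trans: "(u, v) \<in> ord t \<Longrightarrow> (v, x) \<in> ord t \<Longrightarrow> (u, x) \<in> ord t"
  using partial_order_onD(2)[OF ord_order] by (meson transE)

lemma ord_antisym: "(u, v) \<in> ord t \<Longrightarrow> (v, u) \<in> ord t \<Longrightarrow> u = v"
  using partial_order_onD(3)[OF ord_order] by (meson antisymD)

lemma covers_unique: "covers t v u \<Longrightarrow> covers t v' u \<Longrightarrow> v = v'"
  using rooted unfolding rooted_tree_def by blast

lemma covers_ord: "covers t v u \<Longrightarrow> (u, v) \<in> ord t \<and> u \<noteq> v"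
  by (auto simp: covers_def)

lemma finite_ord: "finite (ord t)"
  using partial_order_onD(4)[OF ord_order] finite_verts by (meson finite_SigmaI finite_subset)

lemma wf_ord: "wf (ord t - Id)"
  using partial_order_on_well_order_on[OF finite_ord ord_order] .

text \<open>Induction along this relation starts at the root: the hypothesis is available for
  everything strictly above the current vertex.\<close>

lemma wf_ord_converse: "wf ((ord t - Id)\<inverse>)"
  by (intro finite_acyclic_wf_converse finite_Diff finite_ord partial_order_on_acyclic[OF ord_order])

lemma parent_below:
  assumes "(u, v) \<in> ord t" "u \<noteq> v"
  obtains c where "covers t c u" "(c, v) \<in> ord t"
proof -
  let ?Q = "{z. (u, z) \<in> ord t \<and> z \<noteq> u \<and> (z, v) \<in> ord t}"
  have "v \<in> ?Q"
    using assms(2) assms(1) ord_refl conjunct1[OF ord_verts[OF assms(1)]] conjunct2[OF ord_verts[OF assms(1)]] by simp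
  then obtain c where c: "c \<in> ?Q" and min: "\<And>y. (y, c) \<in> ord t - Id \<Longrightarrow> y \<notin> ?Q"
    by (rule wfE_min[OF wf_ord]) blast
  have "covers t c u"
    unfolding covers_def using c min ord_trans by blast
  then show ?thesis
    using that c by blast
qed

lemma child_above:
  assumes "(u, v) \<in> ord t" "u \<noteq> v"
  obtains c where "covers t v c" "(u, c) \<in> ord t"
proof -
  let ?Q = "{z. (u, z) \<in> ord t \<and> z \<noteq> v \<and> (z, v) \<in> ord t}"
  have "u \<in> ?Q"
    using assms(2) assms(1) ord_refl conjunct1[OF ord_verts[OF assms(1)]] conjunct2[OF ord_verts[OF assms(1)]] by simp
  then obtain c where c: "c \<in> ?Q" and min: "\<And>y. (y, c) \<in> (ord t - Id)\<inverse> \<Longrightarrow> y \<notin> ?Q"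
    by (rule wfE_min[OF wf_ord_converse]) blast
  have "covers t v c"
    unfolding covers_def using c min ord_trans by blast
  then show ?thesis
    using that c by blast
qed

lemma parent_le:
  assumes "covers t c u" "(u, z) \<in> ord t" "u \<noteq> z"
  shows "(c, z) \<in> ord t"
  using parent_below[OF assms(2,3)] covers_unique[OF assms(1)] by metis

text \<open>If \<open>x\<close> differs from \<open>y\<close> and \<open>z\<close>, its unique
  parent lies below both, so the claim is passed on towards the root.\<close>

lemma ord_chain: "(x, y) \<in> ord t \<Longrightarrow> (x, z) \<in> ord t \<Longrightarrow> (y, z) \<in> ord t \<or> (z, y) \<in> ord t"
proof (induction x rule: wf_induct_rule[OF wf_ord_converse])
  case (1 x)
  show ?case
  proof (cases "x = y \<or> x = z")
    case True
    with 1 show ?thesis by auto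
  next
    case False
    obtain c where c: "covers t c x" "(c, y) \<in> ord t"
      using parent_below 1 False by metis
    then have "(c, z) \<in> ord t"
      using parent_le 1 False by metis
    then show ?thesis
      using 1(1)[of c] c covers_ord[OF c(1)] by auto
  qed
qed

text \<open>The full subtree at \<open>v\<close>. Cutting the edge above \<open>v\<close> splits a
  tube \<open>X\<close> into the upper part \<open>X - D v\<close> and the lower part
  \<open>X \<inter> D v\<close>.\<close>

definition D :: "'v \<Rightarrow> 'v set" where
  "D v = {u. (u, v) \<in> ord t}"

lemma D_subset: "D v \<subseteq> verts t"
  using ord_verts by (auto simp: D_def)

text \<open>Tubes are the order-convex sets with a greatest element.\<close>

definition rtube :: "'v set \<Rightarrow> 'v \<Rightarrow> bool" where
  "rtube X r \<longleftrightarrow> r \<in> X \<and> X \<subseteq> D r \<and> (\<forall>x\<in>X. \<forall>y. (x, y) \<in> ord t \<and> (y, r) \<in> ord t \<longrightarrow> y \<in> X)"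

lemma rtubeD:
  assumes "rtube X r"
  shows "r \<in> X" "x \<in> X \<Longrightarrow> (x, r) \<in> ord t" "X \<subseteq> verts t" "finite X"
    "x \<in> X \<Longrightarrow> (x, y) \<in> ord t \<Longrightarrow> (y, r) \<in> ord t \<Longrightarrow> y \<in> X"
proof -
  show 1: "r \<in> X" "x \<in> X \<Longrightarrow> (x, r) \<in> ord t" "X \<subseteq> verts t"
    "x \<in> X \<Longrightarrow> (x, y) \<in> ord t \<Longrightarrow> (y, r) \<in> ord t \<Longrightarrow> y \<in> X"
    using assms D_subset by (auto simp: rtube_def D_def)
  show "finite X"
    by (rule finite_subset[OF 1(3) finite_verts])
qed

lemma top_elem_rtube: "rtube X r \<Longrightarrow> top_elem t X = r"
  unfolding top_elem_def
  by (rule the_equality) (metis rtubeD(1,2) ord_antisym)+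

abbreviation adj :: "'v set \<Rightarrow> 'v rel" where
  "adj X \<equiv> {(a, b). a \<in> X \<and> b \<in> X \<and> (covers t a b \<or> covers t b a)}"

text \<open>The path climbs from parent to parent; convexity keeps it inside \<open>X\<close> until
  \<open>r\<close> is reached.\<close>

lemma rtube_path_to_top:
  assumes "rtube X r"
  shows "x \<in> X \<Longrightarrow> (x, r) \<in> (adj X)\<^sup>*"
proof (induction x rule: wf_induct_rule[OF wf_ord_converse])
  case (1 x)
  show ?case
  proof (cases "x = r")
    case False
    obtain c where c: "covers t c x" "(c, r) \<in> ord t"
      using parent_below[of x r] rtubeD(2)[OF assms 1(2)] False by metis
    have "c \<in> X"
      using c rtubeD(5)[OF assms 1(2)] covers_ord by blast
    then have "(c, r) \<in> (adj X)\<^sup>*" "(x, c) \<in> adj X"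
      using 1 c covers_ord[OF c(1)] by auto
    then show ?thesis
      by (meson converse_rtrancl_into_rtrancl)
  qed simp
qed

lemma tube_rtube:
  assumes "rtube X r"
  shows "tube t X"
proof -
  have "(u, v) \<in> (adj X)\<^sup>*" if "u \<in> X" "v \<in> X" for u v
  proof -
    have "sym (adj X)"
      by (auto simp: sym_def)
    then have "(r, v) \<in> (adj X)\<^sup>*"
      using rtube_path_to_top[OF assms that(2)] by (meson sym_rtrancl symD)
    then show ?thesis
      using rtube_path_to_top[OF assms that(1)] by (meson rtrancl_trans)
  qed
  then show ?thesis
    unfolding tube_def using rtubeD[OF assms] by blast
qed

text \<open>The top is the highest \<open>r\<close> for which the whole interval from a fixed
  \<open>x0\<close> to \<open>r\<close> lies in \<open>X\<close>. Along a walk through adjacent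
  elements, the interval from the current element to \<open>r\<close> stays in \<open>X\<close>, and
  connectedness reaches all of \<open>X\<close>.\<close>

lemma rtube_tube:
  assumes "tube t X"
  obtains r where "rtube X r"
proof -
  obtain x0 where x0: "x0 \<in> X"
    using assms by (auto simp: tube_def)
  define good where "good = (\<lambda>x r. (x, r) \<in> ord t \<and> (\<forall>y. (x, y) \<in> ord t \<and> (y, r) \<in> ord t \<longrightarrow> y \<in> X))"
  have "good x0 x0"
    unfolding good_def using x0 assms ord_refl ord_antisym by (auto simp: tube_def)
  then obtain r where r: "good x0 r" and max: "\<And>z. (r, z) \<in> ord t - Id \<Longrightarrow> \<not> good x0 z"
    using wfE_min[OF wf_ord_converse, of x0 "Collect (good x0)"] by auto
  have step: "good y r" if "(x0, y) \<in> (adj X)\<^sup>*" for y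
    using that
  proof (induction rule: rtrancl_induct)
    case base
    show ?case by (rule r)
  next
    case (step y z)
    have z: "z \<in> X" "y \<in> X" using step by auto
    consider (down) "covers t y z" | (up) "covers t z y" using step by auto
    then show ?case
    proof cases
      case down
      then show ?thesis
        unfolding good_def
        using step.IH covers_ord[OF down] ord_trans parent_le[OF down] z(1) good_def by blast
    next
      case up
      show ?thesis
      proof (cases "y = r")
        case True
        \<comment> \<open>\<open>z\<close> is the parent of \<open>r\<close>, so the interval from
          \<open>x0\<close> grows by \<open>z\<close> only; this contradicts the maximality of
          \<open>r\<close>.\<close>
        have "good x0 z"
          unfolding good_def
        proof (intro conjI allI impI)
          show "(x0, z) \<in> ord t"
            using r up True covers_ord ord_trans unfolding good_def by blast
        next
          fix w assume w: "(x0, w) \<in> ord t \<and> (w, z) \<in> ord t"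
          consider "(w, r) \<in> ord t" | "(r, w) \<in> ord t" "w \<noteq> r"
            using ord_chain[of x0 w r] w r ord_refl ord_verts unfolding good_def by blast
          then show "w \<in> X"
          proof cases
            case 1
            then show ?thesis using w r unfolding good_def by blast
          next
            case 2
            then have "(z, w) \<in> ord t" using parent_le up True by blast
            then show ?thesis using w z ord_antisym by blast
          qed
        qed
        then show ?thesis
          using max[of z] up True covers_ord by auto
      next
        case False
        then have "(z, r) \<in> ord t"
          using up parent_le step.IH unfolding good_def by blast
        then show ?thesis
          using step.IH covers_ord[OF up] ord_trans unfolding good_def by blast
      qed
    qed
  qed
  have "good y r" if "y \<in> X" for y
    using assms x0 that step unfolding tube_def by blast
  then have "rtube X r"
    using r x0 ord_verts ord_refl unfolding rtube_def good_def D_def by blast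
  then show ?thesis using that by blast
qed

section \<open>Binary tubings of a tube and their decomposition by one cut\<close>

definition tubs :: "'v set \<Rightarrow> 'v set set set" where
  "tubs X = {\<tau>. tubing t \<tau> \<and> \<tau> \<subseteq> Pow X \<and> (\<forall>\<sigma>. tubing t \<sigma> \<and> \<sigma> \<subseteq> Pow X \<and> \<tau> \<subseteq> \<sigma> \<longrightarrow> \<sigma> = \<tau>)}"

text \<open>Maximality in \<open>tubs X\<close> is relative to the tubings inside \<open>X\<close>,
  so that the notion applies to the two parts left by a cut. On the full vertex set the restriction
  is void.\<close>

lemma Tub_eq_tubs: "Tub t = tubs (verts t)"
proof -
  have "tubing t \<sigma> \<Longrightarrow> \<sigma> \<subseteq> Pow (verts t)" for \<sigma>
    by (auto simp: tubing_def tube_def)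
  then show ?thesis
    unfolding Tub_def tubs_def by blast
qed

lemma tubing_nested: "tubing t \<tau> \<Longrightarrow> Y \<in> \<tau> \<Longrightarrow> Z \<in> \<tau> \<Longrightarrow> Y \<inter> Z = {} \<or> Y \<subseteq> Z \<or> Z \<subseteq> Y"
  by (simp add: tubing_def)

lemma tubing_tube: "tubing t \<tau> \<Longrightarrow> Y \<in> \<tau> \<Longrightarrow> tube t Y"
  by (simp add: tubing_def)

lemma tubingI:
  assumes "\<And>Y. Y \<in> \<tau> \<Longrightarrow> tube t Y" "\<And>Y Z. Y \<in> \<tau> \<Longrightarrow> Z \<in> \<tau> \<Longrightarrow> Y \<inter> Z = {} \<or> Y \<subseteq> Z \<or> Z \<subseteq> Y"
  shows "tubing t \<tau>"
  using assms by (simp add: tubing_def)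

lemma tubs_max: "\<tau> \<in> tubs X \<Longrightarrow> tubing t \<sigma> \<Longrightarrow> \<sigma> \<subseteq> Pow X \<Longrightarrow> \<tau> \<subseteq> \<sigma> \<Longrightarrow> \<sigma> = \<tau>"
  by (simp add: tubs_def)

lemma tubsI:
  assumes "tubing t \<tau>" "\<tau> \<subseteq> Pow X" "\<And>\<sigma>. tubing t \<sigma> \<Longrightarrow> \<sigma> \<subseteq> Pow X \<Longrightarrow> \<tau> \<subseteq> \<sigma> \<Longrightarrow> \<sigma> \<subseteq> \<tau>"
  shows "\<tau> \<in> tubs X"
  using assms by (auto simp: tubs_def)

lemma tubs_tubing: "\<tau> \<in> tubs X \<Longrightarrow> tubing t \<tau>"
  by (simp add: tubs_def)

lemma tubs_Pow: "\<tau> \<in> tubs X \<Longrightarrow> \<tau> \<subseteq> Pow X"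
  by (simp add: tubs_def)

lemma tubs_tube: "\<tau> \<in> tubs X \<Longrightarrow> Y \<in> \<tau> \<Longrightarrow> tube t Y"
  by (auto simp: tubs_def tubing_def)

text \<open>The form in which maximality gets used: \<open>insert Y \<tau>\<close> is again a
  tubing, hence equal to \<open>\<tau>\<close>.\<close>

lemma tubs_insert:
  assumes "\<tau> \<in> tubs X" "tube t Y" "Y \<subseteq> X" "\<And>Z. Z \<in> \<tau> \<Longrightarrow> Z \<inter> Y = {} \<or> Z \<subseteq> Y \<or> Y \<subseteq> Z"
  shows "Y \<in> \<tau>"
proof -
  have "tubing t (insert Y \<tau>)"
  proof (rule tubingI)
    fix A B assume "A \<in> insert Y \<tau>" "B \<in> insert Y \<tau>"
    then show "A \<inter> B = {} \<or> A \<subseteq> B \<or> B \<subseteq> A"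
      using assms(4)[of A] assms(4)[of B] tubing_nested[OF tubs_tubing[OF assms(1)], of A B] by blast
  qed (use assms tubs_tube in blast)
  then have "insert Y \<tau> = \<tau>"
    using assms(3) tubs_Pow[OF assms(1)] by (intro tubs_max[OF assms(1)]) auto
  then show ?thesis by blast
qed

lemma tubs_top: "\<tau> \<in> tubs X \<Longrightarrow> rtube X r \<Longrightarrow> X \<in> \<tau>"
  using tubs_insert[of \<tau> X X] tube_rtube tubs_Pow by blast

lemma tubs_singleton:
  assumes "rtube {r} r"
  shows "tubs {r} = {{{r}}}"
proof -
  have "tubing t {{r}}"
    using tube_rtube[OF assms] by (auto simp: tubing_def)
  moreover have sub: "\<sigma> \<subseteq> {{r}}" if "tubing t \<sigma>" "\<sigma> \<subseteq> Pow {r}" for \<sigma>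
  proof
    fix Y assume "Y \<in> \<sigma>"
    then have "Y \<noteq> {}" "Y \<subseteq> {r}"
      using tubing_tube[OF that(1)] that(2) by (auto simp: tube_def)
    then show "Y \<in> {{r}}" by blast
  qed
  ultimately have "{{r}} \<in> tubs {r}"
    by (intro tubsI) auto
  moreover have "\<tau> = {{r}}" if "\<tau> \<in> tubs {r}" for \<tau>
    using tubs_top[OF that assms] sub[OF tubs_tubing[OF that] tubs_Pow[OF that]]
    by blast
  ultimately show ?thesis by blast
qed

lemma finite_tubs: "finite X \<Longrightarrow> finite (tubs X)"
  by (rule finite_subset[of _ "Pow (Pow X)"]) (auto simp: tubs_def)

lemma finite_tubs_elem: "finite X \<Longrightarrow> \<tau> \<in> tubs X \<Longrightarrow> finite \<tau>"
  using finite_subset[OF tubs_Pow] by blast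

lemma rtube_upper:
  assumes "rtube X r" "v \<in> X" "v \<noteq> r"
  shows "rtube (X - D v) r"
  unfolding rtube_def
proof (intro conjI ballI allI impI)
  show "r \<in> X - D v"
    using rtubeD(1,2)[OF assms(1)] assms ord_antisym by (auto simp: D_def)
  show "X - D v \<subseteq> D r"
    using assms by (auto simp: rtube_def)
  fix x y assume "x \<in> X - D v" "(x, y) \<in> ord t \<and> (y, r) \<in> ord t"
  then show "y \<in> X - D v"
    using rtubeD(5)[OF assms(1), of x y] ord_trans[of x y v] by (auto simp: D_def)
qed

lemma rtube_lower:
  assumes "rtube X r" "v \<in> X"
  shows "rtube (X \<inter> D v) v"
  unfolding rtube_def
proof (intro conjI ballI allI impI)
  show "v \<in> X \<inter> D v"
    using rtubeD(3)[OF assms(1)] assms ord_refl by (auto simp: D_def)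
  fix x y assume "x \<in> X \<inter> D v" "(x, y) \<in> ord t \<and> (y, v) \<in> ord t"
  then show "y \<in> X \<inter> D v"
    using rtubeD(5)[OF assms(1), of x y] rtubeD(2)[OF assms(1,2)] ord_trans[of y v r] by (auto simp: D_def)
qed auto

text \<open>Both \<open>m\<close> and \<open>v\<close> lie above \<open>w\<close>, hence are
  comparable, and \<open>m\<close> below \<open>v\<close> would put all of \<open>W\<close> below
  \<open>v\<close>. So a tube that crosses the boundary of \<open>D v\<close> contains the edge from
  \<open>v\<close> to its parent.\<close>

lemma rtube_straddle:
  assumes "rtube W m" "w \<in> W" "w \<in> D v" "\<not> W \<subseteq> D v"
  shows "v \<in> W" "v \<noteq> m"
proof -
  have "(m, v) \<notin> ord t"
    using assms ord_trans rtubeD(2)[OF assms(1)] by (force simp: D_def)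
  then have vm: "(v, m) \<in> ord t" "v \<noteq> m"
    using ord_chain[of w m v] assms rtubeD(2)[OF assms(1)] ord_refl ord_verts by (auto simp: D_def)
  then show "v \<in> W" "v \<noteq> m"
    using rtubeD(5)[OF assms(1,2)] assms by (auto simp: D_def)
qed

text \<open>Some edge of \<open>X\<close>, from \<open>v\<close> to its parent, lies in no proper tube of the tubing.\<close>

lemma tubs_cut:
  assumes "\<tau> \<in> tubs X" "rtube X r" "X \<noteq> {r}"
  obtains v where "v \<in> X" "v \<noteq> r" "\<And>Z. Z \<in> \<tau> \<Longrightarrow> Z \<noteq> X \<Longrightarrow> Z \<subseteq> D v \<or> Z \<inter> D v = {}"
proof -
  note X = rtubeD[OF assms(2)]
  have fin: "finite \<tau>"
    using finite_tubs_elem[OF X(4) assms(1)] .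
  \<comment> \<open>\<open>Y\<close> is a maximal proper tube, or \<open>{r}\<close> if there is no
    proper tube. A proper tube that meets \<open>Y\<close> is contained in \<open>Y\<close>, so no
    proper tube contains an edge that leaves \<open>Y\<close>.\<close>
  have "\<exists>Y m. rtube Y m \<and> Y \<subset> X \<and> (\<forall>Z\<in>\<tau>. Z \<noteq> X \<and> Z \<inter> Y \<noteq> {} \<longrightarrow> Z \<subseteq> Y)"
  proof (cases "\<tau> - {X} = {}")
    case True
    have "rtube {r} r"
      using X ord_antisym ord_verts by (auto simp: rtube_def D_def)
    moreover have "{r} \<subset> X"
      using X(1) assms(3) by auto
    ultimately show ?thesis
      using True by blast
  next
    case False
    obtain Y where Y: "Y \<in> \<tau> - {X}" "\<forall>Z\<in>\<tau> - {X}. Y \<subseteq> Z \<longrightarrow> Y = Z"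
      using finite_has_maximal[OF finite_Diff[OF fin] False] by (rule bexE)
    have "Y \<subset> X" using Y tubs_Pow[OF assms(1)] by blast
    have "tube t Y" using Y(1) tubs_tube[OF assms(1)] by simp
    then obtain m where "rtube Y m" by (rule rtube_tube)
    moreover have "Z \<subseteq> Y" if "Z \<in> \<tau>" "Z \<noteq> X" "Z \<inter> Y \<noteq> {}" for Z
      using that Y tubing_nested[OF tubs_tubing[OF assms(1)], of Z Y] by blast
    ultimately show ?thesis using \<open>Y \<subset> X\<close> by (intro exI[of _ Y] exI[of _ m]) simp
  qed
  then obtain Y m where Y: "rtube Y m" "Y \<subset> X" and cut: "\<forall>Z\<in>\<tau>. Z \<noteq> X \<and> Z \<inter> Y \<noteq> {} \<longrightarrow> Z \<subseteq> Y"
    by (elim exE conjE)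
  \<comment> \<open>The edge to be cut leaves \<open>Y\<close>: it goes up from the top of
    \<open>Y\<close> or, if that top is \<open>r\<close>, down to a maximal element of
    \<open>X - Y\<close>, whose parent then lies in \<open>Y\<close>.\<close>
  have "\<exists>v q. v \<in> X \<and> v \<noteq> r \<and> covers t q v \<and> \<not> (v \<in> Y \<and> q \<in> Y) \<and> (v \<in> Y \<or> q \<in> Y)"
  proof (cases "m = r")
    case False
    have "m \<in> X" using rtubeD(1)[OF Y(1)] Y(2) by blast
    then obtain q where q: "covers t q m" "(q, r) \<in> ord t"
      using parent_below[of m r] X False by metis
    have "q \<notin> Y"
      using rtubeD(2)[OF Y(1)] q covers_ord ord_antisym by blast
    then show ?thesis using \<open>m \<in> X\<close> False q rtubeD(1)[OF Y(1)] by blast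
  next
    case True
    obtain x0 where "x0 \<in> X - Y" using Y(2) by blast
    then obtain x where x: "x \<in> X - Y" and max: "\<And>y. (x, y) \<in> ord t - Id \<Longrightarrow> y \<notin> X - Y"
      using wfE_min[OF wf_ord_converse, of x0 "X - Y"] by auto
    have "x \<noteq> r" using x rtubeD(1)[OF Y(1)] True by auto
    then obtain q where q: "covers t q x" "(q, r) \<in> ord t"
      using parent_below[of x r] X x by blast
    have "q \<in> X" using X(5) x q covers_ord by blast
    then have "q \<in> Y" using max[of q] q covers_ord by auto
    then show ?thesis using x \<open>x \<noteq> r\<close> q by blast
  qed
  then obtain v q where v: "v \<in> X" "v \<noteq> r" "covers t q v" "\<not> (v \<in> Y \<and> q \<in> Y)" "v \<in> Y \<or> q \<in> Y"
    by blast
  have "Z \<subseteq> D v \<or> Z \<inter> D v = {}" if Z: "Z \<in> \<tau>" "Z \<noteq> X" for Z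
  proof (rule ccontr)
    assume neg: "\<not> ?thesis"
    obtain k where k: "rtube Z k" using rtube_tube[OF tubs_tube[OF assms(1) Z(1)]] .
    have "v \<in> Z" "v \<noteq> k" using neg rtube_straddle[OF k] by blast+
    moreover from this have "q \<in> Z"
      using rtubeD[OF k] parent_le[OF v(3)] covers_ord[OF v(3)] by blast
    ultimately show False using cut Z v(4,5) by blast
  qed
  then show ?thesis using that v by blast
qed

text \<open>The restriction to either part stays maximal: a tube added inside the part is compatible
  with every tube of \<open>\<tau>\<close>, since these lie inside the part, avoid it or contain
  it.\<close>

lemma tubs_decomp:
  assumes "\<tau> \<in> tubs X" "rtube X r" "X \<noteq> {r}"
  obtains v \<tau>' \<tau>'' where "v \<in> X - {r}" "\<tau>' \<in> tubs (X - D v)" "\<tau>'' \<in> tubs (X \<inter> D v)"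
    "\<tau> = insert X (\<tau>' \<union> \<tau>'')"
proof -
  obtain v where v: "v \<in> X" "v \<noteq> r" and cut: "\<And>Z. Z \<in> \<tau> \<Longrightarrow> Z \<noteq> X \<Longrightarrow> Z \<subseteq> D v \<or> Z \<inter> D v = {}"
    using tubs_cut[OF assms] by blast
  note Pow = tubs_Pow[OF assms(1)]
  have sub: "{Z \<in> \<tau>. Z \<subseteq> Y} \<in> tubs Y"
    if "Y \<subseteq> X" "\<And>Z. Z \<in> \<tau> \<Longrightarrow> Z \<subseteq> Y \<or> Y \<inter> Z = {} \<or> Y \<subseteq> Z" for Y
  proof -
    have "\<sigma> \<subseteq> {Z \<in> \<tau>. Z \<subseteq> Y}" if "tubing t \<sigma>" "\<sigma> \<subseteq> Pow Y" "{Z \<in> \<tau>. Z \<subseteq> Y} \<subseteq> \<sigma>" for \<sigma>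
    proof -
      have "W \<in> \<tau>" if W: "W \<in> \<sigma>" for W
      proof (rule tubs_insert[OF assms(1)])
        show "tube t W" using W \<open>tubing t \<sigma>\<close> by (auto simp: tubing_def)
        show WX: "W \<subseteq> X" using W \<open>\<sigma> \<subseteq> Pow Y\<close> \<open>Y \<subseteq> X\<close> by blast
        fix Z assume "Z \<in> \<tau>"
        then consider "Z \<subseteq> Y" | "Y \<inter> Z = {}" | "Y \<subseteq> Z"
          using \<open>\<And>Z. Z \<in> \<tau> \<Longrightarrow> _\<close> by blast
        then show "Z \<inter> W = {} \<or> Z \<subseteq> W \<or> W \<subseteq> Z"
        proof cases
          case 1
          then have "Z \<in> \<sigma>" using \<open>Z \<in> \<tau>\<close> \<open>_ \<subseteq> \<sigma>\<close> by blast
          then show ?thesis using W tubing_nested[OF \<open>tubing t \<sigma>\<close>] by blast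
        qed (use W \<open>\<sigma> \<subseteq> Pow Y\<close> in blast)+
      qed
      then show ?thesis using that by blast
    qed
    moreover have "tubing t {Z \<in> \<tau>. Z \<subseteq> Y}"
      using tubs_tube[OF assms(1)] tubing_nested[OF tubs_tubing[OF assms(1)]]
      by (intro tubingI) auto
    ultimately show ?thesis by (intro tubsI) auto
  qed
  have "{Z \<in> \<tau>. Z \<subseteq> X - D v} \<in> tubs (X - D v)"
    by (rule sub) (use cut Pow in blast)+
  moreover have "{Z \<in> \<tau>. Z \<subseteq> X \<inter> D v} \<in> tubs (X \<inter> D v)"
    by (rule sub) (use cut Pow in blast)+
  moreover have "\<tau> = insert X ({Z \<in> \<tau>. Z \<subseteq> X - D v} \<union> {Z \<in> \<tau>. Z \<subseteq> X \<inter> D v})"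
  proof -
    have "Z \<subseteq> X - D v \<or> Z \<subseteq> X \<inter> D v" if "Z \<in> \<tau>" "Z \<noteq> X" for Z
      using cut[OF that] Pow that by auto
    then show ?thesis
      using tubs_top[OF assms(1,2)] by auto
  qed
  ultimately show ?thesis
    using that v by blast
qed

text \<open>The two parts are themselves tubes of the union. A tube compatible with both is
  \<open>X\<close> or lies in one of them, where the maximality of the given tubing applies.\<close>

lemma tubs_compose:
  assumes "rtube X r" "v \<in> X - {r}" "\<tau>' \<in> tubs (X - D v)" "\<tau>'' \<in> tubs (X \<inter> D v)"
  shows "insert X (\<tau>' \<union> \<tau>'') \<in> tubs X"
proof -
  let ?U = "X - D v" and ?L = "X \<inter> D v"
  have U: "rtube ?U r" and L: "rtube ?L v"
    using rtube_upper rtube_lower assms by blast+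
  have UL: "?U \<in> \<tau>'" "?L \<in> \<tau>''"
    using tubs_top U L assms by blast+
  have tubing: "tubing t (insert X (\<tau>' \<union> \<tau>''))"
  proof (rule tubingI)
    fix Y assume "Y \<in> insert X (\<tau>' \<union> \<tau>'')"
    then show "tube t Y"
      using tubs_tube assms tube_rtube by blast
  next
    fix Y Z assume "Y \<in> insert X (\<tau>' \<union> \<tau>'')" "Z \<in> insert X (\<tau>' \<union> \<tau>'')"
    then consider "Y = X \<or> Z = X" | "Y \<in> \<tau>' \<and> Z \<in> \<tau>'" | "Y \<in> \<tau>'' \<and> Z \<in> \<tau>''"
      | "Y \<in> \<tau>' \<and> Z \<in> \<tau>'' \<or> Z \<in> \<tau>' \<and> Y \<in> \<tau>''"
      by blast
    then show "Y \<inter> Z = {} \<or> Y \<subseteq> Z \<or> Z \<subseteq> Y"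
    proof cases
      case 1
      then show ?thesis using \<open>Y \<in> _\<close> \<open>Z \<in> _\<close> tubs_Pow[OF assms(3)] tubs_Pow[OF assms(4)] by blast
    next
      case 4
      then show ?thesis using tubs_Pow[OF assms(3)] tubs_Pow[OF assms(4)] by blast
    qed (use tubing_nested tubs_tubing assms in blast)+
  qed
  have max: "W \<in> insert X (\<tau>' \<union> \<tau>'')"
    if \<sigma>: "tubing t \<sigma>" "\<sigma> \<subseteq> Pow X" "insert X (\<tau>' \<union> \<tau>'') \<subseteq> \<sigma>" and W: "W \<in> \<sigma>" for \<sigma> W
  proof -
    have ne: "r \<in> ?U" "v \<in> ?L"
      using rtubeD(1)[OF U] rtubeD(1)[OF L] by blast+
    have "W \<inter> ?U = {} \<or> W \<subseteq> ?U \<or> ?U \<subseteq> W" "W \<inter> ?L = {} \<or> W \<subseteq> ?L \<or> ?L \<subseteq> W"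
      using tubing_nested[OF \<sigma>(1) W] \<sigma>(3) UL by blast+
    then consider "W = X" | "W \<subseteq> ?U" | "W \<subseteq> ?L"
      using ne W \<sigma>(2) by blast
    then show ?thesis
    proof cases
      case 2
      have "W \<in> \<tau>'"
        by (rule tubs_insert[OF assms(3)]) (use 2 W \<sigma> tubing_nested[OF \<sigma>(1) W] tubing_tube[OF \<sigma>(1) W] in blast)+
      then show ?thesis by blast
    next
      case 3
      have "W \<in> \<tau>''"
        by (rule tubs_insert[OF assms(4)]) (use 3 W \<sigma> tubing_nested[OF \<sigma>(1) W] tubing_tube[OF \<sigma>(1) W] in blast)+
      then show ?thesis by blast
    qed blast
  qed
  show ?thesis
    using tubs_Pow[OF assms(3)] tubs_Pow[OF assms(4)] by (intro tubsI tubing subsetI max) auto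
qed

lemma tubs_restrict:
  assumes "rtube X r" "v \<in> X - {r}" "\<tau>' \<in> tubs (X - D v)" "\<tau>'' \<in> tubs (X \<inter> D v)"
  shows "{Z \<in> insert X (\<tau>' \<union> \<tau>''). Z \<subseteq> X - D v} = \<tau>'"
    and "{Z \<in> insert X (\<tau>' \<union> \<tau>''). Z \<subseteq> X \<inter> D v} = \<tau>''"
proof -
  have ne: "r \<in> X - D v" "v \<in> X \<inter> D v"
    using rtube_upper[OF assms(1)] rtube_lower[OF assms(1)] assms rtubeD(1) by blast+
  have "\<And>Z. Z \<in> \<tau>' \<Longrightarrow> Z \<noteq> {} \<and> Z \<subseteq> X - D v" "\<And>Z. Z \<in> \<tau>'' \<Longrightarrow> Z \<noteq> {} \<and> Z \<subseteq> X \<inter> D v"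
    using tubs_tube assms tubs_Pow[OF assms(3)] tubs_Pow[OF assms(4)] by (auto simp: tube_def)
  then show "{Z \<in> insert X (\<tau>' \<union> \<tau>''). Z \<subseteq> X - D v} = \<tau>'"
    "{Z \<in> insert X (\<tau>' \<union> \<tau>''). Z \<subseteq> X \<inter> D v} = \<tau>''"
    using ne by blast+
qed

text \<open>For injectivity, \<open>X - D a\<close> is a proper tube containing \<open>r\<close>, so
  it lies in the upper part of any other decomposition. By symmetry the upper parts coincide, hence
  the lower ones, and \<open>v\<close> is recovered as the top of the lower part.\<close>

lemma tubs_bij:
  assumes "rtube X r" "X \<noteq> {r}"
  shows "bij_betw (\<lambda>(v, \<tau>', \<tau>''). insert X (\<tau>' \<union> \<tau>''))
     (SIGMA v:X - {r}. tubs (X - D v) \<times> tubs (X \<inter> D v)) (tubs X)"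
  unfolding bij_betw_def
proof
  show "inj_on (\<lambda>(v, \<tau>', \<tau>''). insert X (\<tau>' \<union> \<tau>''))
     (SIGMA v:X - {r}. tubs (X - D v) \<times> tubs (X \<inter> D v))"
  proof (rule inj_onI)
    fix p q
    assume p: "p \<in> (SIGMA v:X - {r}. tubs (X - D v) \<times> tubs (X \<inter> D v))"
      and q: "q \<in> (SIGMA v:X - {r}. tubs (X - D v) \<times> tubs (X \<inter> D v))"
      and pq: "(\<lambda>(v, \<tau>', \<tau>''). insert X (\<tau>' \<union> \<tau>'')) p = (\<lambda>(v, \<tau>', \<tau>''). insert X (\<tau>' \<union> \<tau>'')) q"
    obtain v1 \<tau>1' \<tau>1'' v2 \<tau>2' \<tau>2'' where pq': "p = (v1, \<tau>1', \<tau>1'')" "q = (v2, \<tau>2', \<tau>2'')"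
      by (metis prod_cases3)
    have v1: "v1 \<in> X" "v1 \<noteq> r" and t1: "\<tau>1' \<in> tubs (X - D v1)" "\<tau>1'' \<in> tubs (X \<inter> D v1)"
      and v2: "v2 \<in> X" "v2 \<noteq> r" and t2: "\<tau>2' \<in> tubs (X - D v2)" "\<tau>2'' \<in> tubs (X \<inter> D v2)"
      and eq: "insert X (\<tau>1' \<union> \<tau>1'') = insert X (\<tau>2' \<union> \<tau>2'')"
      using p q pq unfolding pq' by auto
    have sub: "X - D a \<subseteq> X - D b"
      if a: "a \<in> X" "a \<noteq> r" and ta: "\<tau>a' \<in> tubs (X - D a)" and b: "b \<in> X" "b \<noteq> r"
        and tb: "\<tau>b' \<in> tubs (X - D b)" "\<tau>b'' \<in> tubs (X \<inter> D b)"
        and sub: "\<tau>a' \<subseteq> insert X (\<tau>b' \<union> \<tau>b'')" for a \<tau>a' b \<tau>b' \<tau>b''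
    proof -
      have "X - D a \<in> \<tau>a'" using tubs_top[OF ta] rtube_upper[OF assms(1)] a by blast
      moreover have "r \<in> X - D a" "r \<in> X - D b" "a \<in> X \<inter> D a"
        using rtube_upper[OF assms(1)] rtube_lower[OF assms(1)] a b rtubeD(1) by blast+
      ultimately show ?thesis
        using sub tubs_Pow[OF tb(1)] tubs_Pow[OF tb(2)] by blast
    qed
    have UU: "X - D v1 = X - D v2"
      using sub[OF v1 t1(1) v2 t2] sub[OF v2 t2(1) v1 t1] eq by blast
    then have "X \<inter> D v1 = X \<inter> D v2" by blast
    then have v: "v1 = v2"
      using top_elem_rtube rtube_lower[OF assms(1)] v1 v2 by metis
    then show "p = q"
      unfolding pq'
      using tubs_restrict[OF assms(1) _ t1] tubs_restrict[OF assms(1) _ t2] eq v1 by auto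
  qed
  show "(\<lambda>(v, \<tau>', \<tau>''). insert X (\<tau>' \<union> \<tau>'')) ` (SIGMA v:X - {r}. tubs (X - D v) \<times> tubs (X \<inter> D v)) = tubs X"
  proof (intro equalityI subsetI)
    fix \<tau> assume "\<tau> \<in> tubs X"
    then obtain v \<tau>' \<tau>'' where "v \<in> X - {r}" "\<tau>' \<in> tubs (X - D v)" "\<tau>'' \<in> tubs (X \<inter> D v)"
      "\<tau> = insert X (\<tau>' \<union> \<tau>'')"
      using tubs_decomp assms by metis
    then show "\<tau> \<in> (\<lambda>(v, \<tau>', \<tau>''). insert X (\<tau>' \<union> \<tau>'')) ` (SIGMA v:X - {r}. tubs (X - D v) \<times> tubs (X \<inter> D v))"
      by (intro image_eqI[of _ _ "(v, \<tau>', \<tau>'')"]) auto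
  qed (use tubs_compose[OF assms(1)] in auto)
qed

end

subsection \<open>Cutting a binary tubing at an edge\<close>

context rtree
begin

lemma child_above_unique:
  assumes "covers t r c" "covers t r c'" "(v, c) \<in> ord t" "(v, c') \<in> ord t"
  shows "c = c'"
proof -
  have "\<not> (a \<noteq> b \<and> (a, b) \<in> ord t)" if "covers t r a" "covers t r b" for a b
    using that by (auto simp: covers_def)
  then show ?thesis
    using ord_chain[OF assms(3,4)] assms(1,2) by metis
qed

text \<open>The type of the upper tube created by a cut above \<open>v\<close>, as a function of
  \<open>v\<close>. The expression is that of \<open>pair_type\<close> with the tops
  \<open>r\<close> and \<open>v\<close> inserted.\<close>

definition etype :: "'v \<Rightarrow> 'v \<Rightarrow> 'e" where
  "etype r v = edec t r (THE c. c \<in> children t r \<and> (v, c) \<in> ord t)"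

lemma etype_eq:
  assumes "covers t r c" "(v, c) \<in> ord t"
  shows "etype r v = edec t r c"
proof -
  have "(THE c. c \<in> children t r \<and> (v, c) \<in> ord t) = c"
    using assms child_above_unique by (intro the_equality) (auto simp: children_def)
  then show ?thesis by (simp add: etype_def)
qed

lemma max_subtubes_restrict:
  assumes "{Z \<in> \<tau>. Z \<subseteq> U} = \<tau>'" "Y \<subseteq> U"
  shows "max_subtubes \<tau> Y = max_subtubes \<tau>' Y"
  using assms(2) unfolding max_subtubes_def assms(1)[symmetric] by blast

text \<open>The relation only inspects tubes contained in \<open>A \<union> B\<close>, so discarding
  tubes that do not lie in a larger set \<open>U\<close> does not affect it.\<close>

lemma upper_lower_restrict:
  assumes "{Z \<in> \<tau>. Z \<subseteq> U} = \<tau>'" "A \<union> B \<subseteq> U"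
  shows "upper_lower t \<tau> A B \<longleftrightarrow> upper_lower t \<tau>' A B"
proof -
  have "A \<union> B \<in> \<tau> \<longleftrightarrow> A \<union> B \<in> \<tau>'"
    using assms by blast
  then show ?thesis
    unfolding upper_lower_def max_subtubes_restrict[OF assms] by simp
qed

lemma upper_lower_mem:
  assumes "upper_lower t \<tau> A B"
  shows "A \<in> \<tau>" "B \<in> \<tau>" "A \<subset> A \<union> B" "A \<union> B \<in> \<tau>"
proof -
  have "A \<in> max_subtubes \<tau> (A \<union> B)" "B \<in> max_subtubes \<tau> (A \<union> B)"
    using assms by (auto simp: upper_lower_def)
  then show "A \<in> \<tau>" "B \<in> \<tau>" "A \<subset> A \<union> B" "A \<union> B \<in> \<tau>"
    using assms by (auto simp: upper_lower_def max_subtubes_def)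
qed

lemma upper_lower_singleton: "\<not> upper_lower t {{r}} A B"
proof
  assume "upper_lower t {{r}} A B"
  then show False
    using upper_lower_mem[of "{{r}}" A B] by auto
qed

lemma upper_tubes_mem:
  assumes "A \<in> upper_tubes t \<tau>"
  shows "A \<in> \<tau> \<and> (\<exists>B\<in>\<tau>. A \<subset> B)"
proof -
  obtain B where "upper_lower t \<tau> A B"
    using assms by (auto simp: upper_tubes_def)
  from upper_lower_mem[OF this] show ?thesis by blast
qed

lemma upper_tubes_of_type_subset: "upper_tubes_of_type t \<tau> e \<subseteq> upper_tubes t \<tau>"
  by (auto simp: upper_tubes_def upper_tubes_of_type_def)

end

locale tubing_cut = rtree t for t :: "('v, 'p, 'e) dtree" +
  fixes X :: "'v set" and r v :: 'v and \<tau>' \<tau>'' :: "'v set set"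
  assumes X: "rtube X r" and v: "v \<in> X - {r}"
    and up: "\<tau>' \<in> tubs (X - D v)" and low: "\<tau>'' \<in> tubs (X \<inter> D v)"
begin

abbreviation \<tau> :: "'v set set" where "\<tau> \<equiv> insert X (\<tau>' \<union> \<tau>'')"
abbreviation U :: "'v set" where "U \<equiv> X - D v"
abbreviation L :: "'v set" where "L \<equiv> X \<inter> D v"

lemma rtube_U: "rtube U r" and rtube_L: "rtube L v"
  using rtube_upper[OF X, of v] rtube_lower[OF X, of v] v by simp_all

lemma U_mem: "U \<in> \<tau>'" and L_mem: "L \<in> \<tau>''"
  using tubs_top[OF up rtube_U] tubs_top[OF low rtube_L] by simp_all

lemma r_U: "r \<in> U" "r \<in> X" and v_L: "v \<in> L"
  using rtubeD(1)[OF rtube_U] rtubeD(1)[OF rtube_L] by simp_all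

lemma fin: "finite \<tau>'" "finite \<tau>''" "finite X"
  using finite_tubs_elem[OF rtubeD(4)[OF rtube_U] up] finite_tubs_elem[OF rtubeD(4)[OF rtube_L] low]
    rtubeD(4)[OF X] by simp_all

lemma up_sub: "Z \<in> \<tau>' \<Longrightarrow> Z \<subseteq> U" and low_sub: "Z \<in> \<tau>'' \<Longrightarrow> Z \<subseteq> L"
  using tubs_Pow[OF up] tubs_Pow[OF low] by auto

lemma max_subtubes_X: "max_subtubes \<tau> X = {U, L}"
proof -
  have sub: "Z \<subseteq> U \<or> Z \<subseteq> L" if "Z \<in> \<tau>" "Z \<subset> X" for Z
    using that up_sub low_sub by blast
  have UL: "U \<subset> X" "L \<subset> X" "\<not> U \<subseteq> L" "\<not> L \<subseteq> U"
    using r_U v_L by blast+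
  have no: "\<not> (W \<subset> Z \<and> Z \<subset> X)" if "Z \<in> \<tau>" "W = U \<or> W = L" for Z W
    using sub[OF that(1)] UL(3,4) that(2) by blast
  have nex: "\<not> (\<exists>Z\<in>\<tau>. W \<subset> Z \<and> Z \<subset> X)" if "W = U \<or> W = L" for W
    using no[OF _ that] by blast
  have "U \<in> max_subtubes \<tau> X"
    unfolding max_subtubes_def
    by (intro CollectI conjI insertI2 UnI1 U_mem UL(1) nex disjI1 refl)
  moreover have "L \<in> max_subtubes \<tau> X"
    unfolding max_subtubes_def
    by (intro CollectI conjI insertI2 UnI2 L_mem UL(2) nex disjI2 refl)
  ultimately have "{U, L} \<subseteq> max_subtubes \<tau> X"
    by simp
  moreover have "max_subtubes \<tau> X \<subseteq> {U, L}"
  proof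
    fix Z assume "Z \<in> max_subtubes \<tau> X"
    then have Z: "Z \<in> \<tau>" "Z \<subset> X" "\<not> (\<exists>W\<in>\<tau>. Z \<subset> W \<and> W \<subset> X)"
      by (auto simp: max_subtubes_def)
    have "\<not> Z \<subset> U" "\<not> Z \<subset> L"
      using Z(3) UL U_mem L_mem by blast+
    then show "Z \<in> {U, L}"
      using sub[OF Z(1,2)] by blast
  qed
  ultimately show ?thesis by (rule equalityI[rotated])
qed

lemma upper_lower_UL: "upper_lower t \<tau> U L"
proof -
  have UL: "U \<union> L = X" by blast
  have 1: "U \<noteq> L" using r_U v_L by blast
  have 2: "\<forall>a\<in>U. \<forall>x\<in>X. (a, x) \<in> ord t \<longrightarrow> x \<in> U"
    using ord_trans unfolding D_def by blast
  have 3: "\<forall>b\<in>L. \<forall>x\<in>X. (x, b) \<in> ord t \<longrightarrow> x \<in> L"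
    using ord_trans unfolding D_def by blast
  show ?thesis
    unfolding upper_lower_def UL max_subtubes_X by (intro conjI 1 2 3 refl insertI1)
qed

text \<open>\<open>max_subtubes_X\<close> leaves open which part is the upper one. The upper one is
  an upset, whereas \<open>L\<close> contains \<open>v\<close> but not the element \<open>r\<close>
  above it.\<close>

lemma upper_lower_X:
  assumes "upper_lower t \<tau> A B" "A \<union> B = X"
  shows "A = U" "B = L"
proof -
  have *: "{A, B} = {U, L}" "\<forall>a\<in>A. \<forall>x\<in>X. (a, x) \<in> ord t \<longrightarrow> x \<in> A"
    using assms(1) unfolding upper_lower_def assms(2) max_subtubes_X by simp_all
  have "A \<noteq> L"
    using *(2) rtubeD(2)[OF X, of v] r_U v_L v by blast
  then show "A = U" "B = L"
    using *(1) by (auto simp: doubleton_eq_iff)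
qed

lemmas restrict = tubs_restrict[OF X v up low]

text \<open>The tube \<open>A \<union> B\<close> is \<open>X\<close>, which gives the pair of the
  cut, or it belongs to one of the two parts, where the relation is decided locally.\<close>

lemma upper_lower_cut:
  "upper_lower t \<tau> A B \<longleftrightarrow> (A = U \<and> B = L) \<or> upper_lower t \<tau>' A B \<or> upper_lower t \<tau>'' A B"
proof
  assume ul: "upper_lower t \<tau> A B"
  from upper_lower_mem(4)[OF ul] consider "A \<union> B = X" | "A \<union> B \<in> \<tau>'" | "A \<union> B \<in> \<tau>''" by blast
  then show "(A = U \<and> B = L) \<or> upper_lower t \<tau>' A B \<or> upper_lower t \<tau>'' A B"
  proof cases
    case 1 then show ?thesis using upper_lower_X[OF ul] by simp
  next
    case 2 show ?thesis
      using upper_lower_restrict[OF restrict(1) up_sub[OF 2]] ul by simp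
  next
    case 3 show ?thesis
      using upper_lower_restrict[OF restrict(2) low_sub[OF 3]] ul by simp
  qed
next
  assume "(A = U \<and> B = L) \<or> upper_lower t \<tau>' A B \<or> upper_lower t \<tau>'' A B"
  then show "upper_lower t \<tau> A B"
  proof (elim disjE)
    assume "upper_lower t \<tau>' A B"
    then show ?thesis
      using upper_lower_restrict[OF restrict(1) up_sub[OF upper_lower_mem(4)]] by blast
  next
    assume "upper_lower t \<tau>'' A B"
    then show ?thesis
      using upper_lower_restrict[OF restrict(2) low_sub[OF upper_lower_mem(4)]] by blast
  qed (simp add: upper_lower_UL)
qed

lemma pair_type_UL: "pair_type t U L = etype r v"
  unfolding pair_type_def etype_def top_elem_rtube[OF rtube_U] top_elem_rtube[OF rtube_L] ..

lemma upper_tubes_cut: "upper_tubes t \<tau> = insert U (upper_tubes t \<tau>' \<union> upper_tubes t \<tau>'')"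
  unfolding upper_tubes_def upper_lower_cut by blast

lemma upper_tubes_of_type_cut:
  "upper_tubes_of_type t \<tau> e =
     (if etype r v = e then {U} else {}) \<union> upper_tubes_of_type t \<tau>' e \<union> upper_tubes_of_type t \<tau>'' e"
  unfolding upper_tubes_of_type_def upper_lower_cut using pair_type_UL by auto

lemma utt_up: "A \<in> upper_tubes_of_type t \<tau>' e \<Longrightarrow> A \<in> \<tau>' \<and> A \<subset> U"
  using upper_tubes_mem upper_tubes_of_type_subset up_sub by blast

lemma utt_low: "A \<in> upper_tubes_of_type t \<tau>'' e \<Longrightarrow> A \<in> \<tau>'' \<and> A \<subseteq> L"
  using upper_tubes_mem upper_tubes_of_type_subset low_sub by blast

lemma finite_utt: "finite (upper_tubes_of_type t \<tau>' e)"
  by (rule finite_subset[OF _ fin(1)]) (use utt_up in blast)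

lemma top_elem_up: "A \<in> \<tau>' \<Longrightarrow> top_elem t A \<in> U" and top_elem_low: "A \<in> \<tau>'' \<Longrightarrow> top_elem t A \<in> L"
proof -
  show "top_elem t A \<in> U" if "A \<in> \<tau>'"
    using rtube_tube[OF tubs_tube[OF up that]] top_elem_rtube rtubeD(1) up_sub[OF that] by (metis subsetD)
  show "top_elem t A \<in> L" if "A \<in> \<tau>''"
    using rtube_tube[OF tubs_tube[OF low that]] top_elem_rtube rtubeD(1) low_sub[OF that] by (metis subsetD)
qed

lemma rk_root: "rk t \<tau> r e = rk t \<tau>' r e + (if etype r v = e then 1 else 0)"
proof -
  have "top_elem t A \<noteq> r" if "A \<in> upper_tubes_of_type t \<tau>'' e" for A
    using top_elem_low[of A] utt_low[OF that] r_U by auto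
  then have "{A \<in> upper_tubes_of_type t \<tau> e. top_elem t A = r} =
      (if etype r v = e then {U} else {}) \<union> {A \<in> upper_tubes_of_type t \<tau>' e. top_elem t A = r}"
    unfolding upper_tubes_of_type_cut
    using top_elem_rtube[OF rtube_U] by auto
  moreover have "U \<notin> upper_tubes_of_type t \<tau>' e"
    using utt_up by blast
  ultimately show ?thesis
    using finite_utt by (simp add: rk_def)
qed

lemma rk_up: "u \<in> U \<Longrightarrow> u \<noteq> r \<Longrightarrow> rk t \<tau> u e = rk t \<tau>' u e"
proof -
  assume u: "u \<in> U" "u \<noteq> r"
  have "{A \<in> upper_tubes_of_type t \<tau> e. top_elem t A = u} = {A \<in> upper_tubes_of_type t \<tau>' e. top_elem t A = u}"
    unfolding upper_tubes_of_type_cut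
    using top_elem_rtube[OF rtube_U] utt_low top_elem_low u by auto
  then show ?thesis by (simp add: rk_def)
qed

lemma rk_low: "u \<in> L \<Longrightarrow> rk t \<tau> u e = rk t \<tau>'' u e"
proof -
  assume u: "u \<in> L"
  have "{A \<in> upper_tubes_of_type t \<tau> e. top_elem t A = u} = {A \<in> upper_tubes_of_type t \<tau>'' e. top_elem t A = u}"
    unfolding upper_tubes_of_type_cut
    using top_elem_rtube[OF rtube_U] utt_up top_elem_up u r_U by auto
  then show ?thesis by (simp add: rk_def)
qed

lemma card_containing_root: "card {Z \<in> \<tau>. r \<in> Z} = Suc (card {Z \<in> \<tau>'. r \<in> Z})"
proof -
  have "{Z \<in> \<tau>. r \<in> Z} = insert X {Z \<in> \<tau>'. r \<in> Z}"
    using r_U low_sub by auto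
  moreover have "X \<notin> \<tau>'"
    using up_sub v_L by blast
  ultimately show ?thesis using fin by simp
qed

text \<open>\<open>U\<close> is the outermost upper tube containing the root and accounts for the
  additional one above \<open>A\<close>; the upper tubes of the lower part avoid
  \<open>r\<close>.\<close>

lemma upper_above_cut:
  assumes "A \<subset> U" "r \<in> A"
  shows "card {A' \<in> upper_tubes t \<tau>. r \<in> A' \<and> A \<subset> A'} = Suc (card {A' \<in> upper_tubes t \<tau>'. r \<in> A' \<and> A \<subset> A'})"
proof -
  have "r \<notin> A'" if "A' \<in> upper_tubes t \<tau>''" for A'
    using upper_tubes_mem[OF that] low_sub r_U by blast
  then have "{A' \<in> upper_tubes t \<tau>. r \<in> A' \<and> A \<subset> A'} = insert U {A' \<in> upper_tubes t \<tau>'. r \<in> A' \<and> A \<subset> A'}"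
    unfolding upper_tubes_cut using assms r_U by auto
  moreover have "U \<notin> upper_tubes t \<tau>'"
    using upper_tubes_mem up_sub by blast
  moreover have "finite (upper_tubes t \<tau>')"
    by (rule finite_subset[OF _ fin(1)]) (use upper_tubes_mem in blast)
  ultimately show ?thesis by simp
qed

lemma upper_above_U: "card {A' \<in> upper_tubes t \<tau>. r \<in> A' \<and> U \<subset> A'} = 0"
proof -
  have "\<not> U \<subset> A'" if "A' \<in> upper_tubes t \<tau>" "r \<in> A'" for A'
    using that upper_tubes_mem[of A' \<tau>'] upper_tubes_mem[of A' \<tau>''] up_sub low_sub r_U
    unfolding upper_tubes_cut by blast
  then show ?thesis by (auto simp: card_eq_0_iff)
qed

text \<open>No upper tube lies above \<open>U\<close>, so a bound of at least one discards it. For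
  the other upper tubes at the root, the count and the bound both drop by one.\<close>

lemma beta_cut:
  "{A \<in> upper_tubes_of_type t \<tau> e. r \<in> A \<and> Suc k \<le> card {A' \<in> upper_tubes t \<tau>. r \<in> A' \<and> A \<subset> A'}} =
   {A \<in> upper_tubes_of_type t \<tau>' e. r \<in> A \<and> k \<le> card {A' \<in> upper_tubes t \<tau>'. r \<in> A' \<and> A \<subset> A'}}"
  (is "?l = ?r")
proof -
  have "A \<in> ?l \<longleftrightarrow> A \<in> ?r" for A
  proof (cases "A \<in> upper_tubes_of_type t \<tau>' e")
    case True
    then have "A \<in> upper_tubes_of_type t \<tau> e" "A \<subset> U"
      using utt_up by (auto simp: upper_tubes_of_type_cut)
    then show ?thesis
      using True upper_above_cut[of A] by (cases "r \<in> A") (auto simp del: Un_iff insert_iff)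
  next
    case False
    have "A \<notin> ?l"
    proof
      assume A: "A \<in> ?l"
      then have "A = U \<or> A \<in> upper_tubes_of_type t \<tau>'' e"
        using False unfolding upper_tubes_of_type_cut by (auto split: if_splits)
      then have "A = U"
        using A utt_low r_U by blast
      then show False
        using A upper_above_U by simp
    qed
    then show ?thesis using False by simp
  qed
  then show ?thesis by blast
qed

end

subsection \<open>Sums over binary tubings\<close>

context rtree
begin

definition beta_at :: "('p \<Rightarrow> 'e set) \<Rightarrow> 'v \<Rightarrow> 'v set set \<Rightarrow> nat \<Rightarrow> 'e expo" where
  "beta_at E r \<tau> k = (\<Sum>e\<in>E (dec t r). Poly_Mapping.single e
     (card {A \<in> upper_tubes_of_type t \<tau> e. r \<in> A \<and>
              k - 1 \<le> card {A' \<in> upper_tubes t \<tau>. r \<in> A' \<and> A \<subset> A'}}))"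

definition mel_at ::
    "('p \<Rightarrow> 'e set) \<Rightarrow> ('p \<Rightarrow> 'e expo \<Rightarrow> 'k) \<Rightarrow> 'v set \<Rightarrow> 'v \<Rightarrow> 'v set set \<Rightarrow> 'k::comm_ring_1" where
  "mel_at E a X r \<tau> = (\<Prod>u\<in>X - {r}. a (dec t u) (rk_vec E t \<tau> u))"

text \<open>For \<open>c = a (dec t r)\<close> this is k! times the coefficient of L^k in the tubing
  sum. The root family \<open>c\<close> is a separate argument because the recursion at
  \<open>k = 1\<close> shifts it.\<close>

definition psi ::
    "('p \<Rightarrow> 'e set) \<Rightarrow> ('p \<Rightarrow> 'e expo \<Rightarrow> 'k) \<Rightarrow> ('e expo \<Rightarrow> 'k) \<Rightarrow> 'v set \<Rightarrow> 'v \<Rightarrow> nat \<Rightarrow> 'k::comm_ring_1" where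
  "psi E a c X r k = (\<Sum>\<tau>\<in>tubs X. mel_at E a X r \<tau> *
     (if k \<le> card {Z \<in> \<tau>. r \<in> Z} then c (beta_at E r \<tau> k) else 0))"

lemma card_containing_root_pos:
  assumes "rtube X r" "\<tau> \<in> tubs X"
  shows "Suc 0 \<le> card {Z \<in> \<tau>. r \<in> Z}"
proof -
  have "X \<in> {Z \<in> \<tau>. r \<in> Z}" "finite {Z \<in> \<tau>. r \<in> Z}"
    using tubs_top[OF assms(2,1)] rtubeD(1,4)[OF assms(1)] finite_tubs_elem[OF _ assms(2)] by auto
  then show ?thesis
    by (metis Suc_leI card_gt_0_iff empty_iff)
qed

lemma top_elem_eq_iff_mem:
  assumes "rtube X r" "\<tau> \<in> tubs X" "A \<in> \<tau>"
  shows "top_elem t A = r \<longleftrightarrow> r \<in> A"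
proof -
  obtain m where m: "rtube A m"
    using rtube_tube[OF tubs_tube[OF assms(2,3)]] .
  have "A \<subseteq> X" using tubs_Pow[OF assms(2)] assms(3) by auto
  then have "(m, r) \<in> ord t" using rtubeD(2)[OF assms(1), of m] rtubeD(1)[OF m] by auto
  then show ?thesis
    using top_elem_rtube[OF m] rtubeD(1)[OF m] rtubeD(2)[OF m, of r] ord_antisym[of m r] by auto
qed

text \<open>At \<open>k = 1\<close> nothing is excluded, and a tube inside \<open>X\<close> contains
  \<open>r\<close> exactly when \<open>r\<close> is its top.\<close>

lemma beta_at_first:
  assumes "rtube X r" "\<tau> \<in> tubs X"
  shows "beta_at E r \<tau> (Suc 0) = rk_vec E t \<tau> r"
proof -
  have "A \<in> \<tau>" if "A \<in> upper_tubes_of_type t \<tau> e" for A e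
    using upper_tubes_mem upper_tubes_of_type_subset that by blast
  then have "{A \<in> upper_tubes_of_type t \<tau> e. r \<in> A} = {A \<in> upper_tubes_of_type t \<tau> e. top_elem t A = r}" for e
    using top_elem_eq_iff_mem[OF assms] by blast
  then show ?thesis
    by (simp add: beta_at_def rk_vec_def rk_def)
qed

lemma psi_singleton:
  assumes "rtube {r} r"
  shows "psi E a c {r} r (Suc 0) = c 0" "psi E a c {r} r (Suc (Suc k)) = 0"
proof -
  have [simp]: "beta_at E r {{r}} k = 0" for k
    by (simp add: beta_at_def upper_tubes_of_type_def upper_lower_singleton)
  have [simp]: "{Z. Z = {r} \<and> r \<in> Z} = {{r}}"
    by auto
  show "psi E a c {r} r (Suc 0) = c 0" "psi E a c {r} r (Suc (Suc k)) = 0"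
    by (simp_all add: psi_def tubs_singleton[OF assms] mel_at_def)
qed

end

context tubing_cut
begin

lemma beta_at_cut: "beta_at E r \<tau> (Suc (Suc k)) = beta_at E r \<tau>' (Suc k)"
  using beta_cut[of _ k] by (simp add: beta_at_def)

lemma rk_vec_root:
  assumes "finite (E (dec t r))" "etype r v \<in> E (dec t r)"
  shows "rk_vec E t \<tau> r = rk_vec E t \<tau>' r + Poly_Mapping.single (etype r v) 1"
proof -
  have "(\<Sum>e\<in>E (dec t r). Poly_Mapping.single e (if etype r v = e then 1 else 0)) =
      (\<Sum>e\<in>E (dec t r). if etype r v = e then Poly_Mapping.single (etype r v) (1::nat) else 0)"
    by (intro sum.cong) auto
  also have "\<dots> = Poly_Mapping.single (etype r v) 1"
    using assms by (simp add: sum.delta)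
  finally show ?thesis
    by (simp add: rk_vec_def rk_root single_add sum.distrib)
qed

text \<open>\<open>v\<close> is not the root of \<open>X\<close> but is the root of the lower part,
  so its factor is missing from \<open>mel_at E a L v \<tau>''\<close> and appears
  separately.\<close>

lemma mel_at_cut:
  "mel_at E a X r \<tau> = mel_at E a U r \<tau>' * (a (dec t v) (rk_vec E t \<tau>'' v) * mel_at E a L v \<tau>'')"
proof -
  have L: "(\<Prod>u\<in>L. a (dec t u) (rk_vec E t \<tau> u)) = (\<Prod>u\<in>L. a (dec t u) (rk_vec E t \<tau>'' u))"
    using rk_low by (intro prod.cong) (auto simp: rk_vec_def)
  have U: "(\<Prod>u\<in>U - {r}. a (dec t u) (rk_vec E t \<tau> u)) = mel_at E a U r \<tau>'"
    unfolding mel_at_def using rk_up by (intro prod.cong) (auto simp: rk_vec_def)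
  have "X - {r} = (U - {r}) \<union> L"
    using r_U by blast
  then have "mel_at E a X r \<tau> =
      (\<Prod>u\<in>U - {r}. a (dec t u) (rk_vec E t \<tau> u)) * (\<Prod>u\<in>L. a (dec t u) (rk_vec E t \<tau> u))"
    unfolding mel_at_def using fin(3) by (simp only:) (subst prod.union_disjoint, auto)
  also have "(\<Prod>u\<in>L. a (dec t u) (rk_vec E t \<tau> u)) = a (dec t v) (rk_vec E t \<tau>'' v) * mel_at E a L v \<tau>''"
    unfolding L mel_at_def using v_L fin(3) by (intro prod.remove) auto
  finally show ?thesis
    unfolding U .
qed

end

context rtree
begin

lemma sum_tubs:
  assumes "rtube X r" "X \<noteq> {r}"
  shows "(\<Sum>\<tau>\<in>tubs X. g \<tau>) =
    (\<Sum>v\<in>X - {r}. \<Sum>\<tau>'\<in>tubs (X - D v). \<Sum>\<tau>''\<in>tubs (X \<inter> D v). g (insert X (\<tau>' \<union> \<tau>'')))"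
proof -
  have fin: "finite (X - {r})" "finite (tubs (X - D v))" "finite (tubs (X \<inter> D v))" for v
    using rtubeD(4)[OF assms(1)] finite_tubs by auto
  have "(\<Sum>\<tau>\<in>tubs X. g \<tau>) =
      (\<Sum>(v, p)\<in>(SIGMA v:X - {r}. tubs (X - D v) \<times> tubs (X \<inter> D v)). case p of (\<tau>', \<tau>'') \<Rightarrow> g (insert X (\<tau>' \<union> \<tau>'')))"
    using sum.reindex_bij_betw[OF tubs_bij[OF assms], of g] by (simp add: case_prod_beta)
  also have "\<dots> = (\<Sum>v\<in>X - {r}. \<Sum>(\<tau>', \<tau>'')\<in>tubs (X - D v) \<times> tubs (X \<inter> D v). g (insert X (\<tau>' \<union> \<tau>'')))"
    using fin by (subst sum.Sigma) auto
  also have "\<dots> = (\<Sum>v\<in>X - {r}. \<Sum>\<tau>'\<in>tubs (X - D v). \<Sum>\<tau>''\<in>tubs (X \<inter> D v). g (insert X (\<tau>' \<union> \<tau>'')))"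
    by (simp add: sum.cartesian_product)
  finally show ?thesis .
qed

lemma psi_first:
  assumes "rtube X r"
  shows "psi E a c X r (Suc 0) = (\<Sum>\<tau>\<in>tubs X. mel_at E a X r \<tau> * c (rk_vec E t \<tau> r))"
  unfolding psi_def using card_containing_root_pos[OF assms] beta_at_first[OF assms]
  by (intro sum.cong) auto

text \<open>At \<open>k = 1\<close> every upper tube with root \<open>r\<close> counts. The one
  created by the cut has type \<open>etype r v\<close>, hence the unit shift of \<open>c\<close>;
  the factor at \<open>v\<close> completes the sum over the lower tubings to their first
  coefficient.\<close>

lemma psi_first_cut:
  assumes "rtube X r" "X \<noteq> {r}" "finite (E (dec t r))" "\<And>v. v \<in> X - {r} \<Longrightarrow> etype r v \<in> E (dec t r)"
  shows "psi E a c X r (Suc 0) = (\<Sum>v\<in>X - {r}. psi E a (a (dec t v)) (X \<inter> D v) v (Suc 0) *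
      psi E a (\<lambda>\<alpha>. c (\<alpha> + Poly_Mapping.single (etype r v) 1)) (X - D v) r (Suc 0))"
  unfolding psi_first[OF assms(1)] sum_tubs[OF assms(1,2)]
proof (intro sum.cong refl)
  fix v assume v: "v \<in> X - {r}"
  have U: "rtube (X - D v) r" and L: "rtube (X \<inter> D v) v"
    using rtube_upper[OF assms(1), of v] rtube_lower[OF assms(1), of v] v by auto
  let ?l = "\<lambda>\<tau>' \<tau>''. mel_at E a X r (insert X (\<tau>' \<union> \<tau>'')) * c (rk_vec E t (insert X (\<tau>' \<union> \<tau>'')) r)"
  let ?r = "\<lambda>\<tau>' \<tau>''. (mel_at E a (X \<inter> D v) v \<tau>'' * a (dec t v) (rk_vec E t \<tau>'' v)) *
        (mel_at E a (X - D v) r \<tau>' * c (rk_vec E t \<tau>' r + Poly_Mapping.single (etype r v) 1))"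
  have "(\<Sum>\<tau>'\<in>tubs (X - D v). \<Sum>\<tau>''\<in>tubs (X \<inter> D v).
        ?l \<tau>' \<tau>'') =
      (\<Sum>\<tau>'\<in>tubs (X - D v). \<Sum>\<tau>''\<in>tubs (X \<inter> D v). ?r \<tau>' \<tau>'')"
  proof (intro sum.cong refl)
    fix \<tau>' \<tau>'' assume "\<tau>' \<in> tubs (X - D v)" "\<tau>'' \<in> tubs (X \<inter> D v)"
    then interpret tubing_cut t X r v \<tau>' \<tau>''
      using assms(1) v by unfold_locales
    show "?l \<tau>' \<tau>'' = ?r \<tau>' \<tau>''"
      by (simp only: mel_at_cut rk_vec_root[where E = E, OF assms(3) assms(4)[OF v]] mult_ac)
  qed
  then show "(\<Sum>\<tau>'\<in>tubs (X - D v). \<Sum>\<tau>''\<in>tubs (X \<inter> D v).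
        ?l \<tau>' \<tau>'') =
      psi E a (a (dec t v)) (X \<inter> D v) v (Suc 0) *
      psi E a (\<lambda>\<alpha>. c (\<alpha> + Poly_Mapping.single (etype r v) 1)) (X - D v) r (Suc 0)"
    unfolding psi_first[OF U] psi_first[OF L] by (simp only: sum_product sum.swap[of _ "tubs (X - D v)"])
qed

text \<open>From the second coefficient on, the tube created by the cut is among the excluded ones,
  so \<open>c\<close> stays fixed and only the index drops. For a single vertex both sides
  vanish.\<close>

lemma psi_Suc_cut:
  assumes "rtube X r"
  shows "psi E a c X r (Suc (Suc k)) = (\<Sum>v\<in>X - {r}. psi E a (a (dec t v)) (X \<inter> D v) v (Suc 0) *
      psi E a c (X - D v) r (Suc k))"
proof (cases "X = {r}")
  case True
  then show ?thesis using psi_singleton(2) assms by simp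
next
  case False
  show ?thesis
    unfolding psi_def[of _ _ _ X] sum_tubs[OF assms False]
  proof (intro sum.cong refl)
    fix v assume v: "v \<in> X - {r}"
    have L: "rtube (X \<inter> D v) v"
      using rtube_lower[OF assms, of v] v by auto
    let ?l = "\<lambda>\<tau>' \<tau>''. mel_at E a X r (insert X (\<tau>' \<union> \<tau>'')) *
          (if Suc (Suc k) \<le> card {Z \<in> insert X (\<tau>' \<union> \<tau>''). r \<in> Z}
           then c (beta_at E r (insert X (\<tau>' \<union> \<tau>'')) (Suc (Suc k))) else 0)"
    let ?r = "\<lambda>\<tau>' \<tau>''. (mel_at E a (X \<inter> D v) v \<tau>'' * a (dec t v) (rk_vec E t \<tau>'' v)) *
          (mel_at E a (X - D v) r \<tau>' *
            (if Suc k \<le> card {Z \<in> \<tau>'. r \<in> Z} then c (beta_at E r \<tau>' (Suc k)) else 0))"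
    have "(\<Sum>\<tau>'\<in>tubs (X - D v). \<Sum>\<tau>''\<in>tubs (X \<inter> D v). ?l \<tau>' \<tau>'') =
        (\<Sum>\<tau>'\<in>tubs (X - D v). \<Sum>\<tau>''\<in>tubs (X \<inter> D v). ?r \<tau>' \<tau>'')"
    proof (intro sum.cong refl)
      fix \<tau>' \<tau>'' assume "\<tau>' \<in> tubs (X - D v)" "\<tau>'' \<in> tubs (X \<inter> D v)"
      then interpret tubing_cut t X r v \<tau>' \<tau>''
        using assms v by unfold_locales
      show "?l \<tau>' \<tau>'' = ?r \<tau>' \<tau>''"
        by (simp only: mel_at_cut beta_at_cut card_containing_root Suc_le_mono mult_ac)
    qed
    then show "(\<Sum>\<tau>'\<in>tubs (X - D v). \<Sum>\<tau>''\<in>tubs (X \<inter> D v). ?l \<tau>' \<tau>'') =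
      psi E a (a (dec t v)) (X \<inter> D v) v (Suc 0) * psi E a c (X - D v) r (Suc k)"
      unfolding psi_first[OF L] psi_def[of _ _ _ "X - D v"]
      by (simp only: sum_product sum.swap[of _ "tubs (X - D v)"])
  qed
qed

end

subsection \<open>Polynomials in several variables\<close>

abbreviation (input) lookup where "lookup \<equiv> Poly_Mapping.lookup"
abbreviation (input) keys where "keys \<equiv> Poly_Mapping.keys"
abbreviation (input) single where "single \<equiv> Poly_Mapping.single"

lemma expo_size_superset:
  "finite A \<Longrightarrow> keys \<alpha> \<subseteq> A \<Longrightarrow> expo_size \<alpha> = (\<Sum>e\<in>A. lookup \<alpha> e)"
  unfolding expo_size_def by (intro sum.mono_neutral_left) (auto simp: in_keys_iff)

lemma expo_size_add: "expo_size (\<alpha> + \<beta>) = expo_size \<alpha> + expo_size \<beta>"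
proof -
  have "keys (\<alpha> + \<beta>) \<subseteq> keys \<alpha> \<union> keys \<beta>"
    by (rule Poly_Mapping.keys_add)
  then show ?thesis
    by (simp add: expo_size_superset[of "keys \<alpha> \<union> keys \<beta>"] lookup_add sum.distrib)
qed

lemma expo_size_single: "expo_size (single e n) = n"
  by (simp add: expo_size_superset[of "{e}"])

lemma expo_size_0: "expo_size 0 = 0"
  by (simp add: expo_size_def)

lemma expo_le_diff_add:
  assumes "expo_le \<beta> \<alpha>"
  shows "(\<alpha> - \<beta>) + \<beta> = \<alpha>"
  using assms by (intro poly_mapping_eqI) (simp add: lookup_add lookup_minus expo_le_def)

lemma expo_size_diff: "expo_le \<beta> \<alpha> \<Longrightarrow> expo_size (\<alpha> - \<beta>) = expo_size \<alpha> - expo_size \<beta>"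
  using expo_size_add[of "\<alpha> - \<beta>" \<beta>] expo_le_diff_add by fastforce

lemma expo_size_eq_0_iff: "expo_size \<alpha> = 0 \<longleftrightarrow> \<alpha> = 0"
  by (auto simp: expo_size_def poly_mapping_eq_iff fun_eq_iff in_keys_iff)

lemma expo_size_eq_1_iff: "expo_size \<alpha> = 1 \<longleftrightarrow> (\<exists>e. \<alpha> = single e 1)"
proof
  assume "expo_size \<alpha> = 1"
  then obtain e where e: "e \<in> keys \<alpha>" "lookup \<alpha> e = 1" "\<And>b. b \<in> keys \<alpha> \<Longrightarrow> b \<noteq> e \<Longrightarrow> lookup \<alpha> b = 0"
    unfolding expo_size_def by (subst (asm) sum_eq_1_iff) auto
  have "\<alpha> = single e 1"
    using e by (intro poly_mapping_eqI) (auto simp: lookup_single when_def in_keys_iff)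
  then show "\<exists>e. \<alpha> = single e 1" by blast
qed (auto simp: expo_size_single)

lemma expo_le_keys: "expo_le \<beta> \<alpha> \<Longrightarrow> keys \<beta> \<subseteq> keys \<alpha>"
  by (auto simp: expo_le_def in_keys_iff) (metis order.strict_trans2)

lemma finite_expo_le: "finite {\<beta>. expo_le \<beta> \<alpha>}"
proof (rule finite_imageD)
  let ?f = "\<lambda>\<beta>. restrict (lookup \<beta>) (keys \<alpha>)"
  show "finite (?f ` {\<beta>. expo_le \<beta> \<alpha>})"
    by (rule finite_subset[of _ "PiE (keys \<alpha>) (\<lambda>e. {..lookup \<alpha> e})"])
       (auto simp: expo_le_def intro!: finite_PiE)
  show "inj_on ?f {\<beta>. expo_le \<beta> \<alpha>}"
  proof (rule inj_onI)
    fix \<beta> \<gamma> assume *: "\<beta> \<in> {\<beta>. expo_le \<beta> \<alpha>}" "\<gamma> \<in> {\<beta>. expo_le \<beta> \<alpha>}" "?f \<beta> = ?f \<gamma>"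
    show "\<beta> = \<gamma>"
    proof (rule poly_mapping_eqI)
      fix e
      show "lookup \<beta> e = lookup \<gamma> e"
      proof (cases "e \<in> keys \<alpha>")
        case True
        then show ?thesis using fun_cong[OF *(3), of e] by simp
      next
        case False
        then have "lookup \<alpha> e = 0" by (simp add: in_keys_iff)
        then show ?thesis using * by (metis expo_le_def le_zero_eq mem_Collect_eq)
      qed
    qed
  qed
qed

lemma expo_diff_single_add:
  assumes "lookup \<alpha> e > 0"
  shows "\<alpha> - single e 1 + single e 1 = (\<alpha> :: 'e expo)"
  using assms by (intro expo_le_diff_add) (auto simp: expo_le_def lookup_single when_def)

lemma mpoly_sum_monomials: "(f :: ('e, 'k::comm_ring_1) mpoly) = (\<Sum>\<alpha>\<in>keys f. single \<alpha> (lookup f \<alpha>))"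
proof (rule poly_mapping_eqI)
  fix \<beta>
  have "lookup (\<Sum>\<alpha>\<in>keys f. single \<alpha> (lookup f \<alpha>)) \<beta> = (\<Sum>\<alpha>\<in>keys f. if \<alpha> = \<beta> then lookup f \<alpha> else 0)"
    by (simp add: lookup_sum lookup_single when_def)
  then show "lookup f \<beta> = lookup (\<Sum>\<alpha>\<in>keys f. single \<alpha> (lookup f \<alpha>)) \<beta>"
    by (simp add: in_keys_iff)
qed

lemma mpoly_induct [case_names single add]:
  fixes f :: "('e, 'k::comm_ring_1) mpoly"
  assumes "\<And>\<alpha> c. P (single \<alpha> c)" "\<And>f g. P f \<Longrightarrow> P g \<Longrightarrow> P (f + g)"
  shows "P f"
proof -
  have "P (\<Sum>\<alpha>\<in>A. single \<alpha> (lookup f \<alpha>))" if "finite A" for A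
    using that
  proof (induction A rule: finite_induct)
    case empty
    show ?case using assms(1)[of undefined 0] by simp
  qed (simp add: assms)
  then show ?thesis
    using mpoly_sum_monomials[of f] by (metis finite_keys)
qed

lemma lookup_mconst_mult: "lookup (mconst c * f) \<alpha> = c * lookup f (\<alpha> :: 'e expo)"
  unfolding mconst_def mult_map_scale_conv_mult[symmetric]
  by (simp add: Poly_Mapping.map.rep_eq when_def)

lemma mconst_mult_single: "mconst c * single \<alpha> x = single (\<alpha> :: 'e expo) (c * x)"
  by (simp add: mconst_def mult_single)

lemma mconst_add: "mconst (c + d) = mconst c + mconst d"
  by (simp add: mconst_def single_add)

lemma mconst_mult: "mconst (c * d) = (mconst c * mconst d :: ('e, 'k::comm_ring_1) mpoly)"
  by (simp add: mconst_def mult_single)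

lemma mconst_0: "mconst 0 = 0" and mconst_1: "mconst 1 = 1"
  by (simp_all add: mconst_def)

lemma mconst_of_nat: "mconst (of_nat n) = (of_nat n :: ('e, 'k::comm_ring_1) mpoly)"
  by (induction n) (simp_all add: mconst_0 mconst_1 mconst_add)

lemma mpolys_0: "0 \<in> mpolys Ep"
  by (simp add: mpolys_def)

lemma mpolys_add: "f \<in> mpolys Ep \<Longrightarrow> g \<in> mpolys Ep \<Longrightarrow> f + g \<in> mpolys Ep"
  using Poly_Mapping.keys_add[of f g] by (auto simp: mpolys_def)

lemma mpolys_single: "keys \<alpha> \<subseteq> Ep \<Longrightarrow> single \<alpha> c \<in> mpolys Ep"
  by (simp add: mpolys_def)

lemma mpolys_sum: "(\<And>x. x \<in> A \<Longrightarrow> g x \<in> mpolys Ep) \<Longrightarrow> sum g A \<in> mpolys Ep"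
  by (induction A rule: infinite_finite_induct) (auto simp: mpolys_0 mpolys_add)

lemma mpolys_mult:
  assumes "f \<in> mpolys Ep" "g \<in> mpolys Ep"
  shows "f * g \<in> mpolys Ep"
  unfolding mpolys_def
proof safe
  fix \<gamma> x assume "\<gamma> \<in> keys (f * g)" "x \<in> keys \<gamma>"
  then obtain \<alpha> \<beta> where "\<gamma> = \<alpha> + \<beta>" "\<alpha> \<in> keys f" "\<beta> \<in> keys g"
    using Poly_Mapping.keys_mult[of f g] by auto
  then show "x \<in> Ep"
    using assms Poly_Mapping.keys_add[of \<alpha> \<beta>] \<open>x \<in> keys \<gamma>\<close> unfolding mpolys_def by blast
qed

lemma mpolys_mconst: "mconst c \<in> mpolys Ep"
  by (simp add: mconst_def mpolys_single)

lemma mpolys_1: "(1 :: ('e, 'k::comm_ring_1) mpoly) \<in> mpolys Ep"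
  by (metis mpolys_mconst mconst_1)

lemma mpolys_prod:
  fixes g :: "'a \<Rightarrow> ('e, 'k::comm_ring_1) mpoly"
  shows "(\<And>x. x \<in> A \<Longrightarrow> g x \<in> mpolys Ep) \<Longrightarrow> prod g A \<in> mpolys Ep"
  by (induction A rule: infinite_finite_induct) (auto simp: mpolys_1 mpolys_mult)

subsection \<open>Partial derivatives\<close>

definition pd :: "'e \<Rightarrow> ('e, 'k::comm_ring_1) mpoly \<Rightarrow> ('e, 'k) mpoly" where
  "pd e f = (\<Sum>\<alpha>\<in>keys f. single (\<alpha> - single e 1) (lookup f \<alpha> * of_nat (lookup \<alpha> e)))"

text \<open>Subtraction of exponents is truncated: an exponent other than
  \<open>\<beta> + single e 1\<close> that is mapped to \<open>\<beta>\<close> does not involve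
  \<open>e\<close>, and its term has the factor zero.\<close>

lemma lookup_pd: "lookup (pd e f) \<beta> = lookup f (\<beta> + single e 1) * of_nat (lookup \<beta> e + 1)"
proof -
  let ?\<alpha> = "\<beta> + single e 1"
  have "(lookup f \<alpha> * of_nat (lookup \<alpha> e) when \<alpha> - single e 1 = \<beta>) =
      (if \<alpha> = ?\<alpha> then lookup f ?\<alpha> * of_nat (lookup \<beta> e + 1) else 0)" for \<alpha>
  proof (cases "\<alpha> = ?\<alpha>")
    case False
    then have "\<alpha> - single e 1 \<noteq> \<beta> \<or> lookup \<alpha> e = 0"
      using expo_diff_single_add[of \<alpha> e] by (metis gr0I)
    then show ?thesis using False by auto
  qed (simp add: lookup_add)
  then have "lookup (pd e f) \<beta> = (\<Sum>\<alpha>\<in>keys f. if \<alpha> = ?\<alpha> then lookup f ?\<alpha> * of_nat (lookup \<beta> e + 1) else 0)"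
    by (simp add: pd_def lookup_sum lookup_single)
  then show ?thesis
    by (simp add: in_keys_iff)
qed

lemma pd_add: "pd e (f + g) = pd e f + pd e g"
  by (rule poly_mapping_eqI) (simp add: lookup_pd lookup_add algebra_simps)

lemma pd_0: "pd e 0 = 0"
  by (simp add: pd_def)

lemma pd_sum: "pd e (sum g A) = (\<Sum>x\<in>A. pd e (g x))"
  by (induction A rule: infinite_finite_induct) (simp_all add: pd_0 pd_add)

lemma pd_single: "pd e (single \<alpha> c) = single (\<alpha> - single e 1) (c * of_nat (lookup \<alpha> e))"
  by (cases "c = 0") (simp_all add: pd_def)

text \<open>On monomials the exponents match only where the exponent of \<open>e\<close> is
  positive; elsewhere the coefficient is zero, which makes up for the truncated subtraction.\<close>

lemma pd_mult: "pd e (f * g) = pd e f * g + f * pd e g"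
proof (induction f rule: mpoly_induct)
  case (single \<alpha> c)
  show ?case
  proof (induction g rule: mpoly_induct)
    case (single \<beta> d)
    have 1: "\<alpha> + \<beta> - single e 1 = (\<alpha> - single e 1) + \<beta>" if "lookup \<alpha> e \<noteq> 0"
      using that by (intro poly_mapping_eqI) (auto simp: lookup_add lookup_minus lookup_single when_def)
    have 2: "\<alpha> + \<beta> - single e 1 = \<alpha> + (\<beta> - single e 1)" if "lookup \<beta> e \<noteq> 0"
      using that by (intro poly_mapping_eqI) (auto simp: lookup_add lookup_minus lookup_single when_def)
    have 3: "single (\<alpha> - single e 1 + \<beta>) (c * of_nat (lookup \<alpha> e) * d) =
        single (\<alpha> + \<beta> - single e 1) (c * d * of_nat (lookup \<alpha> e))"
      using 1 by (cases "lookup \<alpha> e = 0") (simp_all add: mult_ac)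
    have 4: "single (\<alpha> + (\<beta> - single e 1)) (c * (d * of_nat (lookup \<beta> e))) =
        single (\<alpha> + \<beta> - single e 1) (c * d * of_nat (lookup \<beta> e))"
      using 2 by (cases "lookup \<beta> e = 0") (simp_all add: mult_ac)
    show ?case
      unfolding mult_single pd_single 3 4 by (simp add: lookup_add single_add[symmetric] algebra_simps)
  qed (simp add: pd_add algebra_simps)
qed (simp add: pd_add algebra_simps)

lemma pd_mconst: "pd e (mconst c) = 0"
  by (simp add: mconst_def pd_single)

lemma pd_1: "pd e 1 = 0"
  using pd_mconst[of e 1] by (simp add: mconst_1)

lemma pd_prod:
  "finite A \<Longrightarrow> pd e (prod g A) = (\<Sum>x\<in>A. pd e (g x) * prod g (A - {x}))"
proof (induction A rule: finite_induct)
  case (insert y A)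
  have "(\<Sum>x\<in>A. pd e (g x) * prod g (insert y A - {x})) = g y * (\<Sum>x\<in>A. pd e (g x) * prod g (A - {x}))"
    unfolding sum_distrib_left
  proof (intro sum.cong refl)
    fix x assume "x \<in> A"
    then have "insert y A - {x} = insert y (A - {x})" using insert by auto
    then show "pd e (g x) * prod g (insert y A - {x}) = g y * (pd e (g x) * prod g (A - {x}))"
      using insert by (simp add: mult_ac)
  qed
  then show ?case
    using insert by (simp add: pd_mult)
qed (simp add: pd_1)

lemma mpolys_pd:
  assumes "f \<in> mpolys Ep"
  shows "pd e f \<in> mpolys Ep"
  unfolding pd_def
proof (intro mpolys_sum mpolys_single)
  fix \<alpha> assume "\<alpha> \<in> keys f"
  moreover have "keys (\<alpha> - single e 1) \<subseteq> keys \<alpha>"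
    by (auto simp: in_keys_iff lookup_minus)
  ultimately show "keys (\<alpha> - single e 1) \<subseteq> Ep"
    using assms by (auto simp: mpolys_def)
qed

lemma lookup_subst_var:
  "lookup (subst_var e f) \<alpha> = (if keys \<alpha> \<subseteq> {e} then coeff f (lookup \<alpha> e) else 0)"
proof -
  have "single e n = \<alpha> \<longleftrightarrow> keys \<alpha> \<subseteq> {e} \<and> n = lookup \<alpha> e" for n
    by (auto simp: poly_mapping_eq_iff fun_eq_iff lookup_single when_def in_keys_iff)
  then have "lookup (subst_var e f) \<alpha> =
      (\<Sum>n\<le>degree f. if n = lookup \<alpha> e then (if keys \<alpha> \<subseteq> {e} then coeff f n else 0) else 0)"
    unfolding subst_var_def lookup_sum lookup_single when_def by (intro sum.cong) auto
  then show ?thesis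
    by (auto simp: coeff_eq_0)
qed

lemma subst_var_add: "subst_var e (f + g) = subst_var e f + subst_var e g"
  by (rule poly_mapping_eqI) (simp add: lookup_subst_var lookup_add)

lemma subst_var_0: "subst_var e 0 = 0"
  by (rule poly_mapping_eqI) (simp add: lookup_subst_var)

lemma subst_var_sum: "subst_var e (sum g A) = (\<Sum>x\<in>A. subst_var e (g x))"
  by (induction A rule: infinite_finite_induct) (simp_all add: subst_var_0 subst_var_add)

lemma subst_var_smult: "subst_var e (smult c f) = mconst c * subst_var e f"
  by (rule poly_mapping_eqI) (simp add: lookup_subst_var lookup_mconst_mult)

lemma subst_var_pCons_const: "subst_var e [:c:] = mconst c"
  by (simp add: subst_var_def mconst_def)

lemma subst_var_1: "subst_var e 1 = 1"
  using subst_var_pCons_const[of e 1] by (simp add: mconst_1 one_pCons)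

lemma mpolys_subst_var: "e \<in> Ep \<Longrightarrow> subst_var e f \<in> mpolys Ep"
  unfolding subst_var_def by (intro mpolys_sum mpolys_single) (auto split: if_splits)

lemma pd_subst_var: "pd e (subst_var e' f) = (if e = e' then subst_var e' (pderiv f) else 0)"
proof (rule poly_mapping_eqI)
  fix \<beta> :: "'a expo"
  have "keys (\<beta> + single e 1) = insert e (keys \<beta>)"
    by (auto simp: in_keys_iff lookup_add lookup_single when_def split: if_splits)
  then show "lookup (pd e (subst_var e' f)) \<beta> =
      lookup (if e = e' then subst_var e' (pderiv f) else 0) \<beta>"
    by (simp add: lookup_pd lookup_subst_var lookup_add coeff_pderiv algebra_simps)
qed

text \<open>For \<open>c\<close> the coefficients of a 1-cocycle \<Lambda>, this is the functional f
  \<mapsto> [L] \<Lambda>(f). The factor |\<alpha>|! is the multinomial coefficient in the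
  normalisation of A_p times the product of the factorials of the entries of \<alpha>, which
  differentiating L^\<alpha> produces.\<close>

definition dual :: "('e expo \<Rightarrow> 'k) \<Rightarrow> ('e, 'k::field_char_0) mpoly \<Rightarrow> 'k" where
  "dual c f = (\<Sum>\<alpha>\<in>keys f. lookup f \<alpha> * fact (expo_size \<alpha>) * c \<alpha>)"

lemma dual_superset:
  "finite A \<Longrightarrow> keys f \<subseteq> A \<Longrightarrow> dual c f = (\<Sum>\<alpha>\<in>A. lookup f \<alpha> * fact (expo_size \<alpha>) * c \<alpha>)"
  unfolding dual_def by (intro sum.mono_neutral_left) (auto simp: in_keys_iff)

lemma dual_add: "dual c (f + g) = dual c f + dual c g"
proof -
  have "keys (f + g) \<subseteq> keys f \<union> keys g"
    by (rule Poly_Mapping.keys_add)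
  then show ?thesis
    by (simp add: dual_superset[of "keys f \<union> keys g"] lookup_add sum.distrib algebra_simps)
qed

lemma dual_0: "dual c 0 = 0"
  by (simp add: dual_def)

lemma dual_sum: "dual c (sum g A) = (\<Sum>x\<in>A. dual c (g x))"
  by (induction A rule: infinite_finite_induct) (simp_all add: dual_0 dual_add)

lemma dual_single: "dual c (single \<alpha> x) = x * fact (expo_size \<alpha>) * c \<alpha>"
  by (simp add: dual_superset[of "{\<alpha>}"])

lemma dual_mconst_mult: "dual c (mconst x * f) = x * dual c f"
proof -
  have "keys (mconst x * f) \<subseteq> keys f"
    by (auto simp: in_keys_iff lookup_mconst_mult)
  then show ?thesis
    by (simp add: dual_superset[of "keys f"] lookup_mconst_mult sum_distrib_left mult.assoc)
qed

lemma dual_1: "dual c 1 = c 0"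
  using dual_single[of c 0 1] by (simp add: expo_size_0)

text \<open>The recursion \<open>|\<alpha>|! = \<Sum>\<^sub>e \<alpha>\<^sub>e (|\<alpha>| - 1)!\<close> for \<open>\<alpha> \<noteq> 0\<close>.\<close>

lemma dual_shift:
  assumes "finite Ep" "f \<in> mpolys Ep"
  shows "dual c f = lookup f 0 * c 0 + (\<Sum>e\<in>Ep. dual (\<lambda>\<alpha>. c (\<alpha> + single e 1)) (pd e f))"
proof -
  have mono: "dual c (single \<alpha> x) = lookup (single \<alpha> x) 0 * c 0 +
      (\<Sum>e\<in>Ep. dual (\<lambda>\<alpha>. c (\<alpha> + single e 1)) (pd e (single \<alpha> x)))" if "keys \<alpha> \<subseteq> Ep" for \<alpha> :: "'a expo" and x
  proof (cases "\<alpha> = 0")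
    case True
    then show ?thesis by (simp add: dual_single pd_single dual_0 expo_size_0)
  next
    case False
    then obtain n where n: "expo_size \<alpha> = Suc n"
      using expo_size_eq_0_iff[of \<alpha>] by (cases "expo_size \<alpha>") auto
    \<comment> \<open>The shift of \<open>c\<close> undoes the subtraction in the derivative, so
      each \<open>e\<close> contributes the same \<open>c \<alpha>\<close>, weighted by its
      exponent; the weights add up to \<open>expo_size \<alpha>\<close>.\<close>
    have "dual (\<lambda>\<alpha>. c (\<alpha> + single e 1)) (pd e (single \<alpha> x)) = x * c \<alpha> * fact n * of_nat (lookup \<alpha> e)" for e
    proof (cases "lookup \<alpha> e = 0")
      case False
      then have "expo_size (\<alpha> - single e 1) = n"
        using expo_size_add[of "\<alpha> - single e 1" "single e 1"] n
        by (simp add: expo_diff_single_add[simplified] expo_size_single)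
      then show ?thesis
        using False by (simp add: pd_single dual_single expo_diff_single_add[simplified] mult_ac)
    qed (simp add: pd_single dual_0)
    then have "(\<Sum>e\<in>Ep. dual (\<lambda>\<alpha>. c (\<alpha> + single e 1)) (pd e (single \<alpha> x))) =
        x * c \<alpha> * fact n * of_nat (expo_size \<alpha>)"
      by (simp only: sum_distrib_left[symmetric] of_nat_sum[symmetric] expo_size_superset[OF assms(1) that])
    also have "\<dots> = dual c (single \<alpha> x)"
      by (simp add: n dual_single algebra_simps)
    finally show ?thesis
      using False by (simp add: lookup_single)
  qed
  have "dual c f = (\<Sum>\<alpha>\<in>keys f. dual c (single \<alpha> (lookup f \<alpha>)))"
    unfolding dual_single by (simp add: dual_def)
  also have "\<dots> = (\<Sum>\<alpha>\<in>keys f. lookup (single \<alpha> (lookup f \<alpha>)) 0 * c 0 +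
      (\<Sum>e\<in>Ep. dual (\<lambda>\<alpha>. c (\<alpha> + single e 1)) (pd e (single \<alpha> (lookup f \<alpha>)))))"
    using assms(2) by (intro sum.cong refl mono) (auto simp: mpolys_def)
  also have "\<dots> = (\<Sum>\<alpha>\<in>keys f. lookup (single \<alpha> (lookup f \<alpha>)) 0) * c 0 +
      (\<Sum>e\<in>Ep. dual (\<lambda>\<alpha>. c (\<alpha> + single e 1)) (\<Sum>\<alpha>\<in>keys f. pd e (single \<alpha> (lookup f \<alpha>))))"
    by (simp add: sum.distrib sum_distrib_right dual_sum sum.swap[of _ Ep])
  also have "\<dots> = lookup f 0 * c 0 + (\<Sum>e\<in>Ep. dual (\<lambda>\<alpha>. c (\<alpha> + single e 1)) (pd e f))"
    by (simp only: pd_sum[symmetric] lookup_sum[symmetric] mpoly_sum_monomials[symmetric])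
  finally show ?thesis .
qed

subsection \<open>Coefficients of a 1-cocycle\<close>

definition total_deriv :: "'e set \<Rightarrow> ('e, 'k::comm_ring_1) mpoly \<Rightarrow> ('e, 'k) mpoly" where
  "total_deriv Ep f = (\<Sum>e\<in>Ep. pd e f)"

lemma mpolys_total_deriv: "f \<in> mpolys Ep \<Longrightarrow> total_deriv Ep f \<in> mpolys Ep"
  unfolding total_deriv_def by (intro mpolys_sum mpolys_pd)

lemma coeff_coproduct: "coeff (coeff (coproduct p) i) j = of_nat ((i + j) choose i) * coeff p (i + j)"
proof -
  let ?x = "[:[:0, 1:], 1:] :: 'a poly poly"
  let ?m = "map_poly (\<lambda>c. [:[:c:]:]) p"
  have cm: "coeff ?m n = [:[:coeff p n:]:]" for n
    by (simp add: coeff_map_poly)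
  have x: "coeff (?x ^ n) i = (if i \<le> n then of_nat (n choose i) * [:0, 1:] ^ (n - i) else 0)" for n
  proof (cases "i \<le> n")
    case False
    have "degree (?x ^ n) \<le> n"
      by (rule order.trans[OF degree_power_le]) simp
    with False show ?thesis by (simp add: coeff_eq_0)
  qed (simp add: coeff_linear_poly_power)
  have "[:0, 1:] + [:[:0, 1:]:] = ?x" by simp
  then have "coproduct p = (\<Sum>n\<le>degree ?m. [:[:coeff p n:]:] * ?x ^ n)"
    by (simp add: coproduct_def poly_altdef cm)
  \<comment> \<open>The range is extended so that it includes \<open>i + j\<close>, the index of the
    only surviving term.\<close>
  also have "\<dots> = (\<Sum>n\<le>degree ?m + i + j. [:[:coeff p n:]:] * ?x ^ n)"
    by (intro sum.mono_neutral_left) (auto simp: coeff_eq_0 cm[symmetric])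
  finally have "coeff (coproduct p) i = (\<Sum>n\<le>degree ?m + i + j. smult (coeff p n)
      (if i \<le> n then of_nat (n choose i) * [:0, 1:] ^ (n - i) else 0))"
    by (simp add: coeff_sum x)
  then have "coeff (coeff (coproduct p) i) j = (\<Sum>n\<le>degree ?m + i + j. coeff p n *
      coeff (if i \<le> n then of_nat (n choose i) * [:0, 1:] ^ (n - i) else 0) j)"
    by (simp add: coeff_sum)
  also have "\<dots> = (\<Sum>n\<le>degree ?m + i + j. if n = i + j then of_nat ((i + j) choose i) * coeff p (i + j) else 0)"
  proof (intro sum.cong refl)
    fix n
    have "coeff (of_nat (n choose i) * [:0, 1:] ^ (n - i)) j =
        (of_nat (n choose i) * (if j = n - i then 1 else 0) :: 'a)"
      using coeff_monom_mult[of 1 "n - i" 1 j] by (simp add: of_nat_poly monom_altdef[symmetric])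
    then show "coeff p n * coeff (if i \<le> n then of_nat (n choose i) * [:0, 1:] ^ (n - i) else 0) j =
        (if n = i + j then of_nat ((i + j) choose i) * coeff p (i + j) else 0)"
      by (auto simp: mult_ac)
  qed
  finally show ?thesis
    by simp
qed

lemma coeff_tensor_one: "coeff (coeff (tensor_one p) i) j = (if j = 0 then coeff p i else 0)"
  unfolding tensor_one_def by (subst coeff_map_poly) (auto split: nat.split simp: coeff_pCons)

lemma sum_expo_le_filter:
  "(\<Sum>\<beta> | expo_le \<beta> \<alpha>. if P \<beta> then g \<beta> else 0) = (\<Sum>\<beta> | expo_le \<beta> \<alpha> \<and> P \<beta>. g \<beta>)"
  using sum.inter_filter[OF finite_expo_le, where g = g and P = P] by simp

lemma coeff_coaction: "coeff (coaction f) m = (\<Sum>\<alpha>\<in>keys f. \<Sum>\<beta> | expo_le \<beta> \<alpha> \<and> expo_size \<alpha> - expo_size \<beta> = m.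
     single \<beta> (lookup f \<alpha> * of_nat (expo_binom \<alpha> \<beta>)))"
proof -
  have "coeff (coaction f) m = (\<Sum>\<alpha>\<in>keys f. \<Sum>\<beta> | expo_le \<beta> \<alpha>. if expo_size \<alpha> - expo_size \<beta> = m then
     single \<beta> (lookup f \<alpha> * of_nat (expo_binom \<alpha> \<beta>)) else 0)"
    by (simp add: coaction_def coeff_sum)
  also have "\<dots> = (\<Sum>\<alpha>\<in>keys f. \<Sum>\<beta> | expo_le \<beta> \<alpha> \<and> expo_size \<alpha> - expo_size \<beta> = m.
     single \<beta> (lookup f \<alpha> * of_nat (expo_binom \<alpha> \<beta>)))"
    by (simp only: sum_expo_le_filter)
  finally show ?thesis .
qed

lemma mpolys_coaction:
  assumes "f \<in> mpolys Ep"
  shows "coeff (coaction f) m \<in> mpolys Ep"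
  unfolding coeff_coaction
proof (intro mpolys_sum mpolys_single)
  fix \<alpha> \<beta> assume "\<alpha> \<in> keys f" "\<beta> \<in> {\<beta>. expo_le \<beta> \<alpha> \<and> expo_size \<alpha> - expo_size \<beta> = m}"
  then show "keys \<beta> \<subseteq> Ep"
    using assms expo_le_keys[of \<beta> \<alpha>] by (auto simp: mpolys_def)
qed

lemma expo_le_same_size:
  assumes "expo_le \<beta> \<alpha>" "expo_size \<alpha> - expo_size \<beta> = 0"
  shows "\<beta> = \<alpha>"
proof -
  have "expo_size (\<alpha> - \<beta>) = 0" using assms expo_size_diff by metis
  then show ?thesis using expo_le_diff_add[OF assms(1)] by (simp add: expo_size_eq_0_iff)
qed

lemma coeff_coaction_0: "coeff (coaction f) 0 = f"
proof -
  have "{\<beta>. expo_le \<beta> \<alpha> \<and> expo_size \<alpha> - expo_size \<beta> = 0} = {\<alpha>}" for \<alpha> :: "'a expo"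
    using expo_le_same_size by (auto simp: expo_le_def)
  then show ?thesis
    unfolding coeff_coaction by (simp add: expo_binom_def mpoly_sum_monomials[symmetric])
qed

text \<open>The coaction is the translation of every variable L_e to L_e + L; its part linear in L
  is the sum of the partial derivatives.\<close>

lemma coeff_coaction_1:
  assumes "finite Ep" "f \<in> mpolys Ep"
  shows "coeff (coaction f) 1 = total_deriv Ep f"
proof -
  have mono: "(\<Sum>\<beta> | expo_le \<beta> \<alpha> \<and> expo_size \<alpha> - expo_size \<beta> = 1. single \<beta> (x * of_nat (expo_binom \<alpha> \<beta>))) =
      (\<Sum>e\<in>Ep. pd e (single \<alpha> x))" if "keys \<alpha> \<subseteq> Ep" for \<alpha> :: "'a expo" and x :: 'b
  proof -
    have set: "{\<beta>. expo_le \<beta> \<alpha> \<and> expo_size \<alpha> - expo_size \<beta> = 1} = (\<lambda>e. \<alpha> - single e 1) ` keys \<alpha>"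
    proof (intro equalityI subsetI)
      fix \<beta> assume "\<beta> \<in> {\<beta>. expo_le \<beta> \<alpha> \<and> expo_size \<alpha> - expo_size \<beta> = 1}"
      then have *: "expo_le \<beta> \<alpha>" "expo_size (\<alpha> - \<beta>) = 1"
        by (simp_all add: expo_size_diff)
      then obtain e where e: "\<alpha> - \<beta> = single e 1" using iffD1[OF expo_size_eq_1_iff *(2)] by (elim exE)
      then have \<alpha>: "\<alpha> = single e 1 + \<beta>" using expo_le_diff_add[OF *(1)] by simp
      then have "\<beta> = \<alpha> - single e 1" "e \<in> keys \<alpha>" by (auto simp: in_keys_iff lookup_add)
      then show "\<beta> \<in> (\<lambda>e. \<alpha> - single e 1) ` keys \<alpha>" by blast
    next
      fix \<beta> assume "\<beta> \<in> (\<lambda>e. \<alpha> - single e 1) ` keys \<alpha>"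
      then obtain e where e: "e \<in> keys \<alpha>" "\<beta> = \<alpha> - single e 1" by blast
      then have \<alpha>: "\<beta> + single e 1 = \<alpha>" using expo_diff_single_add[of \<alpha> e] by (auto simp: in_keys_iff)
      have "expo_le \<beta> \<alpha>" by (auto simp: expo_le_def e(2) lookup_minus)
      moreover have "expo_size \<alpha> - expo_size \<beta> = 1"
        by (simp add: \<alpha>[symmetric] expo_size_add expo_size_single del: One_nat_def)
      ultimately show "\<beta> \<in> {\<beta>. expo_le \<beta> \<alpha> \<and> expo_size \<alpha> - expo_size \<beta> = 1}" by blast
    qed
    have inj: "inj_on (\<lambda>e. \<alpha> - single e 1) (keys \<alpha>)"
    proof (rule inj_onI)
      fix e e' assume *: "e \<in> keys \<alpha>" "e' \<in> keys \<alpha>" "\<alpha> - single e 1 = \<alpha> - single e' 1"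
      then have "lookup (\<alpha> - single e 1) e = lookup (\<alpha> - single e' 1) e" by simp
      with *(1) show "e = e'" by (auto simp: lookup_minus lookup_single when_def in_keys_iff split: if_splits)
    qed
    have binom: "expo_binom \<alpha> (\<alpha> - single e 1) = lookup \<alpha> e" if "e \<in> keys \<alpha>" for e
    proof -
      have "expo_binom \<alpha> (\<alpha> - single e 1) = (\<Prod>e'\<in>keys \<alpha>. if e' = e then lookup \<alpha> e else 1)"
        unfolding expo_binom_def
      proof (intro prod.cong refl)
        fix e'
        have "lookup \<alpha> e choose (lookup \<alpha> e - Suc 0) = lookup \<alpha> e"
          using that by (cases "lookup \<alpha> e") (auto simp: in_keys_iff binomial_symmetric[of "_" "Suc _"])
        then show "lookup \<alpha> e' choose lookup (\<alpha> - single e 1) e' = (if e' = e then lookup \<alpha> e else 1)"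
          by (auto simp: lookup_minus lookup_single when_def)
      qed
      then show ?thesis using that by simp
    qed
    have "(\<Sum>\<beta> | expo_le \<beta> \<alpha> \<and> expo_size \<alpha> - expo_size \<beta> = 1. single \<beta> (x * of_nat (expo_binom \<alpha> \<beta>))) =
        (\<Sum>e\<in>keys \<alpha>. pd e (single \<alpha> x))"
      unfolding set sum.reindex[OF inj] o_def by (intro sum.cong refl) (simp only: pd_single binom)
    also have "\<dots> = (\<Sum>e\<in>Ep. pd e (single \<alpha> x))"
      using that assms(1) by (intro sum.mono_neutral_left) (auto simp: pd_single in_keys_iff)
    finally show ?thesis .
  qed
  have "coeff (coaction f) 1 = (\<Sum>\<alpha>\<in>keys f. \<Sum>e\<in>Ep. pd e (single \<alpha> (lookup f \<alpha>)))"
    unfolding coeff_coaction using assms(2) by (intro sum.cong refl mono) (auto simp: mpolys_def)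
  also have "\<dots> = total_deriv Ep (\<Sum>\<alpha>\<in>keys f. single \<alpha> (lookup f \<alpha>))"
    unfolding total_deriv_def pd_sum by (rule sum.swap)
  finally show ?thesis
    by (simp only: mpoly_sum_monomials[symmetric])
qed

section \<open>Coefficients of maps given by an integral\<close>

lemma ffact_gbinomial: "ffact (x :: 'k::field_char_0) k = fact k * (x gchoose k)"
  by (simp add: ffact_def gbinomial_prod_rev atLeast0LessThan)

lemma ffact_of_nat: "ffact (of_nat n :: 'k::field_char_0) k = fact k * of_nat (n choose k)"
  by (simp add: ffact_gbinomial binomial_gbinomial)

lemma coeff_poly_integral_0: "coeff (poly_integral g) 0 = 0"
  by (simp add: poly_integral_def coeff_sum)

lemma coeff_poly_integral_Suc: "coeff (poly_integral g) (Suc n) = coeff g n / of_nat (Suc n)"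
  by (simp add: poly_integral_def coeff_sum coeff_eq_0)

lemma set_equal_superset:
  assumes "finite A" "keys f \<subseteq> A"
  shows "set_equal f = (\<Sum>\<alpha>\<in>A. monom (lookup f \<alpha>) (expo_size \<alpha>))"
  unfolding set_equal_def using assms by (intro sum.mono_neutral_left) (auto simp: in_keys_iff)

lemma set_equal_add: "set_equal (f + g) = set_equal f + set_equal g"
proof -
  have "keys (f + g) \<subseteq> keys f \<union> keys g"
    by (rule Poly_Mapping.keys_add)
  then show ?thesis
    by (simp add: set_equal_superset[of "keys f \<union> keys g"] lookup_add add_monom[symmetric] sum.distrib)
qed

lemma set_equal_sum: "set_equal (sum g A) = (\<Sum>x\<in>A. set_equal (g x))"
  by (induction A rule: infinite_finite_induct) (simp_all add: set_equal_add, simp_all add: set_equal_def)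

lemma set_equal_single: "set_equal (single \<alpha> x) = monom x (expo_size \<alpha>)"
  by (simp add: set_equal_superset[of "{\<alpha>}"])

lemma prod_ffact_multinom:
  assumes "expo_le \<gamma> \<alpha>"
  shows "multinom \<gamma> * (\<Prod>e\<in>keys \<gamma>. ffact (of_nat (lookup \<alpha> e)) (lookup \<gamma> e)) =
    (fact (expo_size \<gamma>) * of_nat (expo_binom \<alpha> \<gamma>) :: 'k::field_char_0)"
proof -
  have "expo_binom \<alpha> \<gamma> = (\<Prod>e\<in>keys \<gamma>. lookup \<alpha> e choose lookup \<gamma> e)"
    unfolding expo_binom_def using expo_le_keys[OF assms]
    by (intro prod.mono_neutral_right) (auto simp: in_keys_iff)
  then show ?thesis
    by (simp add: multinom_def ffact_of_nat prod.distrib)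
qed

lemma prod_ffact_not_le:
  assumes "\<not> expo_le \<gamma> \<alpha>"
  shows "(\<Prod>e\<in>keys \<gamma>. ffact (of_nat (lookup \<alpha> e)) (lookup \<gamma> e)) = (0 :: 'k::field_char_0)"
proof -
  obtain e where "lookup \<alpha> e < lookup \<gamma> e"
    using assms by (auto simp: expo_le_def not_le)
  then have "e \<in> keys \<gamma>" "ffact (of_nat (lookup \<alpha> e) :: 'k) (lookup \<gamma> e) = 0"
    by (auto simp: in_keys_iff ffact_of_nat)
  then show ?thesis by (intro prod_zero) auto
qed

text \<open>With all variables set equal, the derivative of order \<gamma> of L^\<alpha> is a
  multiple of u^(|\<alpha>| - |\<gamma>|). The terms of degree n are those of the n-th coefficient
  of the coaction, evaluated by \<open>dual b\<close>, and integration divides by n + 1.\<close>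

lemma coeff_integral_diff_op:
  fixes b :: "'e expo \<Rightarrow> 'k::field_char_0"
  shows "coeff (poly_integral (set_equal (diff_op (\<lambda>\<alpha>. b \<alpha> * multinom \<alpha>) f))) (Suc n) =
    dual b (coeff (coaction f) n) / of_nat (Suc n)"
proof -
  let ?A = "\<lambda>\<alpha>. b \<alpha> * multinom \<alpha>"
  \<comment> \<open>The finitely many exponents below some monomial of \<open>f\<close>. All other
    derivatives of \<open>f\<close> vanish, so the sum in \<open>diff_op\<close> becomes
    finite.\<close>
  let ?\<Gamma> = "\<Union>\<alpha>\<in>keys f. {\<gamma>. expo_le \<gamma> \<alpha>}"
  let ?ff = "\<lambda>\<gamma> \<alpha>. (\<Prod>e\<in>keys \<gamma>. ffact (of_nat (lookup \<alpha> e)) (lookup \<gamma> e)) :: 'k"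
  let ?l = "\<lambda>\<alpha> \<gamma>. monom (?A \<gamma> * (lookup f \<alpha> * ?ff \<gamma> \<alpha>)) (expo_size (\<alpha> - \<gamma>))"
  let ?r = "\<lambda>\<alpha> \<gamma>. monom (lookup f \<alpha> * of_nat (expo_binom \<alpha> \<gamma>) * fact (expo_size \<gamma>) * b \<gamma>) (expo_size \<alpha> - expo_size \<gamma>)"
  have fin: "finite ?\<Gamma>" using finite_expo_le by auto
  have zero: "mpoly_deriv \<gamma> f = 0" if "\<gamma> \<notin> ?\<Gamma>" for \<gamma>
    unfolding mpoly_deriv_def using that by (intro sum.neutral) (auto simp: prod_ffact_not_le)
  have "{\<gamma>. mconst (?A \<gamma>) * mpoly_deriv \<gamma> f \<noteq> 0} \<subseteq> ?\<Gamma>"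
    using zero by (metis (mono_tags, lifting) mem_Collect_eq mult_zero_right subsetI)
  then have "diff_op ?A f = (\<Sum>\<gamma>\<in>?\<Gamma>. mconst (?A \<gamma>) * mpoly_deriv \<gamma> f)"
    unfolding diff_op_def by (rule Sum_any.expand_superset[OF fin])
  also have "\<dots> = (\<Sum>\<gamma>\<in>?\<Gamma>. \<Sum>\<alpha>\<in>keys f. single (\<alpha> - \<gamma>) (?A \<gamma> * (lookup f \<alpha> * ?ff \<gamma> \<alpha>)))"
    by (simp add: mpoly_deriv_def sum_distrib_left mconst_mult_single)
  finally have "set_equal (diff_op ?A f) =
      (\<Sum>\<alpha>\<in>keys f. \<Sum>\<gamma>\<in>?\<Gamma>. ?l \<alpha> \<gamma>)"
    by (simp only: set_equal_sum set_equal_single) (rule sum.swap)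
  also have "\<dots> = (\<Sum>\<alpha>\<in>keys f. \<Sum>\<gamma> | expo_le \<gamma> \<alpha>. ?r \<alpha> \<gamma>)"
  proof (rule sum.cong[OF refl])
    fix \<alpha> assume \<alpha>: "\<alpha> \<in> keys f"
    have "(\<Sum>\<gamma>\<in>?\<Gamma>. ?l \<alpha> \<gamma>) =
        (\<Sum>\<gamma> | expo_le \<gamma> \<alpha>. ?l \<alpha> \<gamma>)"
      using \<alpha> by (intro sum.mono_neutral_right[OF fin]) (auto simp: prod_ffact_not_le)
    also have "\<dots> = (\<Sum>\<gamma> | expo_le \<gamma> \<alpha>. ?r \<alpha> \<gamma>)"
    proof (intro sum.cong refl)
      fix \<gamma> assume "\<gamma> \<in> {\<gamma>. expo_le \<gamma> \<alpha>}"
      then have le: "expo_le \<gamma> \<alpha>" by simp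
      have "?A \<gamma> * (lookup f \<alpha> * ?ff \<gamma> \<alpha>) = lookup f \<alpha> * b \<gamma> * (multinom \<gamma> * ?ff \<gamma> \<alpha>)"
        by (simp only: mult_ac)
      also have "\<dots> = lookup f \<alpha> * of_nat (expo_binom \<alpha> \<gamma>) * fact (expo_size \<gamma>) * b \<gamma>"
        unfolding prod_ffact_multinom[OF le] by (simp only: mult_ac)
      finally show "?l \<alpha> \<gamma> = ?r \<alpha> \<gamma>"
        using expo_size_diff[OF le] by simp
    qed
    finally show "(\<Sum>\<gamma>\<in>?\<Gamma>. ?l \<alpha> \<gamma>) =
      (\<Sum>\<gamma> | expo_le \<gamma> \<alpha>. ?r \<alpha> \<gamma>)" .
  qed
  finally have "coeff (set_equal (diff_op ?A f)) n = (\<Sum>\<alpha>\<in>keys f. \<Sum>\<gamma> | expo_le \<gamma> \<alpha>.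
      if expo_size \<alpha> - expo_size \<gamma> = n then lookup f \<alpha> * of_nat (expo_binom \<alpha> \<gamma>) * fact (expo_size \<gamma>) * b \<gamma> else 0)"
    by (simp add: coeff_sum)
  also have "\<dots> = dual b (coeff (coaction f) n)"
    unfolding coeff_coaction dual_sum dual_single by (simp only: sum_expo_le_filter)
  finally show ?thesis
    by (simp add: coeff_poly_integral_Suc)
qed

locale cocycle =
  fixes Ep :: "'e set" and \<Lambda> :: "('e, 'k::field_char_0) mpoly \<Rightarrow> 'k poly"
  assumes finite_Ep: "finite Ep" and cocycle: "one_cocycle Ep \<Lambda>"
begin

lemma add: "f \<in> mpolys Ep \<Longrightarrow> g \<in> mpolys Ep \<Longrightarrow> \<Lambda> (f + g) = \<Lambda> f + \<Lambda> g"
  using cocycle by (simp add: one_cocycle_def)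

lemma scale: "f \<in> mpolys Ep \<Longrightarrow> \<Lambda> (mconst c * f) = smult c (\<Lambda> f)"
  using cocycle by (simp add: one_cocycle_def)

lemma zero: "\<Lambda> 0 = 0"
  using scale[of 0 0] by (simp add: mpolys_0)

lemma sum: "(\<And>x. x \<in> A \<Longrightarrow> g x \<in> mpolys Ep) \<Longrightarrow> \<Lambda> (sum g A) = (\<Sum>x\<in>A. \<Lambda> (g x))"
  by (induction A rule: infinite_finite_induct) (simp_all add: zero add mpolys_sum)

text \<open>The cocycle equation at L^i \<otimes> L^j. The case i = j = 0 kills the constant term, i
  = 1 yields the rule for the total derivative, and j = 1 expresses all coefficients by the linear
  one.\<close>

lemma coeff_cocycle:
  assumes "f \<in> mpolys Ep"
  shows "of_nat ((i + j) choose i) * coeff (\<Lambda> f) (i + j) =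
    (if j = 0 then coeff (\<Lambda> f) i else 0) + coeff (\<Lambda> (coeff (coaction f) i)) j"
proof -
  have "coproduct (\<Lambda> f) = tensor_one (\<Lambda> f) + id_tensor \<Lambda> (coaction f)"
    using cocycle assms by (simp add: one_cocycle_def)
  then have "coeff (coeff (coproduct (\<Lambda> f)) i) j =
      coeff (coeff (tensor_one (\<Lambda> f) + id_tensor \<Lambda> (coaction f)) i) j"
    by simp
  then show ?thesis
    by (simp add: coeff_coproduct coeff_tensor_one id_tensor_def coeff_map_poly[where f = \<Lambda>, OF zero])
qed

lemma coeff_0: "f \<in> mpolys Ep \<Longrightarrow> coeff (\<Lambda> f) 0 = 0"
  using coeff_cocycle[of f 0 0] by (simp add: coeff_coaction_0)

lemma coeff_Suc_total_deriv:
  assumes "f \<in> mpolys Ep"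
  shows "of_nat (Suc (Suc n)) * coeff (\<Lambda> f) (Suc (Suc n)) = coeff (\<Lambda> (total_deriv Ep f)) (Suc n)"
  using coeff_cocycle[OF assms, of 1 "Suc n"] by (simp add: coeff_coaction_1[OF finite_Ep assms, simplified])

text \<open>The only candidate for the coefficients: by \<open>dual_single\<close>, a representing
  family takes the value [L] \<Lambda>(L^\<alpha>) / |\<alpha>|! at \<alpha>.\<close>

definition symb :: "'e expo \<Rightarrow> 'k" where
  "symb \<alpha> = (if keys \<alpha> \<subseteq> Ep then coeff (\<Lambda> (single \<alpha> 1)) 1 / fact (expo_size \<alpha>) else 0)"

lemma coeff_1_dual:
  assumes "f \<in> mpolys Ep"
  shows "coeff (\<Lambda> f) 1 = dual symb f"
proof -
  have keys: "keys \<alpha> \<subseteq> Ep" if "\<alpha> \<in> keys f" for \<alpha>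
    using that assms by (auto simp: mpolys_def)
  have "\<Lambda> f = \<Lambda> (\<Sum>\<alpha>\<in>keys f. single \<alpha> (lookup f \<alpha>))"
    by (simp only: mpoly_sum_monomials[symmetric])
  also have "\<dots> = (\<Sum>\<alpha>\<in>keys f. \<Lambda> (mconst (lookup f \<alpha>) * single \<alpha> 1))"
    using keys by (subst sum) (auto intro!: mpolys_single simp: mconst_mult_single)
  also have "\<dots> = (\<Sum>\<alpha>\<in>keys f. smult (lookup f \<alpha>) (\<Lambda> (single \<alpha> 1)))"
    using keys by (intro sum.cong refl scale mpolys_single) auto
  finally have "coeff (\<Lambda> f) 1 = (\<Sum>\<alpha>\<in>keys f. lookup f \<alpha> * coeff (\<Lambda> (single \<alpha> 1)) 1)"
    by (simp add: coeff_sum)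
  also have "\<dots> = dual symb f"
    unfolding dual_def using keys by (intro sum.cong refl) (simp add: symb_def)
  finally show ?thesis .
qed

lemma represents_symb: "represents_cocycle Ep \<Lambda> symb"
  unfolding represents_cocycle_def
proof (intro conjI ballI allI impI)
  fix f :: "('e, 'k) mpoly" assume f: "f \<in> mpolys Ep"
  show "\<Lambda> f = poly_integral (set_equal (diff_op (\<lambda>\<alpha>. symb \<alpha> * multinom \<alpha>) f))"
  proof (rule poly_eqI)
    fix n
    show "coeff (\<Lambda> f) n = coeff (poly_integral (set_equal (diff_op (\<lambda>\<alpha>. symb \<alpha> * multinom \<alpha>) f))) n"
    proof (cases n)
      case 0
      then show ?thesis by (simp add: coeff_0[OF f] coeff_poly_integral_0)
    next
      case (Suc m)
      have "of_nat (Suc m) * coeff (\<Lambda> f) (Suc m) = dual symb (coeff (coaction f) m)"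
        using coeff_cocycle[OF f, of m 1] coeff_1_dual[OF mpolys_coaction[OF f]] by simp
      then show ?thesis
        unfolding Suc coeff_integral_diff_op by (simp add: field_simps del: of_nat_Suc)
    qed
  qed
qed (simp add: symb_def)

text \<open>Existence and uniqueness together give the \<open>THE\<close> in
  \<open>cocycle_coeffs\<close> its meaning. Uniqueness is read off the linear coefficients at
  monomials.\<close>

lemma cocycle_coeffs_eq: "cocycle_coeffs Ep \<Lambda> = symb"
  unfolding cocycle_coeffs_def
proof (rule the_equality, rule represents_symb)
  fix b assume b: "represents_cocycle Ep \<Lambda> b"
  show "b = symb"
  proof
    fix \<alpha>
    show "b \<alpha> = symb \<alpha>"
    proof (cases "keys \<alpha> \<subseteq> Ep")
      case True
      then have "\<Lambda> (single \<alpha> 1) = poly_integral (set_equal (diff_op (\<lambda>\<alpha>. b \<alpha> * multinom \<alpha>) (single \<alpha> 1)))"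
        using b by (simp add: represents_cocycle_def mpolys_single)
      then have "coeff (\<Lambda> (single \<alpha> 1)) (Suc 0) = fact (expo_size \<alpha>) * b \<alpha>"
        by (simp only: coeff_integral_diff_op coeff_coaction_0 dual_single) simp
      then show ?thesis using True by (simp add: symb_def)
    next
      case False
      then show ?thesis using b by (simp add: symb_def represents_cocycle_def)
    qed
  qed
qed

lemma coeff_Suc:
  "f \<in> mpolys Ep \<Longrightarrow> coeff (\<Lambda> f) (Suc n) =
    dual (cocycle_coeffs Ep \<Lambda>) ((total_deriv Ep ^^ n) f) / fact (Suc n)"
proof (induction n arbitrary: f)
  case 0
  then show ?case using coeff_1_dual by (simp add: cocycle_coeffs_eq)
next
  case (Suc n)
  have "coeff (\<Lambda> f) (Suc (Suc n)) = coeff (\<Lambda> (total_deriv Ep f)) (Suc n) / of_nat (Suc (Suc n))"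
    using coeff_Suc_total_deriv[OF Suc.prems, of n] by (simp add: field_simps del: of_nat_Suc)
  also have "\<dots> = dual (cocycle_coeffs Ep \<Lambda>) ((total_deriv Ep ^^ Suc n) f) / fact (Suc (Suc n))"
    unfolding Suc.IH[OF mpolys_total_deriv[OF Suc.prems]]
    by (simp add: funpow_swap1 fact_Suc[of "Suc n"] mult_ac del: fact_Suc of_nat_Suc)
  finally show ?case .
qed

end

subsection \<open>Tubing sums as values of 1-cocycles\<close>

lemma total_deriv_sum: "total_deriv Ep (sum g A) = (\<Sum>x\<in>A. total_deriv Ep (g x))"
  unfolding total_deriv_def pd_sum by (rule sum.swap)

lemma total_deriv_scale: "total_deriv Ep (mconst c * f) = mconst c * total_deriv Ep f"
  by (simp add: total_deriv_def pd_mult pd_mconst sum_distrib_left)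

lemma total_deriv_pow_scaled_sum:
  "(total_deriv Ep ^^ n) (\<Sum>x\<in>A. mconst (c x) * g x) = (\<Sum>x\<in>A. mconst (c x) * (total_deriv Ep ^^ n) (g x))"
  by (induction n) (simp_all add: total_deriv_sum total_deriv_scale)

locale decorated_rtree = rtree t for t :: "('v, 'p, 'e) dtree" +
  fixes PP :: "'p set" and E :: "'p \<Rightarrow> 'e set" and a :: "'p \<Rightarrow> 'e expo \<Rightarrow> 'k::field_char_0"
  assumes decorated: "decorated_tree PP E t" and finite_E: "\<And>p. p \<in> PP \<Longrightarrow> finite (E p)"
begin

lemma dec_PP: "v \<in> verts t \<Longrightarrow> dec t v \<in> PP"
  using decorated by (simp add: decorated_tree_def)

lemma edec_E: "covers t v u \<Longrightarrow> edec t v u \<in> E (dec t v)"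
  using decorated by (simp add: decorated_tree_def)

text \<open>This is \<psi>(X) of the overview, \<open>branch_poly\<close> is F(X), and
  \<open>\<sigma>\<close> is the linear coefficient of \<open>tube_poly\<close>.\<close>

definition tube_poly :: "'v set \<Rightarrow> 'v \<Rightarrow> 'k poly" where
  "tube_poly X r = (\<Sum>\<tau>\<in>tubs X. smult (mel_at E a X r \<tau>)
     (\<Sum>k=1..card {Z \<in> \<tau>. r \<in> Z}. monom (a (dec t r) (beta_at E r \<tau> k) / fact k) k))"

definition branch_poly :: "'v set \<Rightarrow> 'v \<Rightarrow> ('e, 'k) mpoly" where
  "branch_poly X r = (\<Prod>c\<in>children t r \<inter> X. subst_var (edec t r c) (tube_poly (X \<inter> D c) c))"

abbreviation \<sigma> :: "'v set \<Rightarrow> 'v \<Rightarrow> 'k" where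
  "\<sigma> X r \<equiv> psi E a (a (dec t r)) X r (Suc 0)"

lemma coeff_tube_poly_0: "coeff (tube_poly X r) 0 = 0"
  by (simp add: tube_poly_def coeff_sum)

lemma coeff_tube_poly_Suc:
  "coeff (tube_poly X r) (Suc k) = psi E a (a (dec t r)) X r (Suc k) / fact (Suc k)"
proof -
  have "coeff (\<Sum>k=1..m. monom (g k / fact k) k) (Suc k) = (if Suc k \<le> m then g (Suc k) else 0) / fact (Suc k)"
    for m and g :: "nat \<Rightarrow> 'k"
    by (simp add: coeff_sum)
  then show ?thesis
    by (auto simp add: tube_poly_def psi_def coeff_sum sum_divide_distrib simp del: fact_Suc intro!: sum.cong)
qed

text \<open>Coefficient by coefficient this is \<open>psi_Suc_cut\<close>. Tube polynomials have no
  constant term, so \<open>\<sigma> X r\<close> alone accounts for the constant coefficient.\<close>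

lemma pderiv_tube_poly:
  assumes "rtube X r"
  shows "pderiv (tube_poly X r) = [:\<sigma> X r:] + (\<Sum>v\<in>X - {r}. smult (\<sigma> (X \<inter> D v) v) (tube_poly (X - D v) r))"
proof (rule poly_eqI)
  fix n
  have Suc: "coeff (pderiv (tube_poly X r)) n = psi E a (a (dec t r)) X r (Suc n) / fact n"
    by (simp add: coeff_pderiv coeff_tube_poly_Suc field_simps del: of_nat_Suc)
  show "coeff (pderiv (tube_poly X r)) n =
      coeff ([:\<sigma> X r:] + (\<Sum>v\<in>X - {r}. smult (\<sigma> (X \<inter> D v) v) (tube_poly (X - D v) r))) n"
  proof (cases n)
    case 0
    then show ?thesis
      using Suc by (simp add: coeff_sum coeff_tube_poly_0)
  next
    case (Suc k)
    then show ?thesis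
      using \<open>coeff _ n = _ / _\<close> psi_Suc_cut[OF assms, of E a "a (dec t r)" k]
      by (simp add: coeff_sum coeff_tube_poly_Suc sum_divide_distrib del: fact_Suc)
  qed
qed

lemma mpolys_branch_poly: "branch_poly X r \<in> mpolys (E (dec t r))"
  unfolding branch_poly_def
  by (intro mpolys_prod mpolys_subst_var) (auto simp: children_def edec_E)

lemma child_le_child: "covers t r c \<Longrightarrow> covers t r c' \<Longrightarrow> (c', c) \<in> ord t \<Longrightarrow> c' = c"
  using child_above_unique[of r c' c c'] covers_ord[of r c'] ord_verts ord_refl by blast

lemma tube_split_root:
  assumes "rtube X r"
  shows "X - {r} = (\<Union>c\<in>children t r \<inter> X. X \<inter> D c)"
proof (intro equalityI subsetI)
  fix v assume v: "v \<in> X - {r}"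
  then have "(v, r) \<in> ord t" "v \<noteq> r" using rtubeD(2)[OF assms, of v] by auto
  then obtain c where c: "covers t r c" "(v, c) \<in> ord t" using child_above by metis
  then have "c \<in> X" using rtubeD(5)[OF assms, of v c] v covers_ord[OF c(1)] by auto
  then show "v \<in> (\<Union>c\<in>children t r \<inter> X. X \<inter> D c)"
    using c v by (auto simp: children_def D_def)
next
  fix v assume "v \<in> (\<Union>c\<in>children t r \<inter> X. X \<inter> D c)"
  then obtain c where c: "covers t r c" "v \<in> X" "(v, c) \<in> ord t"
    by (auto simp: children_def D_def)
  then show "v \<in> X - {r}"
    using covers_ord[OF c(1)] ord_antisym by auto
qed

lemma sum_tube_split:
  assumes "rtube X r"
  shows "(\<Sum>v\<in>X - {r}. h v) = (\<Sum>c\<in>children t r \<inter> X. \<Sum>v\<in>X \<inter> D c. h v)"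
  unfolding tube_split_root[OF assms]
proof (rule sum.UNION_disjoint)
  show "finite (children t r \<inter> X)" "\<forall>c\<in>children t r \<inter> X. finite (X \<inter> D c)"
    using rtubeD(4)[OF assms] by auto
  show "\<forall>c\<in>children t r \<inter> X. \<forall>c'\<in>children t r \<inter> X. c \<noteq> c' \<longrightarrow> X \<inter> D c \<inter> (X \<inter> D c') = {}"
    using child_above_unique by (auto simp: children_def D_def)
qed

lemma etype_child:
  assumes "c \<in> children t r" "v \<in> D c"
  shows "etype r v = edec t r c"
  using etype_eq assms by (simp add: children_def D_def)

lemma children_disjoint:
  assumes "c \<in> children t r" "c' \<in> children t r" "c \<noteq> c'" "v \<in> D c"
  shows "D v \<inter> D c' = {}"
  using assms child_above_unique[of r c c'] ord_trans[of _ v c] by (auto simp: children_def D_def)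

lemma branch_poly_remove_child:
  assumes X: "rtube X r" and c: "c \<in> children t r \<inter> X"
  shows "branch_poly (X - D c) r =
    (\<Prod>c'\<in>children t r \<inter> X - {c}. subst_var (edec t r c') (tube_poly (X \<inter> D c') c'))"
proof -
  have cc: "c \<in> D c" using c rtubeD(3)[OF X] ord_refl by (auto simp: D_def)
  have "children t r \<inter> (X - D c) = children t r \<inter> X - {c}"
    using c cc child_le_child by (auto simp: children_def D_def)
  moreover have "(X - D c) \<inter> D c' = X \<inter> D c'" if "c' \<in> children t r \<inter> X - {c}" for c'
    using children_disjoint[of c r c' c] that c cc by blast
  ultimately show ?thesis
    unfolding branch_poly_def by simp
qed

text \<open>\<open>v\<close> lies strictly below the child \<open>c\<close>, so no child of
  \<open>r\<close> disappears and only the branch at \<open>c\<close> shrinks.\<close>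

lemma branch_poly_remove:
  assumes X: "rtube X r" and c: "c \<in> children t r \<inter> X" and v: "v \<in> X \<inter> D c - {c}"
  shows "branch_poly (X - D v) r = subst_var (edec t r c) (tube_poly ((X \<inter> D c) - D v) c) *
    (\<Prod>c'\<in>children t r \<inter> X - {c}. subst_var (edec t r c') (tube_poly (X \<inter> D c') c'))"
proof -
  have vc: "(v, c) \<in> ord t" "v \<noteq> c" using v by (auto simp: D_def)
  have "c' \<notin> D v" if "c' \<in> children t r \<inter> X" for c'
  proof
    assume "c' \<in> D v"
    then have "(c', v) \<in> ord t" by (simp add: D_def)
    then have "c' = c" using child_le_child[of r c c'] ord_trans[of c' v c] vc that c
      by (auto simp: children_def)
    then show False using \<open>(c', v) \<in> ord t\<close> vc ord_antisym by blast
  qed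
  then have "children t r \<inter> (X - D v) = children t r \<inter> X" by blast
  then have "branch_poly (X - D v) r = subst_var (edec t r c) (tube_poly ((X - D v) \<inter> D c) c) *
    (\<Prod>c'\<in>children t r \<inter> X - {c}. subst_var (edec t r c') (tube_poly ((X - D v) \<inter> D c') c'))"
    unfolding branch_poly_def using prod.remove[OF _ c] rtubeD(4)[OF X] by simp
  also have "(X - D v) \<inter> D c = (X \<inter> D c) - D v" by blast
  also have "(\<Prod>c'\<in>children t r \<inter> X - {c}. subst_var (edec t r c') (tube_poly ((X - D v) \<inter> D c') c')) =
      (\<Prod>c'\<in>children t r \<inter> X - {c}. subst_var (edec t r c') (tube_poly (X \<inter> D c') c'))"
  proof (rule prod.cong[OF refl])
    fix c' assume "c' \<in> children t r \<inter> X - {c}"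
    then have "(X - D v) \<inter> D c' = X \<inter> D c'"
      using children_disjoint[of c r c' v] c v by blast
    then show "subst_var (edec t r c') (tube_poly ((X - D v) \<inter> D c') c') =
        subst_var (edec t r c') (tube_poly (X \<inter> D c') c')"
      by simp
  qed
  finally show ?thesis .
qed

lemma pd_branch_poly:
  assumes X: "rtube X r"
  shows "pd e (branch_poly X r) =
    (\<Sum>v\<in>X - {r}. if etype r v = e then mconst (\<sigma> (X \<inter> D v) v) * branch_poly (X - D v) r else 0)"
proof -
  let ?C = "children t r \<inter> X"
  let ?g = "\<lambda>c. subst_var (edec t r c) (tube_poly (X \<inter> D c) c)"
  let ?h = "\<lambda>v. mconst (\<sigma> (X \<inter> D v) v) * branch_poly (X - D v) r"
  have "pd e (?g c) * prod ?g (?C - {c}) = (\<Sum>v\<in>X \<inter> D c. if etype r v = e then ?h v else 0)"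
    if c: "c \<in> ?C" for c
  proof -
    have Xc: "rtube (X \<inter> D c) c" using rtube_lower[OF X] c by blast
    have fin: "finite (X \<inter> D c)" using rtubeD(4)[OF Xc] .
    \<comment> \<open>In the derivative of the factor at \<open>c\<close>, the constant term
      corresponds to the removal of the whole branch, that is to \<open>v = c\<close>, and the
      remaining terms to the \<open>v\<close> strictly below \<open>c\<close>.\<close>
    have "subst_var (edec t r c) (pderiv (tube_poly (X \<inter> D c) c)) * prod ?g (?C - {c}) =
        mconst (\<sigma> (X \<inter> D c) c) * prod ?g (?C - {c}) +
        (\<Sum>v\<in>X \<inter> D c - {c}. mconst (\<sigma> ((X \<inter> D c) \<inter> D v) v) *
          (subst_var (edec t r c) (tube_poly ((X \<inter> D c) - D v) c) * prod ?g (?C - {c})))"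
      unfolding pderiv_tube_poly[OF Xc]
      by (simp add: subst_var_add subst_var_sum subst_var_smult subst_var_pCons_const
          distrib_right sum_distrib_right mult.assoc)
    also have "\<dots> = ?h c + (\<Sum>v\<in>X \<inter> D c - {c}. ?h v)"
    proof -
      have "mconst (\<sigma> ((X \<inter> D c) \<inter> D v) v) *
          (subst_var (edec t r c) (tube_poly ((X \<inter> D c) - D v) c) * prod ?g (?C - {c})) = ?h v"
        if v: "v \<in> X \<inter> D c - {c}" for v
      proof -
        have "X \<inter> D c \<inter> D v = X \<inter> D v" using v ord_trans[of _ v c] by (auto simp: D_def)
        then show ?thesis using branch_poly_remove[OF X c v] by simp
      qed
      then show ?thesis
        using branch_poly_remove_child[OF X c] by simp
    qed
    also have "\<dots> = (\<Sum>v\<in>X \<inter> D c. ?h v)"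
      using sum.remove[OF fin rtubeD(1)[OF Xc], of ?h] by simp
    finally have "subst_var (edec t r c) (pderiv (tube_poly (X \<inter> D c) c)) * prod ?g (?C - {c}) =
        (\<Sum>v\<in>X \<inter> D c. ?h v)" .
    moreover have "(\<Sum>v\<in>X \<inter> D c. if etype r v = e then ?h v else 0) =
        (if edec t r c = e then (\<Sum>v\<in>X \<inter> D c. ?h v) else 0)"
      using etype_child c by auto
    ultimately show ?thesis
      by (auto simp: pd_subst_var)
  qed
  then have "pd e (branch_poly X r) = (\<Sum>c\<in>?C. \<Sum>v\<in>X \<inter> D c. if etype r v = e then ?h v else 0)"
    unfolding branch_poly_def using rtubeD(4)[OF X] by (simp add: pd_prod)
  then show ?thesis
    unfolding sum_tube_split[OF X] .
qed

lemma etype_E: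
  assumes "rtube X r" "v \<in> X - {r}"
  shows "etype r v \<in> E (dec t r)"
proof -
  obtain c where "c \<in> children t r" "v \<in> D c"
    using assms tube_split_root[OF assms(1)] by blast
  then show ?thesis
    using etype_child edec_E by (simp add: children_def)
qed

lemma finite_E_dec: "rtube X r \<Longrightarrow> finite (E (dec t r))"
  using rtubeD(1,3) finite_E dec_PP by blast

lemma total_deriv_branch_poly:
  assumes "rtube X r"
  shows "total_deriv (E (dec t r)) (branch_poly X r) =
    (\<Sum>v\<in>X - {r}. mconst (\<sigma> (X \<inter> D v) v) * branch_poly (X - D v) r)"
proof -
  have "total_deriv (E (dec t r)) (branch_poly X r) = (\<Sum>v\<in>X - {r}. \<Sum>e\<in>E (dec t r).
      if etype r v = e then mconst (\<sigma> (X \<inter> D v) v) * branch_poly (X - D v) r else 0)"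
    unfolding total_deriv_def pd_branch_poly[OF assms] by (rule sum.swap)
  also have "\<dots> = (\<Sum>v\<in>X - {r}. mconst (\<sigma> (X \<inter> D v) v) * branch_poly (X - D v) r)"
    using finite_E_dec[OF assms] etype_E[OF assms] by (intro sum.cong refl) simp
  finally show ?thesis .
qed

text \<open>A tube with more than one vertex has a branch, whose factor has no constant term. This
  removes the boundary term \<open>lookup f 0 * c 0\<close> in \<open>dual_shift\<close>.\<close>

lemma lookup_branch_poly_0:
  assumes "rtube X r" "X \<noteq> {r}"
  shows "lookup (branch_poly X r) 0 = 0"
proof -
  have lm: "lookup (f * g) 0 = lookup f 0 * lookup g 0" for f g :: "('e, 'k) mpoly"
  proof -
    have z: "\<alpha> + \<beta> = 0 \<longleftrightarrow> \<alpha> = 0 \<and> \<beta> = 0" for \<alpha> \<beta> :: "'e expo"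
      by (auto simp: poly_mapping_eq_iff fun_eq_iff lookup_add)
    show ?thesis
    proof (induction f rule: mpoly_induct)
      case (single \<alpha> x)
      show ?case
      proof (induction g rule: mpoly_induct)
        case (single \<beta> y)
        show ?case
          unfolding mult_single by (simp add: lookup_single when_def z)
      qed (simp add: distrib_left lookup_add)
    qed (simp add: distrib_right lookup_add)
  qed
  have "children t r \<inter> X \<noteq> {}"
    using tube_split_root[OF assms(1)] rtubeD(1)[OF assms(1)] assms(2) by auto
  then obtain c where c: "c \<in> children t r \<inter> X" by blast
  have "branch_poly X r = subst_var (edec t r c) (tube_poly (X \<inter> D c) c) *
      (\<Prod>c'\<in>children t r \<inter> X - {c}. subst_var (edec t r c') (tube_poly (X \<inter> D c') c'))"
    unfolding branch_poly_def using prod.remove[OF _ c] rtubeD(4)[OF assms(1)] by simp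
  then show ?thesis
    by (simp add: lm lookup_subst_var coeff_tube_poly_0)
qed

text \<open>A cut replaces \<open>c\<close> by a shift, so the induction on the size of
  \<open>X\<close> has to cover all families \<open>c\<close> at once. \<open>psi_first_cut\<close>
  for tubings matches \<open>dual_shift\<close> combined with \<open>pd_branch_poly\<close> for
  polynomials; both sides equal \<open>c 0\<close> at a single vertex.\<close>

lemma psi_dual_branch_poly_first:
  "rtube X r \<Longrightarrow> psi E a c X r (Suc 0) = dual c (branch_poly X r)"
proof (induction "card X" arbitrary: X c rule: less_induct)
  case less
  note X = less.prems
  show ?case
  proof (cases "X = {r}")
    case True
    have "children t r \<inter> {r} = {}"
      using covers_ord by (auto simp: children_def)
    then show ?thesis
      using psi_singleton(1) X True by (simp add: branch_poly_def dual_1)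
  next
    case False
    have IH: "psi E a c' (X - D v) r (Suc 0) = dual c' (branch_poly (X - D v) r)" if v: "v \<in> X - {r}" for v c'
    proof (rule less.hyps)
      have "v \<in> X \<inter> D v" using rtube_lower[OF X, of v] v rtubeD(1) by blast
      then show "card (X - D v) < card X"
        using rtubeD(4)[OF X] by (intro psubset_card_mono) auto
      show "rtube (X - D v) r" using rtube_upper[OF X, of v] v by auto
    qed
    have "dual c (branch_poly X r) = (\<Sum>e\<in>E (dec t r).
        dual (\<lambda>\<alpha>. c (\<alpha> + single e 1)) (pd e (branch_poly X r)))"
      using dual_shift[OF finite_E_dec[OF X] mpolys_branch_poly, of c] lookup_branch_poly_0[OF X False] by simp
    also have "\<dots> = (\<Sum>e\<in>E (dec t r). \<Sum>v\<in>X - {r}. if etype r v = e then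
        \<sigma> (X \<inter> D v) v * dual (\<lambda>\<alpha>. c (\<alpha> + single (etype r v) 1)) (branch_poly (X - D v) r) else 0)"
      unfolding pd_branch_poly[OF X] dual_sum
      by (intro sum.cong refl) (simp add: dual_mconst_mult dual_0)
    also have "\<dots> = (\<Sum>v\<in>X - {r}. \<Sum>e\<in>E (dec t r). if etype r v = e then
        \<sigma> (X \<inter> D v) v * dual (\<lambda>\<alpha>. c (\<alpha> + single (etype r v) 1)) (branch_poly (X - D v) r) else 0)"
      by (rule sum.swap)
    also have "\<dots> = (\<Sum>v\<in>X - {r}. \<sigma> (X \<inter> D v) v *
        psi E a (\<lambda>\<alpha>. c (\<alpha> + single (etype r v) 1)) (X - D v) r (Suc 0))"
      using finite_E_dec[OF X] etype_E[OF X] by (intro sum.cong refl) (simp add: IH)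
    also have "\<dots> = psi E a c X r (Suc 0)"
      using psi_first_cut[where E = E and a = a and c = c, OF X False finite_E_dec[OF X] etype_E[OF X]] by simp
    finally show ?thesis by simp
  qed
qed

text \<open>Each total derivative performs one cut, as does each use of \<open>psi_Suc_cut\<close>.
  Here \<open>c\<close> stays fixed until the first coefficient is reached.\<close>

lemma psi_dual_branch_poly:
  "rtube X r \<Longrightarrow> psi E a c X r (Suc n) = dual c ((total_deriv (E (dec t r)) ^^ n) (branch_poly X r))"
proof (induction n arbitrary: X)
  case 0
  then show ?case by (simp add: psi_dual_branch_poly_first)
next
  case (Suc n)
  note X = Suc.prems
  have "(total_deriv (E (dec t r)) ^^ Suc n) (branch_poly X r) =
      (\<Sum>v\<in>X - {r}. mconst (\<sigma> (X \<inter> D v) v) * (total_deriv (E (dec t r)) ^^ n) (branch_poly (X - D v) r))"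
    unfolding funpow_Suc_right o_def total_deriv_branch_poly[OF X] total_deriv_pow_scaled_sum ..
  then have "dual c ((total_deriv (E (dec t r)) ^^ Suc n) (branch_poly X r)) =
      (\<Sum>v\<in>X - {r}. \<sigma> (X \<inter> D v) v * dual c ((total_deriv (E (dec t r)) ^^ n) (branch_poly (X - D v) r)))"
    by (simp only: dual_sum dual_mconst_mult)
  also have "\<dots> = (\<Sum>v\<in>X - {r}. \<sigma> (X \<inter> D v) v * psi E a c (X - D v) r (Suc n))"
  proof (rule sum.cong[OF refl])
    fix v assume "v \<in> X - {r}"
    then have "rtube (X - D v) r" using rtube_upper[OF X, of v] by auto
    then show "\<sigma> (X \<inter> D v) v * dual c ((total_deriv (E (dec t r)) ^^ n) (branch_poly (X - D v) r)) =
        \<sigma> (X \<inter> D v) v * psi E a c (X - D v) r (Suc n)"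
      using Suc.IH by simp
  qed
  also have "\<dots> = psi E a c X r (Suc (Suc n))"
    by (rule psi_Suc_cut[OF X, symmetric])
  finally show ?case by simp
qed

text \<open>In degree n + 1 both sides are the value of \<open>dual\<close> at the n-th total
  derivative, divided by (n + 1)!.\<close>

lemma tube_poly_eq_cocycle:
  assumes "rtube X r" "one_cocycle (E (dec t r)) \<Lambda>" "a (dec t r) = cocycle_coeffs (E (dec t r)) \<Lambda>"
  shows "tube_poly X r = \<Lambda> (branch_poly X r)"
proof -
  interpret cocycle "E (dec t r)" \<Lambda>
    using assms(2) finite_E_dec[OF assms(1)] by unfold_locales
  show ?thesis
  proof (rule poly_eqI)
    fix n
    show "coeff (tube_poly X r) n = coeff (\<Lambda> (branch_poly X r)) n"
      using coeff_0[OF mpolys_branch_poly] coeff_Suc[OF mpolys_branch_poly] assms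
      by (cases n) (simp_all add: coeff_tube_poly_0 coeff_tube_poly_Suc psi_dual_branch_poly del: fact_Suc)
  qed
qed

end

subsection \<open>Planar trees\<close>

text \<open>Labels taken from the vertices of a poset turn a planar tree into an ordering of that
  poset; labels of type \<open>unit\<close> leave only its shape. One datatype serves both purposes,
  and \<open>strip\<close> passes from the former to the latter.\<close>

datatype ('v, 'p, 'e) ptree = Node (lab: 'v) (deco: 'p) (subs: "('e \<times> ('v, 'p, 'e) ptree) list")

fun relabel :: "('v \<Rightarrow> 'u) \<Rightarrow> ('v, 'p, 'e) ptree \<Rightarrow> ('u, 'p, 'e) ptree" where
  "relabel f (Node v p cs) = Node (f v) p (map (\<lambda>x. (fst x, relabel f (snd x))) cs)"

fun labels :: "('v, 'p, 'e) ptree \<Rightarrow> 'v list" where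
  "labels (Node v p cs) = v # concat (map (\<lambda>x. labels (snd x)) cs)"

abbreviation strip :: "('v, 'p, 'e) ptree \<Rightarrow> (unit, 'p, 'e) ptree" where
  "strip \<equiv> relabel (\<lambda>_. ())"

lemma ptree_induct [case_names Node]:
  assumes "\<And>v p cs. (\<And>x. x \<in> set cs \<Longrightarrow> Q (snd x)) \<Longrightarrow> Q (Node v p cs)"
  shows "Q l"
  by (induction l rule: labels.induct) (use assms in blast)

lemma lab_relabel [simp]: "lab (relabel f l) = f (lab l)"
  by (cases l) simp

lemma deco_relabel [simp]: "deco (relabel f l) = deco l"
  by (cases l) simp

lemma labels_relabel: "labels (relabel f l) = map f (labels l)"
  by (induction l rule: ptree_induct) (simp add: map_concat o_def cong: map_cong)

lemma relabel_relabel: "relabel f (relabel g l) = relabel (\<lambda>x. f (g x)) l"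
  by (induction l rule: ptree_induct) simp

lemma relabel_cong: "(\<And>x. x \<in> set (labels l) \<Longrightarrow> f x = g x) \<Longrightarrow> relabel f l = relabel g l"
  by (induction l rule: ptree_induct) auto

lemma relabel_eq_iff: "relabel f l = relabel g l \<longleftrightarrow> (\<forall>x\<in>set (labels l). f x = g x)"
proof
  assume "relabel f l = relabel g l"
  then have "map f (labels l) = map g (labels l)"
    by (metis labels_relabel)
  then show "\<forall>x\<in>set (labels l). f x = g x" by simp
qed (auto intro: relabel_cong)

lemma length_labels_strip: "strip l = strip l' \<Longrightarrow> length (labels l) = length (labels l')"
  by (metis labels_relabel length_map)

text \<open>Equal shapes have label lists of equal length, so the concatenated list splits in only
  one way among the children.\<close>

lemma relabel_eqI:
  "strip l = strip l' \<Longrightarrow> map f (labels l) = labels l' \<Longrightarrow> relabel f l = l'"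
proof (induction l arbitrary: l' rule: ptree_induct)
  case (Node v p cs)
  obtain v' p' cs' where l': "l' = Node v' p' cs'" by (cases l')
  have "map (\<lambda>x. (fst x, relabel f (snd x))) cs = cs'"
    if "map (\<lambda>x. (fst x, strip (snd x))) cs = map (\<lambda>x. (fst x, strip (snd x))) cs'"
      "map f (concat (map (\<lambda>x. labels (snd x)) cs)) = concat (map (\<lambda>x. labels (snd x)) cs')"
      "\<And>x l'. x \<in> set cs \<Longrightarrow> strip (snd x) = strip l' \<Longrightarrow> map f (labels (snd x)) = labels l' \<Longrightarrow> relabel f (snd x) = l'"
    using that
  proof (induction cs arbitrary: cs')
    case (Cons x cs)
    obtain y ys where cs': "cs' = y # ys" using Cons.prems(1) by (cases cs') auto
    have eq: "fst x = fst y" "strip (snd x) = strip (snd y)"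
      using Cons.prems(1) cs' by auto
    have "map f (labels (snd x)) = labels (snd y) \<and>
        map f (concat (map (\<lambda>x. labels (snd x)) cs)) = concat (map (\<lambda>x. labels (snd x)) ys)"
      using Cons.prems(2) length_labels_strip[OF eq(2)] by (simp add: cs')
    then show ?case
      using Cons.prems eq Cons.IH[of ys] by (auto simp: cs' prod_eq_iff)
  qed simp
  then show ?case
    using Node by (auto simp: l')
qed

section \<open>Orderings of a given poset\<close>

fun represents :: "('v, 'p, 'e) dtree \<Rightarrow> ('v, 'p, 'e) ptree \<Rightarrow> bool" where
  "represents t (Node v p cs) \<longleftrightarrow> v \<in> verts t \<and> p = dec t v \<and>
     distinct (map (\<lambda>x. lab (snd x)) cs) \<and> (\<lambda>x. lab (snd x)) ` set cs = children t v \<and>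
     (\<forall>x\<in>set cs. fst x = edec t v (lab (snd x)) \<and> represents t (snd x))"

definition orderings :: "('v, 'p, 'e) dtree \<Rightarrow> 'v \<Rightarrow> ('v, 'p, 'e) ptree set" where
  "orderings t v = {l. represents t l \<and> lab l = v}"

lemma represents_deco: "represents t l \<Longrightarrow> deco l = dec t (lab l)"
  by (cases l) simp

context rtree
begin

lemma rtube_D: "v \<in> verts t \<Longrightarrow> rtube (D v) v"
  using ord_refl by (auto simp: rtube_def D_def)

lemma children_verts: "c \<in> children t v \<Longrightarrow> c \<in> verts t"
  using covers_ord ord_verts by (auto simp: children_def)

lemma finite_children: "finite (children t v)"
  by (rule finite_subset[OF _ finite_verts]) (use children_verts in blast)

lemma D_children: "v \<in> verts t \<Longrightarrow> D v = insert v (\<Union>c\<in>children t v. D c)"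
proof (intro equalityI subsetI)
  fix u assume "v \<in> verts t" "u \<in> D v"
  then show "u \<in> insert v (\<Union>c\<in>children t v. D c)"
    using child_above[of u v] by (cases "u = v") (auto simp: D_def children_def)
next
  fix u assume "v \<in> verts t" "u \<in> insert v (\<Union>c\<in>children t v. D c)"
  then show "u \<in> D v"
    using covers_ord ord_trans ord_refl by (auto simp: D_def children_def)
qed

lemma D_child_disjoint:
  "c \<in> children t v \<Longrightarrow> c' \<in> children t v \<Longrightarrow> c \<noteq> c' \<Longrightarrow> D c \<inter> D c' = {}"
  using child_above_unique by (auto simp: D_def children_def)

lemma root_notin_D_child: "c \<in> children t v \<Longrightarrow> v \<notin> D c"
  using covers_ord ord_antisym by (auto simp: D_def children_def)

lemma finite_D: "finite (D v)"
  using finite_subset[OF D_subset finite_verts] .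

lemma prod_D:
  assumes "v \<in> verts t"
  shows "prod g (D v) = g v * (\<Prod>c\<in>children t v. prod g (D c))"
proof -
  have "prod g (\<Union>c\<in>children t v. D c) = (\<Prod>c\<in>children t v. prod g (D c))"
    using finite_children finite_D D_child_disjoint by (intro prod.UNION_disjoint) auto
  moreover have "v \<notin> (\<Union>c\<in>children t v. D c)" using root_notin_D_child by blast
  ultimately show ?thesis
    unfolding D_children[OF assms] using finite_children finite_D by simp
qed

lemma sum_D:
  assumes "v \<in> verts t"
  shows "sum g (D v) = g v + (\<Sum>c\<in>children t v. sum g (D c))"
proof -
  have "sum g (\<Union>c\<in>children t v. D c) = (\<Sum>c\<in>children t v. sum g (D c))"
    using finite_children finite_D D_child_disjoint by (intro sum.UNION_disjoint) auto
  moreover have "v \<notin> (\<Union>c\<in>children t v. D c)" using root_notin_D_child by blast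
  ultimately show ?thesis
    unfolding D_children[OF assms] using finite_children finite_D by simp
qed

lemma represents_labels:
  "represents t l \<Longrightarrow> set (labels l) = D (lab l) \<and> distinct (labels l)"
proof (induction l rule: ptree_induct)
  case (Node v p cs)
  have v: "v \<in> verts t" and dist: "distinct (map (\<lambda>x. lab (snd x)) cs)"
    and ch: "(\<lambda>x. lab (snd x)) ` set cs = children t v"
    and sub: "\<And>x. x \<in> set cs \<Longrightarrow> represents t (snd x)"
    using Node.prems by auto
  have IH: "set (labels (snd x)) = D (lab (snd x))" "distinct (labels (snd x))" if "x \<in> set cs" for x
    using Node.IH[OF that] sub[OF that] by auto
  have set: "(\<Union>x\<in>set cs. set (labels (snd x))) = (\<Union>c\<in>children t v. D c)"
    using IH by (simp add: ch[symmetric])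
  have inj: "x = y" if "x \<in> set cs" "y \<in> set cs" "lab (snd x) = lab (snd y)" for x y
    using dist that by (auto simp: distinct_map inj_on_def)
  have "distinct (concat (map (\<lambda>x. labels (snd x)) cs))"
  proof (rule distinct_concat)
    have lab_eq: "lab (snd x) = lab (snd y)" if "labels (snd x) = labels (snd y)" for x y :: "'e \<times> ('v, 'p, 'e) ptree"
      using that by (cases "snd x"; cases "snd y") simp
    have "inj_on (\<lambda>x. labels (snd x)) (set cs)"
      by (rule inj_onI, rule inj) (assumption+, rule lab_eq, assumption)
    then show "distinct (map (\<lambda>x. labels (snd x)) cs)"
      using dist by (simp add: distinct_map)
    fix ys zs assume "ys \<in> set (map (\<lambda>x. labels (snd x)) cs)" "zs \<in> set (map (\<lambda>x. labels (snd x)) cs)" "ys \<noteq> zs"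
    then obtain x y where xy: "x \<in> set cs" "y \<in> set cs" "ys = labels (snd x)" "zs = labels (snd y)"
      and ne: "ys \<noteq> zs"
      by auto
    have "lab (snd x) \<noteq> lab (snd y)"
      using inj[OF xy(1,2)] ne xy(3,4) by auto
    moreover have "lab (snd x) \<in> children t v" "lab (snd y) \<in> children t v"
      using xy by (simp_all add: ch[symmetric])
    ultimately show "set ys \<inter> set zs = {}"
      using D_child_disjoint[of "lab (snd x)" v "lab (snd y)"] IH[OF xy(1)] IH[OF xy(2)] xy(3,4) by simp
  qed (use IH in auto)
  then show ?case
    using root_notin_D_child set D_children[OF v] by auto
qed

text \<open>An ordering below \<open>v\<close> is an order of the children together with an ordering
  below each child. Both can be read off, because every subtree carries its root as label.\<close>

lemma orderings_Node:
  assumes v: "v \<in> verts t"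
  shows "bij_betw (\<lambda>(us, f). Node v (dec t v) (map (\<lambda>u. (edec t v u, f u)) us))
    (permutations_of_set (children t v) \<times> PiE (children t v) (orderings t)) (orderings t v)"
  unfolding bij_betw_def
proof
  let ?F = "\<lambda>(us, f). Node v (dec t v) (map (\<lambda>u. (edec t v u, f u)) us)"
  let ?S = "permutations_of_set (children t v) \<times> PiE (children t v) (orderings t)"
  show "inj_on ?F ?S"
  proof (rule inj_onI)
    fix x y assume xy: "x \<in> ?S" "y \<in> ?S" "?F x = ?F y"
    obtain us f vs g where x: "x = (us, f)" and y: "y = (vs, g)" by (cases x; cases y)
    have us: "set us = children t v" "set vs = children t v"
      using xy by (auto simp: x y permutations_of_set_def)
    have f: "f \<in> PiE (children t v) (orderings t)" "g \<in> PiE (children t v) (orderings t)"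
      using xy by (auto simp: x y)
    have eq: "map (\<lambda>u. (edec t v u, f u)) us = map (\<lambda>u. (edec t v u, g u)) vs"
      using xy by (simp add: x y)
    have "us = map (\<lambda>u. lab (f u)) us" "vs = map (\<lambda>u. lab (g u)) vs"
      using f us by (auto simp: orderings_def PiE_def Pi_def intro!: map_idI[symmetric])
    moreover have "map (\<lambda>u. lab (f u)) us = map (\<lambda>u. lab (g u)) vs"
      using arg_cong[OF eq, of "map (\<lambda>x. lab (snd x))"] by (simp add: o_def)
    ultimately have uv: "us = vs" by simp
    have "f = g"
    proof (rule PiE_ext[OF f])
      fix u assume "u \<in> children t v"
      then show "f u = g u" using eq us unfolding uv by auto
    qed
    with uv show "x = y" by (simp add: x y)
  qed
  show "?F ` ?S = orderings t v"
  proof (intro equalityI subsetI)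
    fix l assume "l \<in> ?F ` ?S"
    then obtain us f where us: "us \<in> permutations_of_set (children t v)" and f: "f \<in> PiE (children t v) (orderings t)"
      and l: "l = Node v (dec t v) (map (\<lambda>u. (edec t v u, f u)) us)" by auto
    have set: "set us = children t v" "distinct us" using us by (auto simp: permutations_of_set_def)
    have fu: "represents t (f u)" "lab (f u) = u" if "u \<in> set us" for u
      using f that set by (auto simp: orderings_def PiE_def Pi_def)
    have "map (\<lambda>x. lab (snd x)) (map (\<lambda>u. (edec t v u, f u)) us) = us"
      using fu by (auto simp: intro!: map_idI)
    then show "l \<in> orderings t v"
      using v set fu by (auto simp: orderings_def l image_image)
  next
    fix l assume "l \<in> orderings t v"
    then obtain cs where l: "l = Node v (dec t v) cs" and dist: "distinct (map (\<lambda>x. lab (snd x)) cs)"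
      and ch: "(\<lambda>x. lab (snd x)) ` set cs = children t v"
      and sub: "\<And>x. x \<in> set cs \<Longrightarrow> fst x = edec t v (lab (snd x)) \<and> represents t (snd x)"
      by (cases l) (auto simp: orderings_def)
    \<comment> \<open>The subtree of a child is looked up by its root label, which occurs only once
      in the list.\<close>
    define f where "f = restrict (\<lambda>u. the (map_of (map (\<lambda>x. (lab (snd x), snd x)) cs) u)) (children t v)"
    have f: "f (lab (snd x)) = snd x" if "x \<in> set cs" for x
    proof -
      have "map_of (map (\<lambda>x. (lab (snd x), snd x)) cs) (lab (snd x)) = Some (snd x)"
        using dist that by (intro map_of_is_SomeI) (auto simp: o_def)
      then show ?thesis using ch that by (auto simp: f_def)
    qed
    have "f \<in> PiE (children t v) (orderings t)"
    proof (rule PiE_I)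
      fix u assume "u \<in> children t v"
      then have "u \<in> (\<lambda>x. lab (snd x)) ` set cs" by (simp add: ch)
      then obtain x where "x \<in> set cs" "u = lab (snd x)" by (rule imageE)
      then show "f u \<in> orderings t u" using f sub by (auto simp: orderings_def)
    qed (simp add: f_def)
    moreover have "map (\<lambda>x. lab (snd x)) cs \<in> permutations_of_set (children t v)"
      using dist ch by (auto simp: permutations_of_set_def)
    moreover have "map (\<lambda>u. (edec t v u, f u)) (map (\<lambda>x. lab (snd x)) cs) = cs"
      using sub f by (auto simp: o_def prod_eq_iff intro!: map_idI)
    ultimately show "l \<in> ?F ` ?S"
      by (intro image_eqI[of _ _ "(map (\<lambda>x. lab (snd x)) cs, f)"]) (auto simp: l)
  qed
qed

lemma card_orderings:
  "v \<in> verts t \<Longrightarrow> finite (orderings t v) \<and> card (orderings t v) = (\<Prod>u\<in>D v. fact (card (children t u)))"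
proof (induction v rule: wf_induct_rule[OF wf_ord])
  case (1 v)
  have IH: "finite (orderings t c)" "card (orderings t c) = (\<Prod>u\<in>D c. fact (card (children t u)))"
    if "c \<in> children t v" for c
    using 1(1)[of c] children_verts[OF that] covers_ord[of v c] that by (auto simp: children_def)
  let ?S = "permutations_of_set (children t v) \<times> PiE (children t v) (orderings t)"
  have "finite ?S"
    using finite_children IH by (intro finite_SigmaI finite_PiE) auto
  moreover have "card ?S = fact (card (children t v)) * (\<Prod>c\<in>children t v. card (orderings t c))"
    by (simp add: card_cartesian_product card_PiE finite_children)
  moreover have "(\<Prod>c\<in>children t v. card (orderings t c)) = (\<Prod>c\<in>children t v. \<Prod>u\<in>D c. fact (card (children t u)))"
    using IH by (intro prod.cong) auto
  ultimately show ?case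
    using bij_betw_finite[OF orderings_Node[OF 1(2)]] bij_betw_same_card[OF orderings_Node[OF 1(2)]]
      prod_D[OF 1(2), of "\<lambda>u. fact (card (children t u)) :: nat"]
    by simp
qed

lemma root_verts: "root t \<in> verts t" "D (root t) = verts t"
proof -
  obtain r where r: "r \<in> verts t" "\<forall>v\<in>verts t. (v, r) \<in> ord t"
    using rooted unfolding rooted_tree_def by blast
  have "D r = verts t" using r D_subset by (auto simp: D_def)
  then have "rtube (verts t) r" using rtube_D r by metis
  then have "root t = r" unfolding root_def by (rule top_elem_rtube)
  then show "root t \<in> verts t" "D (root t) = verts t" using r \<open>D r = verts t\<close> by auto
qed

text \<open>A finite order is generated by its covering relation, so it is enough to climb from
  \<open>u\<close> to \<open>v\<close> through parents.\<close>

lemma ord_mono_of_covers: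
  assumes "rooted_tree s" "\<And>v. v \<in> verts t \<Longrightarrow> f v \<in> verts s" "\<And>u v. covers t v u \<Longrightarrow> covers s (f v) (f u)"
  shows "(u, v) \<in> ord t \<Longrightarrow> (f u, f v) \<in> ord s"
proof (induction u rule: wf_induct_rule[OF wf_ord_converse])
  case (1 u)
  interpret s: rtree s using assms(1) by unfold_locales
  show ?case
  proof (cases "u = v")
    case True
    then show ?thesis using assms(2)[of v] 1(2) ord_verts s.ord_refl by blast
  next
    case False
    obtain c where c: "covers t c u" "(c, v) \<in> ord t" using parent_below[OF 1(2) False] .
    then have "(f c, f v) \<in> ord s" using 1(1)[of c] covers_ord[of c u] by auto
    then show ?thesis
      using s.covers_ord[OF assms(3)[OF c(1)]] s.ord_trans by blast
  qed
qed

end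

subsection \<open>Orderings and automorphisms\<close>

locale rtree_pair = s: rtree s + t: rtree t
  for s :: "('v, 'p, 'e) dtree" and t :: "('u, 'p, 'e) dtree"
begin

lemma tree_isosD:
  assumes "\<phi> \<in> tree_isos s t"
  shows "bij_betw \<phi> (verts s) (verts t)" "\<phi> \<in> extensional (verts s)"
    "u \<in> verts s \<Longrightarrow> v \<in> verts s \<Longrightarrow> (u, v) \<in> ord s \<longleftrightarrow> (\<phi> u, \<phi> v) \<in> ord t"
    "v \<in> verts s \<Longrightarrow> dec t (\<phi> v) = dec s v"
    "covers s v u \<Longrightarrow> edec t (\<phi> v) (\<phi> u) = edec s v u"
  using assms by (auto simp: tree_isos_def PiE_def)

lemma tree_isos_covers:
  assumes "\<phi> \<in> tree_isos s t" "u \<in> verts s" "v \<in> verts s"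
  shows "covers s v u \<longleftrightarrow> covers t (\<phi> v) (\<phi> u)"
proof -
  note iso = tree_isosD[OF assms(1)]
  have img: "\<phi> ` verts s = verts t" and inj: "inj_on \<phi> (verts s)"
    using iso(1) by (auto simp: bij_betw_def)
  have eq: "\<phi> x = \<phi> y \<longleftrightarrow> x = y" if "x \<in> verts s" "y \<in> verts s" for x y
    using inj that by (auto simp: inj_on_def)
  have "(\<exists>z. z \<noteq> u \<and> z \<noteq> v \<and> (u, z) \<in> ord s \<and> (z, v) \<in> ord s) \<longleftrightarrow>
      (\<exists>z\<in>verts s. z \<noteq> u \<and> z \<noteq> v \<and> (u, z) \<in> ord s \<and> (z, v) \<in> ord s)"
    using s.ord_verts by blast
  also have "\<dots> \<longleftrightarrow> (\<exists>z\<in>verts s. \<phi> z \<noteq> \<phi> u \<and> \<phi> z \<noteq> \<phi> v \<and> (\<phi> u, \<phi> z) \<in> ord t \<and> (\<phi> z, \<phi> v) \<in> ord t)"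
    using iso(3) assms(2,3) eq by auto
  also have "\<dots> \<longleftrightarrow> (\<exists>z\<in>verts t. z \<noteq> \<phi> u \<and> z \<noteq> \<phi> v \<and> (\<phi> u, z) \<in> ord t \<and> (z, \<phi> v) \<in> ord t)"
    unfolding img[symmetric] by blast
  also have "\<dots> \<longleftrightarrow> (\<exists>z. z \<noteq> \<phi> u \<and> z \<noteq> \<phi> v \<and> (\<phi> u, z) \<in> ord t \<and> (z, \<phi> v) \<in> ord t)"
    using t.ord_verts by blast
  finally show ?thesis
    unfolding covers_def using iso(3) assms(2,3) eq by simp
qed

lemma tree_isos_children:
  assumes "\<phi> \<in> tree_isos s t" "v \<in> verts s"
  shows "children t (\<phi> v) = \<phi> ` children s v"
proof (intro equalityI subsetI)
  fix w assume w: "w \<in> children t (\<phi> v)"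
  have "w \<in> \<phi> ` verts s"
    using tree_isosD(1)[OF assms(1)] t.children_verts[OF w] by (simp add: bij_betw_def)
  then obtain u where u: "u \<in> verts s" "w = \<phi> u" by blast
  then show "w \<in> \<phi> ` children s v"
    using tree_isos_covers[OF assms(1) u(1) assms(2)] w by (auto simp: children_def)
next
  fix w assume "w \<in> \<phi> ` children s v"
  then obtain u where "u \<in> children s v" "w = \<phi> u" by blast
  then show "w \<in> children t (\<phi> v)"
    using tree_isos_covers[OF assms(1) _ assms(2)] s.children_verts by (auto simp: children_def)
qed

lemma tree_isos_root:
  assumes "\<phi> \<in> tree_isos s t"
  shows "\<phi> (root s) = root t"
proof -
  have img: "\<phi> ` verts s = verts t"
    using tree_isosD(1)[OF assms] by (auto simp: bij_betw_def)
  then obtain x where x: "x \<in> verts s" "\<phi> x = root t"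
    using t.root_verts(1) by (metis imageE)
  have "x \<in> s.D (root s)"
    using x s.root_verts by simp
  then have "(root t, \<phi> (root s)) \<in> ord t"
    using tree_isosD(3)[OF assms x(1) s.root_verts(1)] x by (simp add: s.D_def)
  moreover have "\<phi> (root s) \<in> t.D (root t)"
    unfolding t.root_verts using img s.root_verts(1) by blast
  ultimately show ?thesis
    using t.ord_antisym by (simp add: t.D_def)
qed

lemma represents_relabel:
  assumes "\<phi> \<in> tree_isos s t"
  shows "represents s l \<Longrightarrow> represents t (relabel \<phi> l)"
proof (induction l rule: ptree_induct)
  case (Node v p cs)
  have v: "v \<in> verts s" and dist: "distinct (map (\<lambda>x. lab (snd x)) cs)"
    and ch: "(\<lambda>x. lab (snd x)) ` set cs = children s v"
    using Node.prems by auto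
  have inj: "inj_on \<phi> (verts s)" and img: "\<phi> ` verts s = verts t"
    using tree_isosD(1)[OF assms] by (auto simp: bij_betw_def)
  have "inj_on \<phi> (children s v)"
    using inj s.children_verts by (auto intro: inj_on_subset)
  then have "distinct (map \<phi> (map (\<lambda>x. lab (snd x)) cs))"
    using dist ch by (subst distinct_map) (simp add: image_image)
  moreover have "(\<lambda>x. \<phi> (lab (snd x))) ` set cs = children t (\<phi> v)"
    unfolding tree_isos_children[OF assms v] ch[symmetric] by (simp add: image_image)
  moreover have "edec t (\<phi> v) (\<phi> (lab (snd x))) = edec s v (lab (snd x))" if "x \<in> set cs" for x
  proof -
    have "lab (snd x) \<in> children s v" using that by (simp add: ch[symmetric])
    then show ?thesis using tree_isosD(5)[OF assms] by (simp add: children_def)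
  qed
  moreover have "\<phi> v \<in> verts t" using img v by blast
  ultimately show ?case
    using Node tree_isosD(4)[OF assms v] by (auto simp: o_def image_image)
qed

lemma ordering_relabel:
  assumes "\<phi> \<in> tree_isos s t" "l \<in> orderings s (root s)"
  shows "relabel \<phi> l \<in> orderings t (root t)"
  using represents_relabel[OF assms(1)] tree_isos_root[OF assms(1)] assms(2) by (auto simp: orderings_def)

text \<open>\<open>l\<close> and its relabelling list the children of corresponding vertices with
  their decorations, so comparing entries transports the local data along \<phi>.\<close>

lemma represents_transport:
  "represents s l \<Longrightarrow> represents t (relabel \<phi> l) \<Longrightarrow> v \<in> set (labels l) \<Longrightarrow>
    dec t (\<phi> v) = dec s v \<and> children t (\<phi> v) = \<phi> ` children s v \<and>
    (\<forall>u\<in>children s v. edec t (\<phi> v) (\<phi> u) = edec s v u)"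
proof (induction l rule: ptree_induct)
  case (Node x p cs)
  have ch: "(\<lambda>x. lab (snd x)) ` set cs = children s x" "(\<lambda>x. \<phi> (lab (snd x))) ` set cs = children t (\<phi> x)"
    using Node.prems(1,2) by (auto simp: image_image)
  show ?case
  proof (cases "v = x")
    case True
    have "children t (\<phi> x) = \<phi> ` children s x"
      unfolding ch(1)[symmetric] ch(2)[symmetric] by (simp only: image_image)
    moreover have "edec t (\<phi> x) (\<phi> u) = edec s x u" if u: "u \<in> children s x" for u
    proof -
      have "u \<in> (\<lambda>x. lab (snd x)) ` set cs" using u ch by simp
      then obtain y where y: "y \<in> set cs" "u = lab (snd y)" by (rule imageE)
      have "fst y = edec s x (lab (snd y))" using Node.prems(1) y by simp
      moreover have "fst y = edec t (\<phi> x) (\<phi> (lab (snd y)))" using Node.prems(2) y by simp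
      ultimately show ?thesis using y by simp
    qed
    ultimately show ?thesis using Node.prems(1,2) True by simp
  next
    case False
    then obtain y where "y \<in> set cs" "v \<in> set (labels (snd y))" using Node.prems(3) by auto
    then show ?thesis using Node.IH[of y] Node.prems(1,2) by simp
  qed
qed

lemma iso_of_orderings:
  assumes l: "l \<in> orderings s (root s)" and l': "l' \<in> orderings t (root t)" and eq: "strip l = strip l'"
  obtains \<phi> where "\<phi> \<in> tree_isos s t" "relabel \<phi> l = l'"
proof -
  have rl: "represents s l" "set (labels l) = verts s" "distinct (labels l)"
    using l s.represents_labels[of l] s.root_verts by (auto simp: orderings_def)
  have rl': "represents t l'" "set (labels l') = verts t" "distinct (labels l')"
    using l' t.represents_labels[of l'] t.root_verts by (auto simp: orderings_def)
  have len: "length (labels l) = length (labels l')"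
    by (rule length_labels_strip[OF eq])
  \<comment> \<open>The i-th label of \<open>l\<close> is sent to the i-th label of
    \<open>l'\<close>; both lists run through all vertices without repetition.\<close>
  define \<phi> where "\<phi> = restrict (\<lambda>x. the (map_of (zip (labels l) (labels l')) x)) (verts s)"
  have "\<phi> (labels l ! i) = labels l' ! i" if "i < length (labels l)" for i
    using that rl(2) nth_mem[OF that] len map_of_zip_nth[OF len rl(3), of i] by (simp add: \<phi>_def)
  then have map: "map \<phi> (labels l) = labels l'"
    using len by (intro nth_equalityI) auto
  have relabel: "relabel \<phi> l = l'"
    by (rule relabel_eqI[OF eq map])
  have inj: "inj_on \<phi> (verts s)" and img: "\<phi> ` verts s = verts t"
    using map rl(2) rl'(2,3) by (metis distinct_map, metis list.set_map)
  have tr: "dec t (\<phi> v) = dec s v" "children t (\<phi> v) = \<phi> ` children s v"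
    "\<And>u. u \<in> children s v \<Longrightarrow> edec t (\<phi> v) (\<phi> u) = edec s v u" if "v \<in> verts s" for v
    using represents_transport[OF rl(1), of \<phi> v] rl(2) rl'(1) relabel that by auto
  have cov: "covers t (\<phi> v) (\<phi> u)" if "covers s v u" for u v
  proof -
    have "v \<in> verts s" using s.covers_ord[OF that] s.ord_verts by blast
    then show ?thesis using tr(2)[of v] that by (auto simp: children_def)
  qed
  have img': "\<phi> v \<in> verts t" if "v \<in> verts s" for v
    using img that by blast
  \<comment> \<open>The inverse preserves covers as well, hence the order, which gives the reverse
    implication for \<open>ord\<close>.\<close>
  define \<psi> where "\<psi> = inv_into (verts s) \<phi>"
  have \<psi>: "\<psi> w \<in> verts s" "\<phi> (\<psi> w) = w" if "w \<in> verts t" for w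
    using that img inv_into_into[of w \<phi> "verts s"] f_inv_into_f[of w \<phi> "verts s"] by (simp_all add: \<psi>_def)
  have \<psi>\<phi>: "\<psi> (\<phi> v) = v" if "v \<in> verts s" for v
    using that inj by (simp add: \<psi>_def)
  have cov': "covers s (\<psi> v) (\<psi> u)" if "covers t v u" for u v
  proof -
    have v: "v \<in> verts t" using t.covers_ord[OF that] t.ord_verts by blast
    have "children t v = \<phi> ` children s (\<psi> v)"
      using tr(2)[OF \<psi>(1)[OF v]] \<psi>(2)[OF v] by simp
    moreover have "u \<in> children t v" using that by (simp add: children_def)
    ultimately have "u \<in> \<phi> ` children s (\<psi> v)" by simp
    then show ?thesis
      using \<psi>\<phi> s.children_verts by (auto simp: children_def)
  qed
  have "\<phi> \<in> tree_isos s t"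
    unfolding tree_isos_def
  proof (intro CollectI conjI ballI allI impI)
    show "\<phi> \<in> verts s \<rightarrow>\<^sub>E verts t"
      using img by (auto simp: \<phi>_def)
    show "bij_betw \<phi> (verts s) (verts t)"
      using inj img by (simp add: bij_betw_def)
    show "dec t (\<phi> v) = dec s v" if "v \<in> verts s" for v
      using tr(1)[OF that] .
    show "edec t (\<phi> v) (\<phi> u) = edec s v u" if "covers s v u" for u v
      using tr(3)[of v u] that s.covers_ord[OF that] s.ord_verts by (auto simp: children_def)
    show "(u, v) \<in> ord s \<longleftrightarrow> (\<phi> u, \<phi> v) \<in> ord t" if uv: "u \<in> verts s" "v \<in> verts s" for u v
    proof
      assume "(u, v) \<in> ord s"
      show "(\<phi> u, \<phi> v) \<in> ord t"
        by (rule s.ord_mono_of_covers[where f = \<phi>, OF t.rooted]) (fact img' cov \<open>(u, v) \<in> ord s\<close>)+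
    next
      assume "(\<phi> u, \<phi> v) \<in> ord t"
      have "(\<psi> (\<phi> u), \<psi> (\<phi> v)) \<in> ord s"
        by (rule t.ord_mono_of_covers[where f = \<psi>, OF s.rooted]) (fact \<psi>(1) cov' \<open>(\<phi> u, \<phi> v) \<in> ord t\<close>)+
      then show "(u, v) \<in> ord s"
        using \<psi>\<phi> uv by simp
    qed
  qed
  then show ?thesis using that relabel by blast
qed

text \<open>The isomorphisms from \<open>s\<close> act simply transitively on the orderings of a given shape.\<close>

lemma card_tree_isos:
  assumes l: "l \<in> orderings s (root s)"
  shows "card {l' \<in> orderings t (root t). strip l' = strip l} = card (tree_isos s t)"
proof -
  have labels: "set (labels l) = verts s"
    using l s.represents_labels[of l] s.root_verts by (auto simp: orderings_def)
  have "bij_betw (\<lambda>\<phi>. relabel \<phi> l) (tree_isos s t) {l' \<in> orderings t (root t). strip l' = strip l}"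
    unfolding bij_betw_def
  proof
    show "inj_on (\<lambda>\<phi>. relabel \<phi> l) (tree_isos s t)"
    proof (rule inj_onI)
      fix \<phi> \<psi> assume iso: "\<phi> \<in> tree_isos s t" "\<psi> \<in> tree_isos s t" "relabel \<phi> l = relabel \<psi> l"
      show "\<phi> = \<psi>"
        using iso(3) labels by (intro extensionalityI[OF tree_isosD(2)[OF iso(1)] tree_isosD(2)[OF iso(2)]])
          (simp add: relabel_eq_iff)
    qed
    show "(\<lambda>\<phi>. relabel \<phi> l) ` tree_isos s t = {l' \<in> orderings t (root t). strip l' = strip l}"
    proof (intro equalityI subsetI)
      fix l' assume "l' \<in> {l' \<in> orderings t (root t). strip l' = strip l}"
      then have l': "l' \<in> orderings t (root t)" "strip l = strip l'" by auto
      obtain \<phi> where "\<phi> \<in> tree_isos s t" "relabel \<phi> l = l'"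
        using iso_of_orderings[OF l l'] .
      then show "l' \<in> (\<lambda>\<phi>. relabel \<phi> l) ` tree_isos s t" by blast
    qed (use ordering_relabel l in \<open>auto simp: relabel_relabel\<close>)
  qed
  then show ?thesis by (simp add: bij_betw_same_card)
qed

end

text \<open>The planar trees obtained by ordering \<open>t\<close> and forgetting its vertices. By
  \<open>tree_isos_iff_shapes\<close> this is a complete isomorphism invariant.\<close>

definition shapes :: "('v, 'p, 'e) dtree \<Rightarrow> (unit, 'p, 'e) ptree set" where
  "shapes t = strip ` orderings t (root t)"

context rtree
begin

lemma card_orderings_root:
  "finite (orderings t (root t))" "card (orderings t (root t)) = (\<Prod>u\<in>verts t. fact (card (children t u)))"
  using card_orderings[OF root_verts(1)] root_verts(2) by simp_all

lemma orderings_nonempty: "orderings t (root t) \<noteq> {}"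
proof
  assume "orderings t (root t) = {}"
  then have "(\<Prod>u\<in>verts t. fact (card (children t u))) = (0::nat)"
    using card_orderings_root(2) by simp
  then show False using finite_verts by simp
qed

lemma finite_shapes: "finite (shapes t)" and shapes_nonempty: "shapes t \<noteq> {}"
  using card_orderings_root(1) orderings_nonempty by (simp_all add: shapes_def)

text \<open>The orderings are grouped by shape. Automorphisms act simply transitively on each group,
  and the total number of orderings is the product of factorials.\<close>

lemma card_shapes_Aut: "card (shapes t) * card (Aut t) = (\<Prod>u\<in>verts t. fact (card (children t u)))"
proof -
  interpret rtree_pair t t by unfold_locales
  have "card (orderings t (root t)) = (\<Sum>T\<in>shapes t. card {l \<in> orderings t (root t). strip l = T})"
    unfolding shapes_def card_eq_sum using card_orderings_root(1) by (rule sum.image_gen)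
  also have "\<dots> = (\<Sum>T\<in>shapes t. card (Aut t))"
    using card_tree_isos by (intro sum.cong) (auto simp: shapes_def Aut_def)
  finally show ?thesis
    by (simp add: card_orderings_root(2))
qed

end

context rtree_pair
begin

lemma iso_if_common_shape:
  assumes "shapes s \<inter> shapes t \<noteq> {}"
  shows "tree_isos s t \<noteq> {}"
proof -
  obtain T where "T \<in> shapes s" "T \<in> shapes t" using assms by blast
  then obtain l l' where l: "l \<in> orderings s (root s)" "l' \<in> orderings t (root t)" "strip l = strip l'"
    unfolding shapes_def by (elim imageE) simp
  obtain \<phi> where "\<phi> \<in> tree_isos s t" using iso_of_orderings[OF l] .
  then show ?thesis by blast
qed

lemma shapes_subset_if_iso:
  assumes "tree_isos s t \<noteq> {}"
  shows "shapes s \<subseteq> shapes t"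
proof -
  obtain \<phi> where \<phi>: "\<phi> \<in> tree_isos s t" using assms by blast
  have "strip l = strip (relabel \<phi> l)" for l by (simp add: relabel_relabel)
  then show ?thesis using ordering_relabel[OF \<phi>] by (auto simp: shapes_def)
qed

end

text \<open>A single common shape already yields an isomorphism, and an isomorphism carries over
  every shape. Thus two shape sets are equal or disjoint.\<close>

lemma tree_isos_iff_shapes:
  assumes "rooted_tree s" "rooted_tree t"
  shows "tree_isos s t \<noteq> {} \<longleftrightarrow> shapes s \<inter> shapes t \<noteq> {}" "tree_isos s t \<noteq> {} \<longleftrightarrow> shapes s = shapes t"
proof -
  interpret st: rtree_pair s t using assms by unfold_locales
  interpret ts: rtree_pair t s ..
  have ne: "shapes s \<noteq> {}" by (rule st.s.shapes_nonempty)
  show 1: "tree_isos s t \<noteq> {} \<longleftrightarrow> shapes s \<inter> shapes t \<noteq> {}"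
    using st.iso_if_common_shape st.shapes_subset_if_iso ne by (metis Int_absorb2)
  show "tree_isos s t \<noteq> {} \<longleftrightarrow> shapes s = shapes t"
  proof
    assume iso: "tree_isos s t \<noteq> {}"
    then have "shapes t \<inter> shapes s \<noteq> {}" using 1 by blast
    then show "shapes s = shapes t"
      using st.shapes_subset_if_iso[OF iso] ts.shapes_subset_if_iso ts.iso_if_common_shape by blast
  next
    assume "shapes s = shapes t"
    then show "tree_isos s t \<noteq> {}" using 1 ne by simp
  qed
qed

subsection \<open>Weights of planar trees\<close>

fun pweight :: "('p \<Rightarrow> nat) \<Rightarrow> ('v, 'p, 'e) ptree \<Rightarrow> nat" where
  "pweight w (Node v p cs) = w p + (\<Sum>x\<leftarrow>cs. pweight w (snd x))"

definition root_factor ::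
    "'i set \<Rightarrow> ('i \<Rightarrow> 'p set) \<Rightarrow> ('p \<Rightarrow> 'e set) \<Rightarrow> ('e \<Rightarrow> 'i \<Rightarrow> 'k) \<Rightarrow> 'p \<Rightarrow> ('e \<times> ('v, 'p, 'e) ptree) list \<Rightarrow> 'k::field_char_0" where
  "root_factor I P E \<mu> p cs =
     (\<Prod>e\<in>E p. \<Prod>j\<in>I. ffact (\<mu> e j) (length (filter (\<lambda>x. deco (snd x) \<in> P j \<and> fst x = e) cs)))"

text \<open>The factorials of the numbers of children in the denominators take the place of |Aut(t)|
  once the sum runs over shapes.\<close>

fun pfactor ::
    "'i set \<Rightarrow> ('i \<Rightarrow> 'p set) \<Rightarrow> ('p \<Rightarrow> 'e set) \<Rightarrow> ('e \<Rightarrow> 'i \<Rightarrow> 'k) \<Rightarrow> ('v, 'p, 'e) ptree \<Rightarrow> 'k::field_char_0" where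
  "pfactor I P E \<mu> (Node v p cs) =
     root_factor I P E \<mu> p cs / fact (length cs) * (\<Prod>x\<leftarrow>cs. pfactor I P E \<mu> (snd x))"

text \<open>The identity \<psi> = \<Lambda> \<circ> F turned into a recursive definition, from which
  the tubings have disappeared.\<close>

fun ppoly :: "('p \<Rightarrow> ('e, 'k) mpoly \<Rightarrow> 'k poly) \<Rightarrow> ('v, 'p, 'e) ptree \<Rightarrow> 'k::field_char_0 poly" where
  "ppoly \<Lambda> (Node v p cs) = \<Lambda> p (\<Prod>x\<leftarrow>cs. subst_var (fst x) (ppoly \<Lambda> (snd x)))"

fun valid :: "'p set \<Rightarrow> ('p \<Rightarrow> 'e set) \<Rightarrow> ('v, 'p, 'e) ptree \<Rightarrow> bool" where
  "valid PP E (Node v p cs) \<longleftrightarrow> p \<in> PP \<and> (\<forall>x\<in>set cs. fst x \<in> E p \<and> valid PP E (snd x))"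

lemma pweight_relabel: "pweight w (relabel f l) = pweight w l"
  by (induction l rule: ptree_induct) (simp add: o_def cong: map_cong)

lemma root_factor_relabel:
  "root_factor I P E \<mu> p (map (\<lambda>x. (fst x, relabel f (snd x))) cs) = root_factor I P E \<mu> p cs"
  by (simp add: root_factor_def filter_map o_def)

lemma pfactor_relabel: "pfactor I P E \<mu> (relabel f l) = pfactor I P E \<mu> l"
  by (induction l rule: ptree_induct) (simp add: o_def root_factor_relabel cong: map_cong)

lemma ppoly_relabel: "ppoly \<Lambda> (relabel f l) = ppoly \<Lambda> l"
  by (induction l rule: ptree_induct) (simp add: o_def cong: map_cong)

lemma valid_relabel: "valid PP E (relabel f l) = valid PP E l"
  by (induction l rule: ptree_induct) auto

context rtree
begin

lemma represents_Node:
  assumes "represents t (Node v p cs)"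
  shows "v \<in> verts t" "p = dec t v" "distinct (map (\<lambda>x. lab (snd x)) cs)"
    "set (map (\<lambda>x. lab (snd x)) cs) = children t v" "length cs = card (children t v)"
    "x \<in> set cs \<Longrightarrow> fst x = edec t v (lab (snd x)) \<and> represents t (snd x)"
proof -
  show 1: "v \<in> verts t" "p = dec t v" "distinct (map (\<lambda>x. lab (snd x)) cs)"
    "set (map (\<lambda>x. lab (snd x)) cs) = children t v"
    "x \<in> set cs \<Longrightarrow> fst x = edec t v (lab (snd x)) \<and> represents t (snd x)"
    using assms by auto
  show "length cs = card (children t v)"
    using distinct_card[OF 1(3)] unfolding 1(4) by simp
qed

lemma sum_children:
  assumes "represents t (Node v p cs)"
  shows "(\<Sum>c\<in>children t v. g c) = (\<Sum>x\<leftarrow>cs. g (lab (snd x)))"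
  using sum.distinct_set_conv_list[OF represents_Node(3)[OF assms], of g]
  unfolding represents_Node(4)[OF assms] by (simp add: o_def)

lemma prod_children:
  assumes "represents t (Node v p cs)"
  shows "(\<Prod>c\<in>children t v. g c) = (\<Prod>x\<leftarrow>cs. g (lab (snd x)))"
  using prod.distinct_set_conv_list[OF represents_Node(3)[OF assms], of g]
  unfolding represents_Node(4)[OF assms] by (simp add: o_def)

lemma pweight_represents: "represents t l \<Longrightarrow> pweight w l = (\<Sum>u\<in>D (lab l). w (dec t u))"
proof (induction l rule: ptree_induct)
  case (Node v p cs)
  note rep = represents_Node[OF Node.prems]
  have "(\<Sum>x\<leftarrow>cs. pweight w (snd x)) = (\<Sum>x\<leftarrow>cs. \<Sum>u\<in>D (lab (snd x)). w (dec t u))"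
    using Node.IH rep(6) by (intro arg_cong[of _ _ sum_list] map_cong) auto
  then show ?case
    using sum_D[OF rep(1), of "\<lambda>u. w (dec t u)"] rep(2)
      sum_children[OF Node.prems, of "\<lambda>c. \<Sum>u\<in>D c. w (dec t u)"] by simp
qed

lemma root_factor_represents:
  assumes "represents t (Node v p cs)"
  shows "root_factor I P E \<mu> p cs = (\<Prod>e\<in>E (dec t v). \<Prod>j\<in>I. ffact (\<mu> e j) (od P t v e j))"
proof -
  note rep = represents_Node[OF assms]
  have "length (filter (\<lambda>x. deco (snd x) \<in> P j \<and> fst x = e) cs) = od P t v e j" for e j
  proof -
    let ?us = "map (\<lambda>x. lab (snd x)) cs"
    have "od P t v e j = card (set (filter (\<lambda>u. dec t u \<in> P j \<and> edec t v u = e) ?us))"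
      unfolding od_def rep(4)[symmetric] by simp
    also have "\<dots> = length (filter (\<lambda>u. dec t u \<in> P j \<and> edec t v u = e) ?us)"
      using rep(3) by (intro distinct_card distinct_filter)
    also have "\<dots> = length (filter (\<lambda>x. dec t (lab (snd x)) \<in> P j \<and> edec t v (lab (snd x)) = e) cs)"
      by (simp add: filter_map o_def)
    also have "filter (\<lambda>x. dec t (lab (snd x)) \<in> P j \<and> edec t v (lab (snd x)) = e) cs =
        filter (\<lambda>x. deco (snd x) \<in> P j \<and> fst x = e) cs"
      using rep(6) represents_deco[of t] by (intro filter_cong refl) metis
    finally show ?thesis by simp
  qed
  then show ?thesis
    unfolding root_factor_def rep(2) by simp
qed

lemma pfactor_represents:
  "represents t l \<Longrightarrow> pfactor I P E \<mu> l =
    (\<Prod>u\<in>D (lab l). \<Prod>e\<in>E (dec t u). \<Prod>j\<in>I. ffact (\<mu> e j) (od P t u e j)) /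
    (\<Prod>u\<in>D (lab l). fact (card (children t u)))"
proof (induction l rule: ptree_induct)
  case (Node v p cs)
  note rep = represents_Node[OF Node.prems]
  let ?g = "\<lambda>u. (\<Prod>e\<in>E (dec t u). \<Prod>j\<in>I. ffact (\<mu> e j) (od P t u e j)) / fact (card (children t u))"
  have "(\<Prod>x\<leftarrow>cs. pfactor I P E \<mu> (snd x)) = (\<Prod>x\<leftarrow>cs. prod ?g (D (lab (snd x))))"
    using Node.IH rep(6) by (intro arg_cong[of _ _ prod_list] map_cong) (auto simp: prod_dividef)
  then have "pfactor I P E \<mu> (Node v p cs) = prod ?g (D v)"
    using prod_D[OF rep(1), of ?g] prod_children[OF Node.prems, of "\<lambda>c. prod ?g (D c)"]
      root_factor_represents[OF Node.prems, of I P E \<mu>] rep(5) by simp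
  then show ?case
    by (simp add: prod_dividef)
qed

end

context decorated_rtree
begin

lemma valid_represents: "represents t l \<Longrightarrow> valid PP E l"
proof (induction l rule: ptree_induct)
  case (Node v p cs)
  note rep = represents_Node[OF Node.prems]
  have "fst x \<in> E p \<and> valid PP E (snd x)" if x: "x \<in> set cs" for x
  proof -
    have "lab (snd x) \<in> set (map (\<lambda>x. lab (snd x)) cs)" using x by simp
    then have "covers t v (lab (snd x))" unfolding rep(4) by (simp add: children_def)
    then show ?thesis
      using edec_E rep(2,6) Node.IH[OF x] x by metis
  qed
  then show ?case
    using dec_PP[OF rep(1)] rep(2) by simp
qed

lemma ppoly_represents:
  assumes \<Lambda>: "\<And>p. p \<in> PP \<Longrightarrow> one_cocycle (E p) (\<Lambda> p)" "\<And>p. p \<in> PP \<Longrightarrow> a p = cocycle_coeffs (E p) (\<Lambda> p)"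
  shows "represents t l \<Longrightarrow> ppoly \<Lambda> l = tube_poly (D (lab l)) (lab l)"
proof (induction l rule: ptree_induct)
  case (Node v p cs)
  note rep = represents_Node[OF Node.prems]
  have v: "rtube (D v) v" by (rule rtube_D[OF rep(1)])
  have "(\<Prod>x\<leftarrow>cs. subst_var (fst x) (ppoly \<Lambda> (snd x))) =
      (\<Prod>x\<leftarrow>cs. subst_var (edec t v (lab (snd x))) (tube_poly (D (lab (snd x))) (lab (snd x))))"
    using Node.IH rep(6) by (intro arg_cong[of _ _ prod_list] map_cong) auto
  also have "\<dots> = (\<Prod>c\<in>children t v. subst_var (edec t v c) (tube_poly (D c) c))"
    by (rule prod_children[OF Node.prems, symmetric])
  also have "\<dots> = branch_poly (D v) v"
  proof -
    have "D v \<inter> D c = D c" if "c \<in> children t v" for c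
      using D_children[OF rep(1)] that by blast
    moreover have "children t v \<inter> D v = children t v"
      using covers_ord by (auto simp: children_def D_def)
    ultimately show ?thesis
      unfolding branch_poly_def by simp
  qed
  finally show ?case
    using tube_poly_eq_cocycle[OF v \<Lambda>(1) \<Lambda>(2)] dec_PP[OF rep(1)] rep(2) by simp
qed

end

lemma smult_sum_right: "smult c (sum f A) = (\<Sum>x\<in>A. smult c (f x))"
  by (induction A rule: infinite_finite_induct) (simp_all add: smult_add_right)

definition pterm ::
    "'i set \<Rightarrow> ('i \<Rightarrow> 'p set) \<Rightarrow> ('p \<Rightarrow> nat) \<Rightarrow> ('p \<Rightarrow> 'e set) \<Rightarrow> ('e \<Rightarrow> 'i \<Rightarrow> 'k)
      \<Rightarrow> ('p \<Rightarrow> ('e, 'k) mpoly \<Rightarrow> 'k poly) \<Rightarrow> ('v, 'p, 'e) ptree \<Rightarrow> 'k::field_char_0 poly fps" where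
  "pterm I P w E \<mu> \<Lambda> T = fps_const (smult (pfactor I P E \<mu> T) (ppoly \<Lambda> T)) * fps_X ^ pweight w T"

context decorated_rtree
begin

lemma smult_tube_poly_root:
  "(\<Sum>\<tau>\<in>Tub t. smult (mel E a t \<tau>) (\<Sum>k=1..bnum t \<tau>.
      monom (a (dec t (root t)) (beta_vec E t \<tau> k) / (of_nat m * fact k)) k)) =
    smult (1 / of_nat m) (tube_poly (verts t) (root t))"
proof -
  have "monom (x / (of_nat m * fact k)) k = smult (1 / of_nat m) (monom (x / fact k) k)" for x :: 'k and k
    by (simp add: smult_monom)
  moreover have "mel E a t \<tau> = mel_at E a (verts t) (root t) \<tau>" "bnum t \<tau> = card {Z \<in> \<tau>. root t \<in> Z}"
    "beta_vec E t \<tau> k = beta_at E (root t) \<tau> k" for \<tau> k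
    by (simp_all add: mel_def mel_at_def bnum_def beta_vec_def beta_at_def)
  ultimately show ?thesis
    unfolding tube_poly_def Tub_eq_tubs by (simp add: smult_sum_right mult.commute)
qed

text \<open>All shapes of \<open>t\<close> contribute the same term, and their number divided by the
  product of factorials is 1 / |Aut(t)|.\<close>

lemma tree_term_eq_sum_shapes:
  assumes \<Lambda>: "\<And>p. p \<in> PP \<Longrightarrow> one_cocycle (E p) (\<Lambda> p)" "\<And>p. p \<in> PP \<Longrightarrow> a p = cocycle_coeffs (E p) (\<Lambda> p)"
  shows "tree_term I P w E \<mu> a t = (\<Sum>T\<in>shapes t. pterm I P w E \<mu> \<Lambda> T)"
proof -
  let ?N = "(\<Prod>u\<in>verts t. fact (card (children t u))) :: 'k"
  let ?tp = "tube_poly (verts t) (root t)"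
  let ?IF = "insertion_factor I P E \<mu> t"
  have pt: "pterm I P w E \<mu> \<Lambda> T = fps_const (smult (?IF / ?N) ?tp) * fps_X ^ weight w t" if "T \<in> shapes t" for T
  proof -
    obtain l where l: "represents t l" "lab l = root t" "T = strip l"
      using \<open>T \<in> shapes t\<close> by (auto simp: shapes_def orderings_def)
    have "pweight w T = weight w t"
      using pweight_represents[OF l(1), of w] l(2,3) root_verts(2) by (simp add: pweight_relabel weight_def)
    moreover have "ppoly \<Lambda> T = ?tp"
      using ppoly_represents[OF \<Lambda> l(1)] l(2,3) root_verts(2) by (simp add: ppoly_relabel)
    moreover have "pfactor I P E \<mu> T = ?IF / ?N"
      using pfactor_represents[OF l(1), of I P E \<mu>] l(2,3) root_verts(2)
      by (simp add: pfactor_relabel insertion_factor_def)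
    ultimately show ?thesis by (simp add: pterm_def)
  qed
  have N: "of_nat (card (shapes t)) * of_nat (card (Aut t)) = ?N"
    using arg_cong[OF card_shapes_Aut, of "of_nat :: nat \<Rightarrow> 'k"] by simp
  have "?N \<noteq> 0" using finite_verts by simp
  then have IF: "?IF * (1 / of_nat (card (Aut t))) = of_nat (card (shapes t)) * (?IF / ?N)"
    unfolding N[symmetric] by (auto simp: field_simps)
  have smult: "fps_const (smult (of_nat m * x) q) = of_nat m * fps_const (smult x q)" for m x and q :: "'k poly"
    by (simp add: fps_of_nat[symmetric] fps_const_mult[symmetric] of_nat_poly del: fps_const_mult)
  have "tree_term I P w E \<mu> a t =
      fps_const (smult (?IF * (1 / of_nat (card (Aut t)))) ?tp) * fps_X ^ weight w t"
    unfolding tree_term_def smult_tube_poly_root by simp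
  also have "\<dots> = of_nat (card (shapes t)) * (fps_const (smult (?IF / ?N) ?tp) * fps_X ^ weight w t)"
    unfolding IF smult by (rule mult.assoc)
  also have "\<dots> = (\<Sum>T\<in>shapes t. pterm I P w E \<mu> \<Lambda> T)"
    using pt by simp
  finally show ?thesis .
qed

end

subsection \<open>Posets of planar trees\<close>

fun subtree :: "('v, 'p, 'e) ptree \<Rightarrow> nat list \<Rightarrow> ('v, 'p, 'e) ptree option" where
  "subtree l [] = Some l"
| "subtree (Node v p cs) (i # q) = (if i < length cs then subtree (snd (cs ! i)) q else None)"

definition positions :: "('v, 'p, 'e) ptree \<Rightarrow> nat list set" where
  "positions l = {q. subtree l q \<noteq> None}"

lemma positions_Node:
  "positions (Node v p cs) = insert [] (\<Union>i<length cs. (#) i ` positions (snd (cs ! i)))"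
proof (intro equalityI subsetI)
  fix q assume "q \<in> positions (Node v p cs)"
  then show "q \<in> insert [] (\<Union>i<length cs. (#) i ` positions (snd (cs ! i)))"
    by (cases q) (auto simp: positions_def split: if_splits)
qed (auto simp: positions_def)

lemma finite_positions: "finite (positions l)"
proof (induction l rule: ptree_induct)
  case (Node v p cs)
  then show ?case by (auto simp: positions_Node)
qed

lemma subtree_append: "subtree l (q @ q') = (case subtree l q of None \<Rightarrow> None | Some s \<Rightarrow> subtree s q')"
proof (induction q arbitrary: l)
  case (Cons i q)
  then show ?case by (cases l) auto
qed simp

lemma subtree_snoc:
  fixes l :: "('v, 'p, 'e) ptree"
  shows "subtree l (q @ [i]) = (case subtree l q of None \<Rightarrow> None
    | Some s \<Rightarrow> if i < length (subs s) then Some (snd (subs s ! i)) else None)"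
proof -
  have "subtree s [i] = (if i < length (subs s) then Some (snd (subs s ! i)) else None)"
    for s :: "('v, 'p, 'e) ptree"
    by (cases s) simp
  then show ?thesis
    unfolding subtree_append by (simp split: option.split)
qed

lemma positions_prefix: "q' \<in> positions l \<Longrightarrow> prefix q q' \<Longrightarrow> q \<in> positions l"
  by (auto simp: positions_def prefix_def subtree_append split: option.splits)

lemma valid_subtree: "valid PP E l \<Longrightarrow> subtree l q = Some s \<Longrightarrow> valid PP E s"
proof (induction q arbitrary: l)
  case (Cons i q)
  then show ?case by (cases l) (auto split: if_splits simp: all_set_conv_all_nth)
qed simp

text \<open>Every planar tree is the shape of the poset of its positions, encoded as natural numbers.\<close>

definition position_tree :: "(unit, 'p, 'e) ptree \<Rightarrow> (nat, 'p, 'e) dtree" where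
  "position_tree T = \<lparr>verts = list_encode ` positions T,
     ord = {(m, n). m \<in> list_encode ` positions T \<and> n \<in> list_encode ` positions T \<and>
       prefix (list_decode n) (list_decode m)},
     dec = (\<lambda>n. deco (the (subtree T (list_decode n)))),
     edec = (\<lambda>m n. fst (subs (the (subtree T (list_decode m))) ! last (list_decode n)))\<rparr>"

lemma mem_encode_positions: "n \<in> list_encode ` positions T \<longleftrightarrow> list_decode n \<in> positions T"
  by (metis (no_types, lifting) image_iff list_decode_inverse list_encode_inverse)

lemma position_tree_covers:
  "covers (position_tree T) m n \<longleftrightarrow>
    list_decode n \<in> positions T \<and> (\<exists>i. list_decode n = list_decode m @ [i])"
proof
  assume cov: "covers (position_tree T) m n"
  then have n: "list_decode n \<in> positions T" "n \<noteq> m" "prefix (list_decode m) (list_decode n)"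
    by (auto simp: covers_def position_tree_def mem_encode_positions)
  then obtain r where r: "list_decode n = list_decode m @ r" by (auto simp: prefix_def)
  have "r \<noteq> []" using r n(2) by (metis append_Nil2 list_decode_inverse)
  then obtain i r' where r': "r = i # r'" by (cases r) auto
  \<comment> \<open>The position of \<open>m\<close> extended by one index lies weakly between
    \<open>n\<close> and \<open>m\<close> and differs from \<open>m\<close>; as \<open>m\<close>
    covers \<open>n\<close>, it is \<open>n\<close>.\<close>
  let ?z = "list_encode (list_decode m @ [i])"
  have z: "prefix (list_decode ?z) (list_decode n)" "prefix (list_decode m) (list_decode ?z)"
    by (simp_all add: r r')
  have "list_decode ?z \<in> positions T" "list_decode m \<in> positions T"
    using positions_prefix n z by blast+
  then have "(n, ?z) \<in> ord (position_tree T)" "(?z, m) \<in> ord (position_tree T)"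
    using n z by (simp_all add: position_tree_def mem_encode_positions)
  moreover have "?z \<noteq> m"
    by (metis append_self_conv list.distinct(1) list_encode_inverse)
  ultimately have "?z = n"
    using cov by (auto simp: covers_def)
  then have "list_decode n = list_decode m @ [i]"
    by (metis list_encode_inverse)
  with n show "list_decode n \<in> positions T \<and> (\<exists>i. list_decode n = list_decode m @ [i])"
    by blast
next
  assume "list_decode n \<in> positions T \<and> (\<exists>i. list_decode n = list_decode m @ [i])"
  then obtain i where n: "list_decode n \<in> positions T" "list_decode n = list_decode m @ [i]" by blast
  have m: "list_decode m \<in> positions T" using positions_prefix n by (metis prefixI)
  have "m \<noteq> n" using n by auto
  moreover have "z = n \<or> z = m" if "prefix (list_decode m) (list_decode z)" "prefix (list_decode z) (list_decode n)" for z
  proof -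
    have "list_decode z = list_decode m \<or> list_decode z = list_decode n"
      using that n(2) by (metis prefix_order.antisym prefix_snoc)
    then show ?thesis by (metis list_decode_inverse)
  qed
  ultimately show "covers (position_tree T) m n"
    using n m by (auto simp: covers_def position_tree_def mem_encode_positions)
qed

lemma position_tree_rooted: "rooted_tree (position_tree T)"
  unfolding rooted_tree_def
proof (intro conjI allI impI)
  show "finite (verts (position_tree T))"
    by (simp add: position_tree_def finite_positions)
  show "partial_order_on (verts (position_tree T)) (ord (position_tree T))"
    unfolding partial_order_on_def preorder_on_def
  proof (intro conjI)
    show "refl_on (verts (position_tree T)) (ord (position_tree T))"
      by (auto simp: refl_on_def position_tree_def)
    show "antisym (ord (position_tree T))"
      unfolding antisym_def position_tree_def by simp (metis list_decode_inverse prefix_order.antisym)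
    show "trans (ord (position_tree T))"
      unfolding trans_def position_tree_def by simp (metis prefix_order.trans)
  qed (auto simp: position_tree_def)
  have "[] \<in> positions T" by (simp add: positions_def)
  then show "\<exists>r\<in>verts (position_tree T). \<forall>v\<in>verts (position_tree T). (v, r) \<in> ord (position_tree T)"
    by (intro bexI[of _ "list_encode []"]) (auto simp: position_tree_def mem_encode_positions simp del: list_encode.simps)
  fix u v v' assume "covers (position_tree T) v u \<and> covers (position_tree T) v' u"
  then show "v = v'"
    unfolding position_tree_covers by (metis butlast_snoc list_decode_inverse)
qed

lemma position_tree_decorated:
  assumes "valid PP E T"
  shows "decorated_tree PP E (position_tree T)"
  unfolding decorated_tree_def
proof (intro conjI ballI allI impI)
  have val: "valid PP E (the (subtree T q))" if "q \<in> positions T" for q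
    using that valid_subtree[OF assms] by (auto simp: positions_def)
  fix v assume "v \<in> verts (position_tree T)"
  then have "list_decode v \<in> positions T"
    by (simp add: position_tree_def mem_encode_positions)
  from val[OF this] show "dec (position_tree T) v \<in> PP"
    by (cases "the (subtree T (list_decode v))") (simp add: position_tree_def)
next
  fix m n assume "covers (position_tree T) m n"
  then obtain i where n: "list_decode n \<in> positions T" "list_decode n = list_decode m @ [i]"
    unfolding position_tree_covers by blast
  then obtain s where s: "subtree T (list_decode m) = Some s" "i < length (subs s)"
    by (auto simp: positions_def subtree_snoc split: option.splits if_splits)
  have "valid PP E s" by (rule valid_subtree[OF assms s(1)])
  then show "edec (position_tree T) m n \<in> E (dec (position_tree T) m)"
    using s n(2) by (cases s) (auto simp: position_tree_def)
qed (rule position_tree_rooted)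

text \<open>The children are listed by increasing index. Generalising over \<open>q\<close> lets the
  ordering be assembled from those at the positions \<open>q @ [i]\<close>.\<close>

lemma position_tree_represents:
  "subtree T q = Some s \<Longrightarrow> \<exists>l. represents (position_tree T) l \<and> lab l = list_encode q \<and> strip l = s"
proof (induction s arbitrary: q rule: ptree_induct)
  case (Node v p cs)
  have sub: "subtree T (q @ [i]) = Some (snd (cs ! i))" if "i < length cs" for i
    using that Node.prems by (simp add: subtree_snoc)
  have "\<exists>l. represents (position_tree T) l \<and> lab l = list_encode (q @ [i]) \<and> strip l = snd (cs ! i)"
    if "i < length cs" for i
    using Node.IH[of "cs ! i"] sub[OF that] that by simp
  then obtain f where f: "\<And>i. i < length cs \<Longrightarrow> represents (position_tree T) (f i) \<and>
      lab (f i) = list_encode (q @ [i]) \<and> strip (f i) = snd (cs ! i)"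
    by metis
  let ?cs = "map (\<lambda>i. (fst (cs ! i), f i)) [0..<length cs]"
  let ?l = "Node (list_encode q) p ?cs"
  have ch: "children (position_tree T) (list_encode q) = (\<lambda>i. list_encode (q @ [i])) ` {0..<length cs}"
  proof (intro equalityI subsetI)
    fix n assume "n \<in> children (position_tree T) (list_encode q)"
    then obtain i where i: "list_decode n \<in> positions T" "list_decode n = q @ [i]"
      by (auto simp: children_def position_tree_covers)
    then have "i < length cs"
      using Node.prems by (auto simp: positions_def subtree_snoc split: if_splits)
    moreover have "n = list_encode (q @ [i])" using i(2) by (metis list_decode_inverse)
    ultimately show "n \<in> (\<lambda>i. list_encode (q @ [i])) ` {0..<length cs}" by auto
  qed (use sub in \<open>auto simp: children_def position_tree_covers positions_def\<close>)
  have labs: "map (\<lambda>x. lab (snd x)) ?cs = map (\<lambda>i. list_encode (q @ [i])) [0..<length cs]"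
    using f by simp
  have "represents (position_tree T) ?l"
    unfolding represents.simps
  proof (intro conjI ballI)
    show "list_encode q \<in> verts (position_tree T)" "p = dec (position_tree T) (list_encode q)"
      using Node.prems by (auto simp: position_tree_def positions_def)
    show "distinct (map (\<lambda>x. lab (snd x)) ?cs)"
      unfolding labs by (simp add: distinct_map inj_on_def inj_list_encode[THEN inj_eq])
    show "(\<lambda>x. lab (snd x)) ` set ?cs = children (position_tree T) (list_encode q)"
      unfolding ch using f by (auto simp: image_image)
    fix x assume "x \<in> set ?cs"
    then obtain i where i: "i < length cs" "x = (fst (cs ! i), f i)" by auto
    show "represents (position_tree T) (snd x)" using f i by simp
    show "fst x = edec (position_tree T) (list_encode q) (lab (snd x))"
      using Node.prems f[OF i(1)] i(2) by (simp add: position_tree_def)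
  qed
  moreover have "strip ?l = Node v p cs"
    using f by (auto intro!: nth_equalityI simp: prod_eq_iff)
  ultimately show ?case
    by (intro exI[of _ ?l] conjI) (assumption, rule ptree.sel(1), assumption)
qed

lemma position_tree_root: "root (position_tree T) = list_encode []"
proof -
  interpret rtree "position_tree T"
    using position_tree_rooted by unfold_locales
  have e: "list_encode [] \<in> verts (position_tree T)"
    by (simp add: position_tree_def positions_def del: list_encode.simps)
  have "(root (position_tree T), list_encode []) \<in> ord (position_tree T)"
    using root_verts(1) e by (auto simp: position_tree_def simp del: list_encode.simps)
  moreover have "(list_encode [], root (position_tree T)) \<in> ord (position_tree T)"
    using root_verts(2) e by (auto simp: D_def)
  ultimately show ?thesis by (rule ord_antisym)
qed

lemma shapes_position_tree: "T \<in> shapes (position_tree T)"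
proof -
  obtain l where "represents (position_tree T) l" "lab l = list_encode []" "strip l = T"
    using position_tree_represents[of T "[]" T] by auto
  then show ?thesis
    by (auto simp: shapes_def orderings_def position_tree_root)
qed

subsection \<open>Isomorphism classes\<close>

text \<open>The representative is chosen as in the theorem; the shapes are the same for all members
  of an isomorphism class.\<close>

definition class_shapes :: "(nat, 'p, 'e) dtree set \<Rightarrow> (unit, 'p, 'e) ptree set" where
  "class_shapes C = shapes (SOME t. t \<in> C)"

lemma shapes_valid:
  assumes "decorated_tree PP E t" "\<forall>p\<in>PP. finite (E p)" "T \<in> shapes t"
  shows "valid PP E T \<and> deco T = dec t (root t)"
proof -
  \<comment> \<open>The locale asks for a family of coefficients; the zero family over
    \<open>rat\<close> serves as a placeholder.\<close>
  interpret decorated_rtree t PP E "\<lambda>_ _. 0 :: rat"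
    using assms by unfold_locales (auto simp: decorated_tree_def)
  obtain l where l: "represents t l" "lab l = root t" "T = strip l"
    using assms(3) by (auto simp: shapes_def orderings_def)
  then show ?thesis
    using valid_represents[OF l(1)] represents_deco[OF l(1)] by (simp add: valid_relabel)
qed

context
  fixes PP :: "'p set" and E :: "'p \<Rightarrow> 'e set" and Q :: "'p set"
  assumes finite_E: "\<forall>p\<in>PP. finite (E p)"
begin

text \<open>Membership is rewritten through shapes, so that the chosen representative can stand in
  for the tree that generated the class.\<close>

lemma tree_class:
  assumes "C \<in> tree_classes PP E Q"
  defines "t \<equiv> SOME t. t \<in> C"
  shows "decorated_tree PP E t" "dec t (root t) \<in> Q"
    "C = {s. decorated_tree PP E s \<and> dec s (root s) \<in> Q \<and> shapes s \<inter> shapes t \<noteq> {}}"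
proof -
  let ?T = "{t :: (nat, 'p, 'e) dtree. decorated_tree PP E t \<and> dec t (root t) \<in> Q}"
  have rooted: "rooted_tree s" if "s \<in> ?T" for s
    using that by (auto simp: decorated_tree_def)
  obtain t0 where t0: "t0 \<in> ?T" and C: "C = {(s, t). s \<in> ?T \<and> t \<in> ?T \<and> tree_isos s t \<noteq> {}} `` {t0}"
    using assms(1) unfolding tree_classes_def Let_def by (rule quotientE)
  have C': "C = {s \<in> ?T. shapes t0 = shapes s}"
    unfolding C using t0 tree_isos_iff_shapes(2)[OF rooted rooted] by auto
  then have "t0 \<in> C" using t0 by simp
  then have "t \<in> C" unfolding t_def by (rule someI)
  then have t: "t \<in> ?T" "shapes t0 = shapes t" using C' by auto
  then show "decorated_tree PP E t" "dec t (root t) \<in> Q" by auto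
  have "shapes t = shapes s \<longleftrightarrow> shapes s \<inter> shapes t \<noteq> {}" if "s \<in> ?T" for s
    using tree_isos_iff_shapes[OF rooted[OF t(1)] rooted[OF that]] by blast
  then show "C = {s. decorated_tree PP E s \<and> dec s (root s) \<in> Q \<and> shapes s \<inter> shapes t \<noteq> {}}"
    unfolding C' t(2) by blast
qed

lemma class_shapes_disjoint:
  assumes "C \<in> tree_classes PP E Q" "C' \<in> tree_classes PP E Q" "C \<noteq> C'"
  shows "class_shapes C \<inter> class_shapes C' = {}"
proof (rule ccontr)
  let ?t = "SOME t. t \<in> C" and ?t' = "SOME t. t \<in> C'"
  assume "class_shapes C \<inter> class_shapes C' \<noteq> {}"
  then have inter: "shapes ?t \<inter> shapes ?t' \<noteq> {}" by (simp add: class_shapes_def)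
  have "rooted_tree ?t" "rooted_tree ?t'"
    using tree_class(1)[OF assms(1)] tree_class(1)[OF assms(2)] by (auto simp: decorated_tree_def)
  then have "shapes ?t = shapes ?t'"
    using tree_isos_iff_shapes inter by blast
  then show False
    using tree_class(3)[OF assms(1)] tree_class(3)[OF assms(2)] assms(3) by simp
qed

text \<open>Every valid planar tree is a shape of its position tree, and therefore occurs in the
  class of the latter.\<close>

lemma Union_class_shapes:
  "(\<Union>C\<in>tree_classes PP E Q. class_shapes C) = {T. valid PP E T \<and> deco T \<in> Q}"
proof (intro equalityI subsetI)
  fix T assume "T \<in> (\<Union>C\<in>tree_classes PP E Q. class_shapes C)"
  then obtain C where C: "C \<in> tree_classes PP E Q" "T \<in> class_shapes C" by blast
  then show "T \<in> {T. valid PP E T \<and> deco T \<in> Q}"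
    using shapes_valid[OF tree_class(1)[OF C(1)] finite_E, of T] tree_class(2)[OF C(1)]
    by (simp add: class_shapes_def)
next
  fix T :: "(unit, 'p, 'e) ptree" assume T: "T \<in> {T. valid PP E T \<and> deco T \<in> Q}"
  let ?s = "position_tree T"
  let ?T = "{t :: (nat, 'p, 'e) dtree. decorated_tree PP E t \<and> dec t (root t) \<in> Q}"
  let ?C = "{(s, t). s \<in> ?T \<and> t \<in> ?T \<and> tree_isos s t \<noteq> {}} `` {?s}"
  have dec: "decorated_tree PP E ?s" using T position_tree_decorated by blast
  have "deco T = dec ?s (root ?s)"
    using shapes_valid[OF dec finite_E shapes_position_tree] by blast
  with T dec have s: "?s \<in> ?T" by auto
  then have C: "?C \<in> tree_classes PP E Q"
    unfolding tree_classes_def Let_def by (rule quotientI)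
  have "tree_isos ?s ?s \<noteq> {}"
    using tree_isos_iff_shapes(2)[of ?s ?s] position_tree_rooted by blast
  then have sC: "?s \<in> ?C" using s by auto
  let ?t = "SOME t. t \<in> ?C"
  have "rooted_tree ?t"
    using tree_class(1)[OF C] by (simp add: decorated_tree_def)
  moreover have "shapes ?s \<inter> shapes ?t \<noteq> {}"
    using sC tree_class(3)[OF C] by blast
  ultimately have "shapes ?s = shapes ?t"
    using tree_isos_iff_shapes[OF position_tree_rooted, of ?t] by blast
  then have "T \<in> class_shapes ?C"
    using shapes_position_tree by (auto simp: class_shapes_def)
  with C show "T \<in> (\<Union>C\<in>tree_classes PP E Q. class_shapes C)" by blast
qed

lemma class_shapes_finite_nonempty:
  assumes "C \<in> tree_classes PP E Q"
  shows "finite (class_shapes C)" "class_shapes C \<noteq> {}"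
proof -
  interpret rtree "SOME t. t \<in> C"
    using tree_class(1)[OF assms] by unfold_locales (simp add: decorated_tree_def)
  show "finite (class_shapes C)" "class_shapes C \<noteq> {}"
    using finite_shapes shapes_nonempty by (simp_all add: class_shapes_def)
qed

end

subsection \<open>Infinite sums of power series\<close>

text \<open>In the x-adic topology it suffices that the n-th coefficient of the finite partial sums
  no longer changes once the index set contains \<open>N n\<close>.\<close>

lemma has_sum_fpsI:
  fixes f :: "'x \<Rightarrow> 'b::comm_ring_1 fps"
  assumes "\<And>n. finite (N n)" "\<And>n. N n \<subseteq> A" "\<And>n x. x \<in> A - N n \<Longrightarrow> fps_nth (f x) n = 0"
    and "\<And>n. fps_nth S n = (\<Sum>x\<in>N n. fps_nth (f x) n)"
  shows "(f has_sum S) A"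
  unfolding has_sum_def
proof (rule tendsto_fpsI)
  fix n
  have eq: "fps_nth (sum f Y) n = fps_nth S n" if "finite Y" "N n \<subseteq> Y" "Y \<subseteq> A" for Y
    unfolding fps_sum_nth assms(4) using that assms(3) by (intro sum.mono_neutral_right) auto
  show "\<forall>\<^sub>F Y in finite_subsets_at_top A. fps_nth (sum f Y) n = fps_nth S n"
    unfolding eventually_finite_subsets_at_top
    by (intro exI[of _ "N n"] conjI allI impI assms(1,2) eq) auto
qed

subsection \<open>Agreement of power series up to a given order\<close>

text \<open>Congruence modulo x^(n+1). It allows infinite families of trees to be truncated to
  finite ones.\<close>

definition agree :: "nat \<Rightarrow> 'a fps \<Rightarrow> 'a fps \<Rightarrow> bool" where
  "agree n F G \<longleftrightarrow> (\<forall>m\<le>n. fps_nth F m = fps_nth G m)"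

lemma agree_refl: "agree n F F"
  by (simp add: agree_def)

lemma agree_mult:
  fixes F :: "'a::comm_ring_1 fps"
  shows "agree n F F' \<Longrightarrow> agree n G G' \<Longrightarrow> agree n (F * G) (F' * G')"
  by (auto simp: agree_def fps_mult_nth intro!: sum.cong)

lemma agree_power:
  fixes F :: "'a::comm_ring_1 fps"
  shows "agree n F F' \<Longrightarrow> agree n (F ^ k) (F' ^ k)"
  by (induction k) (auto intro: agree_mult agree_refl)

lemma agree_prod:
  fixes F :: "'x \<Rightarrow> 'a::comm_ring_1 fps"
  shows "(\<And>x. x \<in> A \<Longrightarrow> agree n (F x) (F' x)) \<Longrightarrow> agree n (prod F A) (prod F' A)"
  by (induction A rule: infinite_finite_induct) (auto intro: agree_mult agree_refl)

lemma agree_compose: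
  fixes F :: "'a::comm_ring_1 fps"
  assumes "agree n F F'"
  shows "agree n (b oo F) (b oo F')"
  unfolding agree_def
proof (intro allI impI)
  fix m assume "m \<le> n"
  then have "fps_nth (F ^ k) m = fps_nth (F' ^ k) m" for k
    using agree_power[OF assms, of k] by (simp add: agree_def)
  then show "fps_nth (b oo F) m = fps_nth (b oo F') m"
    by (simp add: fps_compose_nth)
qed

lemma agree_insertion_product:
  assumes "\<And>j. j \<in> I \<Longrightarrow> agree n (G j) (G' j)"
  shows "agree n (insertion_product I \<mu> Ep G) (insertion_product I \<mu> Ep G')"
  unfolding insertion_product_def fps_cpow_def
  by (intro agree_prod agree_compose) (use assms in \<open>simp add: agree_def fps_map_def\<close>)

subsection \<open>Evaluation at 1 of series in an auxiliary variable\<close>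

text \<open>The outer series is in an auxiliary variable y. If the coefficient of y^k is divisible
  by x^k, then only k \<le> n contributes to x^n at y = 1, so that \<open>eval_one\<close> is the
  honest evaluation.\<close>

definition graded :: "'a::comm_ring_1 fps fps \<Rightarrow> bool" where
  "graded F \<longleftrightarrow> (\<forall>k. \<forall>i<k. fps_nth (fps_nth F k) i = 0)"

definition eval_one :: "'a::comm_ring_1 fps fps \<Rightarrow> 'a fps" where
  "eval_one F = Abs_fps (\<lambda>n. \<Sum>k\<le>n. fps_nth (fps_nth F k) n)"

lemma graded_mult_nth:
  assumes "graded F" "graded G" "i < k + l"
  shows "fps_nth (fps_nth F k * fps_nth G l) i = 0"
  unfolding fps_mult_nth
proof (intro sum.neutral ballI)
  fix j assume "j \<in> {0..i}"
  then have "j < k \<or> i - j < l" using assms(3) by auto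
  then show "fps_nth (fps_nth F k) j * fps_nth (fps_nth G l) (i - j) = 0"
    using assms(1,2) by (auto simp: graded_def)
qed

lemma graded_mult: "graded F \<Longrightarrow> graded G \<Longrightarrow> graded (F * G)"
  unfolding graded_def[of "F * G"] fps_mult_nth[of F] fps_sum_nth
  by (intro allI impI sum.neutral ballI graded_mult_nth) auto

lemma graded_1: "graded 1"
  by (simp add: graded_def)

lemma eval_one_1: "eval_one 1 = 1"
  by (rule fps_ext) (simp add: eval_one_def if_distrib[of "\<lambda>f. fps_nth f _"] cong: if_cong)

text \<open>Gradedness allows both truncated sums to be extended to all indices up to n, and the
  double sum to be cut down to k + l \<le> n afterwards; there it is compared with the Cauchy
  product along the diagonals.\<close>

lemma eval_one_mult:
  assumes "graded F" "graded G"
  shows "eval_one (F * G) = eval_one F * eval_one G"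
proof (rule fps_ext)
  fix n
  let ?c = "\<lambda>k l. fps_nth (fps_nth F k * fps_nth G l) n"
  have "fps_nth (eval_one F * eval_one G) n =
      (\<Sum>i=0..n. (\<Sum>k\<le>n. fps_nth (fps_nth F k) i) * (\<Sum>l\<le>n. fps_nth (fps_nth G l) (n - i)))"
    unfolding fps_mult_nth eval_one_def
  proof (intro sum.cong refl)
    fix i assume "i \<in> {0..n}"
    then have "(\<Sum>k\<le>i. fps_nth (fps_nth F k) i) = (\<Sum>k\<le>n. fps_nth (fps_nth F k) i)"
      "(\<Sum>l\<le>n - i. fps_nth (fps_nth G l) (n - i)) = (\<Sum>l\<le>n. fps_nth (fps_nth G l) (n - i))"
      using assms by (intro sum.mono_neutral_left; auto simp: graded_def)+
    then show "fps_nth (Abs_fps (\<lambda>n. \<Sum>k\<le>n. fps_nth (fps_nth F k) n)) i *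
        fps_nth (Abs_fps (\<lambda>n. \<Sum>k\<le>n. fps_nth (fps_nth G k) n)) (n - i) =
        (\<Sum>k\<le>n. fps_nth (fps_nth F k) i) * (\<Sum>l\<le>n. fps_nth (fps_nth G l) (n - i))"
      by simp
  qed
  also have "\<dots> = (\<Sum>i=0..n. \<Sum>k\<le>n. \<Sum>l\<le>n. fps_nth (fps_nth F k) i * fps_nth (fps_nth G l) (n - i))"
    by (simp add: sum_product)
  also have "\<dots> = (\<Sum>k\<le>n. \<Sum>l\<le>n. \<Sum>i=0..n. fps_nth (fps_nth F k) i * fps_nth (fps_nth G l) (n - i))"
    by (rule trans[OF sum.swap], rule sum.cong[OF refl], rule sum.swap)
  also have "\<dots> = (\<Sum>(k, l)\<in>{..n} \<times> {..n}. ?c k l)"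
    unfolding sum.cartesian_product[symmetric] fps_mult_nth by simp
  also have "\<dots> = (\<Sum>(k, l)\<in>{(k, l). k + l \<le> n}. ?c k l)"
  proof (rule sum.mono_neutral_right)
    show "\<forall>p\<in>{..n} \<times> {..n} - {(k, l). k + l \<le> n}. (case p of (k, l) \<Rightarrow> ?c k l) = 0"
      by (auto intro!: graded_mult_nth[OF assms])
  qed auto
  also have "{(k, l). k + l \<le> n} = (\<lambda>(m, k). (k, m - k)) ` (SIGMA m:{..n}. {0..m})"
    by (auto simp: image_iff) (metis add_diff_cancel_left' atMost_iff le_add1)
  also have "(\<Sum>(k, l)\<in>(\<lambda>(m, k). (k, m - k)) ` (SIGMA m:{..n}. {0..m}). ?c k l) =
      (\<Sum>(m, k)\<in>(SIGMA m:{..n}. {0..m}). ?c k (m - k))"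
    by (subst sum.reindex) (auto simp: inj_on_def intro!: sum.cong)
  also have "\<dots> = fps_nth (eval_one (F * G)) n"
    by (simp add: eval_one_def fps_mult_nth[of F] fps_sum_nth sum.Sigma)
  finally show "fps_nth (eval_one (F * G)) n = fps_nth (eval_one F * eval_one G) n" ..
qed

lemma graded_prod: "(\<And>x. x \<in> A \<Longrightarrow> graded (F x)) \<Longrightarrow> graded (prod F A)"
  by (induction A rule: infinite_finite_induct) (auto intro: graded_mult graded_1)

lemma eval_one_prod:
  "(\<And>x. x \<in> A \<Longrightarrow> graded (F x)) \<Longrightarrow> eval_one (prod F A) = (\<Prod>x\<in>A. eval_one (F x))"
  by (induction A rule: infinite_finite_induct) (auto simp: eval_one_mult graded_prod eval_one_1)

subsection \<open>Products of binomial series as sums over lists\<close>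

abbreviation const :: "'k \<Rightarrow> ('e, 'k::field_char_0) mpoly fps" where
  "const c \<equiv> fps_const (mconst c)"

lemma const_mult: "const (c * d) = const c * const d"
  by (simp add: mconst_mult)

lemma const_of_nat: "const (of_nat n) = of_nat n"
  by (simp add: mconst_of_nat fps_of_nat)

text \<open>The series (1 + y S)^c in the auxiliary variable y. At y = 1 it becomes the binomial
  series in \<open>fps_cpow\<close>, with \<open>S = F - 1\<close>.\<close>

definition binom_fps :: "'k \<Rightarrow> ('e, 'k::field_char_0) mpoly fps \<Rightarrow> ('e, 'k) mpoly fps fps" where
  "binom_fps c S = Abs_fps (\<lambda>k. const (c gchoose k) * S ^ k)"

lemma binom_fps_0: "fps_nth (binom_fps c S) 0 = 1"
  by (simp add: binom_fps_def mconst_1)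

lemma deriv_binom_fps: "fps_deriv (binom_fps c S) = fps_const (const c * S) * binom_fps (c - 1) S"
proof (rule fps_ext)
  fix k
  have "fps_nth (fps_deriv (binom_fps c S)) k = const (of_nat (Suc k) * (c gchoose Suc k)) * S ^ Suc k"
    by (simp only: fps_deriv_nth binom_fps_def fps_nth_Abs_fps const_mult const_of_nat Suc_eq_plus1 mult.assoc)
  also have "\<dots> = const c * S * (const ((c - 1) gchoose k) * S ^ k)"
    unfolding gbinomial_absorption const_mult power_Suc by (simp only: mult_ac)
  finally show "fps_nth (fps_deriv (binom_fps c S)) k =
      fps_nth (fps_const (const c * S) * binom_fps (c - 1) S) k"
    by (simp add: binom_fps_def)
qed

lemma graded_binom_fps: "fps_nth S 0 = 0 \<Longrightarrow> graded (binom_fps c S)"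
proof -
  assume S: "fps_nth S 0 = 0"
  have "fps_nth (S ^ k) i = 0" if "i < k" for i k
    using startsby_zero_power_prefix[OF S] that by blast
  then show ?thesis by (simp add: graded_def binom_fps_def)
qed

lemma eval_one_binom_fps: "eval_one (binom_fps c S) = fps_map mconst (fps_binomial c) oo S"
  by (rule fps_ext) (simp add: eval_one_def binom_fps_def fps_compose_nth fps_map_def atLeast0AtMost)

lemma prod_fps_nth_0:
  fixes F :: "'x \<Rightarrow> 'a::comm_ring_1 fps"
  shows "fps_nth (prod F A) 0 = (\<Prod>x\<in>A. fps_nth (F x) 0)"
  by (induction A rule: infinite_finite_induct) simp_all

lemma fps_deriv_prod:
  fixes F :: "'x \<Rightarrow> 'a::comm_ring_1 fps"
  shows "finite A \<Longrightarrow> fps_deriv (prod F A) = (\<Sum>x\<in>A. fps_deriv (F x) * prod F (A - {x}))"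
proof (induction A rule: finite_induct)
  case (insert y A)
  have "(\<Sum>x\<in>A. fps_deriv (F x) * prod F (insert y A - {x})) = F y * (\<Sum>x\<in>A. fps_deriv (F x) * prod F (A - {x}))"
    unfolding sum_distrib_left
  proof (intro sum.cong refl)
    fix x assume "x \<in> A"
    then have "insert y A - {x} = insert y (A - {x})" using insert by auto
    then show "fps_deriv (F x) * prod F (insert y A - {x}) = F y * (fps_deriv (F x) * prod F (A - {x}))"
      using insert by (simp add: mult_ac)
  qed
  then show ?case
    using insert by (simp add: algebra_simps)
qed simp

lemma ffact_Suc: "ffact c (Suc k) = c * ffact (c - 1) k"
  unfolding ffact_def by (simp add: prod.lessThan_Suc_shift diff_diff_eq del: prod.lessThan_Suc)

lemma ffact_0: "ffact c 0 = 1"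
  by (simp add: ffact_def)

text \<open>Later the colour of a child is its edge decoration paired with the index of the part
  containing its own decoration. The length m of the lists corresponds to y^m, up to the factor
  m!.\<close>

definition color_sum ::
    "'q set \<Rightarrow> 'a set \<Rightarrow> ('a \<Rightarrow> 'q) \<Rightarrow> ('a \<Rightarrow> ('e, 'k) mpoly fps) \<Rightarrow> ('q \<Rightarrow> 'k) \<Rightarrow> nat \<Rightarrow> ('e, 'k::field_char_0) mpoly fps" where
  "color_sum Q A col s \<mu> m = (\<Sum>cs | set cs \<subseteq> A \<and> length cs = m.
     const (\<Prod>q\<in>Q. ffact (\<mu> q) (length (filter (\<lambda>c. col c = q) cs))) * (\<Prod>c\<leftarrow>cs. s c))"

text \<open>By \<open>ffact_Suc\<close>, a first entry of colour \<open>q\<close> contributes the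
  factor \<open>\<mu> q\<close> and lowers that exponent by one for the rest of the list.\<close>

lemma color_sum_Suc:
  assumes "finite Q" "finite A" "\<And>c. c \<in> A \<Longrightarrow> col c \<in> Q"
  shows "color_sum Q A col s \<mu> (Suc m) =
    (\<Sum>q\<in>Q. const (\<mu> q) * (\<Sum>c | c \<in> A \<and> col c = q. s c) * color_sum Q A col s (\<mu>(q := \<mu> q - 1)) m)"
proof -
  let ?L = "{cs. set cs \<subseteq> A \<and> length cs = m}"
  let ?f = "\<lambda>\<mu> cs. \<Prod>q\<in>Q. ffact (\<mu> q) (length (filter (\<lambda>c. col c = q) cs))"
  have fin: "finite ?L" by (rule finite_lists_length_eq[OF assms(2)])
  have step: "?f \<mu> (c # cs) = \<mu> (col c) * ?f (\<mu>(col c := \<mu> (col c) - 1)) cs" if "c \<in> A" for c cs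
  proof -
    let ?q = "col c"
    have q: "?q \<in> Q" using assms(3) that .
    have "(\<Prod>q\<in>Q - {?q}. ffact (\<mu> q) (length (filter (\<lambda>c. col c = q) (c # cs)))) =
        (\<Prod>q\<in>Q - {?q}. ffact ((\<mu>(?q := \<mu> ?q - 1)) q) (length (filter (\<lambda>c. col c = q) cs)))"
      by (intro prod.cong) auto
    then show ?thesis
      unfolding prod.remove[OF assms(1) q] by (simp add: ffact_Suc mult.assoc)
  qed
  have "color_sum Q A col s \<mu> (Suc m) = (\<Sum>(cs, c)\<in>?L \<times> A. const (?f \<mu> (c # cs)) * (s c * (\<Prod>c\<leftarrow>cs. s c)))"
    unfolding color_sum_def lists_length_Suc_eq
    by (subst sum.reindex) (auto simp: inj_on_def intro!: sum.cong)
  also have "\<dots> = (\<Sum>c\<in>A. \<Sum>cs\<in>?L. const (?f \<mu> (c # cs)) * (s c * (\<Prod>c\<leftarrow>cs. s c)))"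
    unfolding sum.cartesian_product[symmetric] by (rule sum.swap)
  also have "\<dots> = (\<Sum>c\<in>A. const (\<mu> (col c)) * s c * color_sum Q A col s (\<mu>(col c := \<mu> (col c) - 1)) m)"
    unfolding color_sum_def sum_distrib_left
    by (intro sum.cong refl) (simp only: step const_mult mult_ac)
  also have "\<dots> = (\<Sum>q\<in>Q. \<Sum>c | c \<in> A \<and> col c = q.
      const (\<mu> (col c)) * s c * color_sum Q A col s (\<mu>(col c := \<mu> (col c) - 1)) m)"
    using assms by (intro sum.group[symmetric]) auto
  also have "\<dots> = (\<Sum>q\<in>Q. const (\<mu> q) * (\<Sum>c | c \<in> A \<and> col c = q. s c) * color_sum Q A col s (\<mu>(q := \<mu> q - 1)) m)"
    by (intro sum.cong refl) (simp add: sum_distrib_left sum_distrib_right)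
  finally show ?thesis .
qed

text \<open>Both sides satisfy the recursion obtained by differentiating in the auxiliary variable,
  respectively by splitting off the first entry of the list.\<close>

lemma prod_binom_fps_nth:
  fixes s :: "'a \<Rightarrow> ('e, 'k::field_char_0) mpoly fps"
  assumes Q: "finite Q" and A: "finite A" and col: "\<And>c. c \<in> A \<Longrightarrow> col c \<in> Q"
  defines "S \<equiv> \<lambda>q. \<Sum>c | c \<in> A \<and> col c = q. s c"
  shows "of_nat (fact m) * fps_nth (\<Prod>q\<in>Q. binom_fps (\<mu> q) (S q)) m = color_sum Q A col s \<mu> m"
proof (induction m arbitrary: \<mu>)
  case 0
  have "fps_nth (\<Prod>q\<in>Q. binom_fps (\<mu> q) (S q)) 0 = 1"
    by (simp add: prod_fps_nth_0 binom_fps_0)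
  moreover have "{cs. set cs \<subseteq> A \<and> length cs = 0} = {[]}"
    by auto
  ultimately show ?case
    by (simp add: color_sum_def ffact_0 mconst_1)
next
  case (Suc m)
  let ?B = "\<lambda>\<mu>. \<Prod>q\<in>Q. binom_fps (\<mu> q) (S q)"
  have upd: "binom_fps (\<mu> q - 1) (S q) * (\<Prod>q'\<in>Q - {q}. binom_fps (\<mu> q') (S q')) = ?B (\<mu>(q := \<mu> q - 1))"
    if "q \<in> Q" for q
    using prod.remove[OF Q that, of "\<lambda>q'. binom_fps ((\<mu>(q := \<mu> q - 1)) q') (S q')"] by simp
  have "of_nat (Suc m) * fps_nth (?B \<mu>) (Suc m) = fps_nth (fps_deriv (?B \<mu>)) m"
    by simp
  also have "fps_deriv (?B \<mu>) = (\<Sum>q\<in>Q. fps_const (const (\<mu> q) * S q) * ?B (\<mu>(q := \<mu> q - 1)))"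
    unfolding fps_deriv_prod[OF Q] deriv_binom_fps
    by (intro sum.cong refl) (simp only: mult.assoc upd)
  finally have "of_nat (Suc m) * fps_nth (?B \<mu>) (Suc m) =
      (\<Sum>q\<in>Q. const (\<mu> q) * S q * fps_nth (?B (\<mu>(q := \<mu> q - 1))) m)"
    by (simp add: fps_sum_nth)
  then have "of_nat (fact (Suc m)) * fps_nth (\<Prod>q\<in>Q. binom_fps (\<mu> q) (S q)) (Suc m) =
      (\<Sum>q\<in>Q. const (\<mu> q) * S q * (of_nat (fact m) * fps_nth (?B (\<mu>(q := \<mu> q - 1))) m))"
    by (simp only: fact_Suc of_nat_mult of_nat_id mult.assoc mult.left_commute[of _ "of_nat (fact m)"]
        sum_distrib_left[symmetric])
  also have "\<dots> = (\<Sum>q\<in>Q. const (\<mu> q) * S q * color_sum Q A col s (\<mu>(q := \<mu> q - 1)) m)"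
    by (simp only: Suc.IH)
  also have "\<dots> = color_sum Q A col s \<mu> (Suc m)"
    unfolding S_def by (rule color_sum_Suc[OF Q A col, symmetric])
  finally show ?case .
qed

text \<open>Setting y = 1 adds up \<open>prod_binom_fps_nth\<close> over all lengths. Each
  \<open>s c\<close> is divisible by x, so lists longer than n do not reach x^n.\<close>

lemma prod_binom_series_nth:
  fixes s :: "'a \<Rightarrow> ('e, 'k::field_char_0) mpoly fps"
  assumes Q: "finite Q" and A: "finite A" and col: "\<And>c. c \<in> A \<Longrightarrow> col c \<in> Q"
    and s: "\<And>c. c \<in> A \<Longrightarrow> fps_nth (s c) 0 = 0"
  defines "S \<equiv> \<lambda>q. \<Sum>c | c \<in> A \<and> col c = q. s c"
  shows "fps_nth (\<Prod>q\<in>Q. fps_map mconst (fps_binomial (\<mu> q)) oo S q) n =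
    (\<Sum>cs | set cs \<subseteq> A \<and> length cs \<le> n.
      mconst ((\<Prod>q\<in>Q. ffact (\<mu> q) (length (filter (\<lambda>c. col c = q) cs))) / fact (length cs)) *
      fps_nth (\<Prod>c\<leftarrow>cs. s c) n)"
proof -
  let ?f = "\<lambda>cs. mconst ((\<Prod>q\<in>Q. ffact (\<mu> q) (length (filter (\<lambda>c. col c = q) cs))) / fact (length cs)) *
      fps_nth (\<Prod>c\<leftarrow>cs. s c) n"
  have S0: "fps_nth (S q) 0 = 0" for q
    unfolding S_def fps_sum_nth using s by (intro sum.neutral) auto
  have B: "fps_nth (\<Prod>q\<in>Q. binom_fps (\<mu> q) (S q)) m = const (1 / fact m) * color_sum Q A col s \<mu> m" for m
  proof -
    have "const (1 / fact m) * (of_nat (fact m) * fps_nth (\<Prod>q\<in>Q. binom_fps (\<mu> q) (S q)) m) =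
        const (1 / fact m) * color_sum Q A col s \<mu> m"
      by (simp only: S_def prod_binom_fps_nth[OF Q A col])
    moreover have "const (1 / fact m) * of_nat (fact m) = (1 :: ('e, 'k) mpoly fps)"
      unfolding const_of_nat[symmetric] const_mult[symmetric] by (simp add: mconst_1)
    ultimately show ?thesis by (simp add: mult.assoc[symmetric])
  qed
  have "(\<Prod>q\<in>Q. fps_map mconst (fps_binomial (\<mu> q)) oo S q) = eval_one (\<Prod>q\<in>Q. binom_fps (\<mu> q) (S q))"
    using graded_binom_fps[OF S0] by (simp add: eval_one_prod eval_one_binom_fps)
  then have "fps_nth (\<Prod>q\<in>Q. fps_map mconst (fps_binomial (\<mu> q)) oo S q) n =
      (\<Sum>m\<le>n. fps_nth (const (1 / fact m) * color_sum Q A col s \<mu> m) n)"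
    by (simp add: eval_one_def B)
  also have "\<dots> = (\<Sum>m\<le>n. \<Sum>cs | set cs \<subseteq> A \<and> length cs = m.
      ?f cs)"
    unfolding color_sum_def sum_distrib_left fps_sum_nth
    by (intro sum.cong refl) (auto simp: mult.assoc[symmetric] mconst_mult[symmetric])
  also have "\<dots> = (\<Sum>cs\<in>(\<Union>m\<le>n. {cs. set cs \<subseteq> A \<and> length cs = m}).
      ?f cs)"
    using finite_lists_length_eq[OF A] by (intro sum.UNION_disjoint[symmetric]) auto
  also have "(\<Union>m\<le>n. {cs. set cs \<subseteq> A \<and> length cs = m}) = {cs. set cs \<subseteq> A \<and> length cs \<le> n}"
    by auto
  finally show ?thesis .
qed

subsection \<open>The Dyson--Schwinger system\<close>

locale dyson_schwinger =
  fixes I :: "'i set" and P :: "'i \<Rightarrow> 'p set" and w :: "'p \<Rightarrow> nat" and E :: "'p \<Rightarrow> 'e set"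
    and \<mu> :: "'e \<Rightarrow> 'i \<Rightarrow> 'k::field_char_0" and \<Lambda> :: "'p \<Rightarrow> ('e, 'k) mpoly \<Rightarrow> 'k poly" and PP :: "'p set"
  assumes PP: "PP = (\<Union>i\<in>I. P i)"
    and finite_I: "finite I"
    and disjoint: "disjoint_family_on P I"
    and weight_pos: "\<And>p. p \<in> PP \<Longrightarrow> w p \<ge> 1"
    and finite_weight: "\<And>n. finite {p \<in> PP. w p = n}"
    and finite_E: "\<And>p. p \<in> PP \<Longrightarrow> finite (E p)"
    and cocycles: "\<And>p. p \<in> PP \<Longrightarrow> one_cocycle (E p) (\<Lambda> p)"
begin

abbreviation tree_ok :: "(unit, 'p, 'e) ptree \<Rightarrow> bool" where
  "tree_ok T \<equiv> valid PP E T"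

definition child_lists :: "'p \<Rightarrow> nat \<Rightarrow> ('e \<times> (unit, 'p, 'e) ptree) list set" where
  "child_lists p n = {cs. (\<forall>x\<in>set cs. fst x \<in> E p \<and> tree_ok (snd x)) \<and> (\<Sum>x\<leftarrow>cs. pweight w (snd x)) = n}"

text \<open>The claimed solution in its planar form; the system is solved with it before isomorphism
  classes reappear.\<close>

definition tree_series :: "'i \<Rightarrow> 'k poly fps" where
  "tree_series i = Abs_fps (\<lambda>n. (if n = 0 then 1 else 0) +
     (\<Sum>T | tree_ok T \<and> deco T \<in> P i \<and> pweight w T = n. smult (pfactor I P E \<mu> T) (ppoly \<Lambda> T)))"

text \<open>The right-hand side of the system without its constant 1. Each coefficient is a finite
  sum, as only \<open>p\<close> with \<open>w p \<le> n\<close> reach x^n.\<close>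

definition rhs_series :: "('i \<Rightarrow> 'k poly fps) \<Rightarrow> 'i \<Rightarrow> 'k poly fps" where
  "rhs_series G i = Abs_fps (\<lambda>n. \<Sum>p | p \<in> P i \<and> w p \<le> n.
     \<Lambda> p (fps_nth (insertion_product I \<mu> (E p) G) (n - w p)))"

lemma P_PP: "i \<in> I \<Longrightarrow> P i \<subseteq> PP"
  using PP by blast

lemma finite_weight_le: "finite {p \<in> PP. w p \<le> n}"
proof -
  have "{p \<in> PP. w p \<le> n} = (\<Union>m\<le>n. {p \<in> PP. w p = m})" by auto
  then show ?thesis using finite_weight by simp
qed

lemma finite_P_weight_le: "i \<in> I \<Longrightarrow> finite {p. p \<in> P i \<and> w p \<le> n}"
  by (rule finite_subset[OF _ finite_weight_le[of n]]) (use P_PP in blast)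

lemma pweight_pos: "tree_ok T \<Longrightarrow> pweight w T \<ge> 1"
  using weight_pos by (cases T) (auto intro: trans_le_add1)

lemma length_le_sum_pweight:
  "(\<And>x. x \<in> set cs \<Longrightarrow> tree_ok (snd x)) \<Longrightarrow> length cs \<le> (\<Sum>x\<leftarrow>cs. pweight w (snd x))"
proof (induction cs)
  case (Cons x cs)
  then have "length cs \<le> (\<Sum>x\<leftarrow>cs. pweight w (snd x))" "pweight w (snd x) \<ge> 1"
    using pweight_pos[of "snd x"] by simp_all
  then show ?case by simp
qed simp

lemma pweight_le_sum: "x \<in> set cs \<Longrightarrow> pweight w (snd x) \<le> (\<Sum>x\<leftarrow>cs. pweight w (snd x))"
  by (rule member_le_sum_list) auto

text \<open>Weights are at least 1. Hence the subtrees at the root of a tree of weight at most n + 1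
  have total weight at most n, which bounds their number and their individual weights.\<close>

lemma finite_trees: "finite {T. tree_ok T \<and> pweight w T \<le> n}"
proof (induction n)
  case 0
  have "{T. tree_ok T \<and> pweight w T \<le> 0} = {}"
    using pweight_pos by fastforce
  then show ?case by (simp only: finite.emptyI)
next
  case (Suc n)
  let ?V = "{T. tree_ok T \<and> pweight w T \<le> n}"
  let ?L = "\<lambda>p. {cs. set cs \<subseteq> E p \<times> ?V \<and> length cs \<le> n}"
  have "{T. tree_ok T \<and> pweight w T \<le> Suc n} \<subseteq> (\<Union>p\<in>{p \<in> PP. w p \<le> Suc n}. Node () p ` ?L p)"
  proof
    fix T assume T: "T \<in> {T. tree_ok T \<and> pweight w T \<le> Suc n}"
    obtain p cs where T': "T = Node () p cs" by (cases T) auto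
    have p: "p \<in> PP" and cs: "\<And>x. x \<in> set cs \<Longrightarrow> fst x \<in> E p \<and> tree_ok (snd x)"
      and wt: "w p + (\<Sum>x\<leftarrow>cs. pweight w (snd x)) \<le> Suc n"
      using T by (auto simp: T')
    have sum: "(\<Sum>x\<leftarrow>cs. pweight w (snd x)) \<le> n" using wt weight_pos[OF p] by linarith
    have "set cs \<subseteq> E p \<times> ?V"
    proof
      fix x assume x: "x \<in> set cs"
      then have "pweight w (snd x) \<le> n" using pweight_le_sum sum order.trans by blast
      then show "x \<in> E p \<times> ?V" using cs[OF x] by (cases x) auto
    qed
    moreover have "length cs \<le> n" using length_le_sum_pweight[of cs] cs sum by fastforce
    moreover have "w p \<le> Suc n" using wt by linarith
    ultimately show "T \<in> (\<Union>p\<in>{p \<in> PP. w p \<le> Suc n}. Node () p ` ?L p)"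
      using p T' by blast
  qed
  moreover have "finite (\<Union>p\<in>{p \<in> PP. w p \<le> Suc n}. Node () p ` ?L p)"
    using finite_weight_le[of "Suc n"] finite_E Suc
    by (intro finite_UN_I finite_imageI finite_lists_length_le finite_cartesian_product) auto
  ultimately show ?case by (rule finite_subset)
qed

lemma child_lists_subset:
  "child_lists p n \<subseteq> {cs. set cs \<subseteq> E p \<times> {T. tree_ok T \<and> pweight w T \<le> n} \<and> length cs \<le> n}"
proof
  fix cs assume "cs \<in> child_lists p n"
  then have cs: "\<And>x. x \<in> set cs \<Longrightarrow> fst x \<in> E p \<and> tree_ok (snd x)" and n: "(\<Sum>x\<leftarrow>cs. pweight w (snd x)) = n"
    by (auto simp: child_lists_def)
  have "x \<in> E p \<times> {T. tree_ok T \<and> pweight w T \<le> n}" if "x \<in> set cs" for x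
    using cs[OF that] pweight_le_sum[OF that] n by (cases x) auto
  moreover have "length cs \<le> n" using length_le_sum_pweight[of cs] cs n by fastforce
  ultimately show "cs \<in> {cs. set cs \<subseteq> E p \<times> {T. tree_ok T \<and> pweight w T \<le> n} \<and> length cs \<le> n}"
    by blast
qed

lemma finite_child_lists: "p \<in> PP \<Longrightarrow> finite (child_lists p n)"
  by (rule finite_subset[OF child_lists_subset])
    (intro finite_lists_length_le finite_cartesian_product finite_E finite_trees)

text \<open>The parts are disjoint, so this makes the colour a function of the child.\<close>

definition index :: "'p \<Rightarrow> 'i" where
  "index p = (THE j. j \<in> I \<and> p \<in> P j)"

lemma index_unique: "p \<in> PP \<Longrightarrow> j \<in> I \<Longrightarrow> index p = j \<longleftrightarrow> p \<in> P j"
  and index_I: "p \<in> PP \<Longrightarrow> index p \<in> I"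
proof -
  assume p: "p \<in> PP"
  then obtain i where i: "i \<in> I" "p \<in> P i" using PP by blast
  have uniq: "j = i" if "j \<in> I" "p \<in> P j" for j
    using disjoint i that by (auto simp: disjoint_family_on_def)
  have "index p = i"
    unfolding index_def by (rule the_equality) (use i in blast, use uniq in blast)
  then show "index p \<in> I" "j \<in> I \<Longrightarrow> index p = j \<longleftrightarrow> p \<in> P j"
    using i uniq by blast+
qed

lemma valid_deco: "tree_ok T \<Longrightarrow> deco T \<in> PP"
  by (cases T) simp

definition child_series :: "'e \<times> (unit, 'p, 'e) ptree \<Rightarrow> ('e, 'k) mpoly fps" where
  "child_series c = fps_const (mconst (pfactor I P E \<mu> (snd c)) * subst_var (fst c) (ppoly \<Lambda> (snd c))) *
     fps_X ^ pweight w (snd c)"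

lemma child_series_nth:
  "fps_nth (child_series c) m = (if m = pweight w (snd c)
    then mconst (pfactor I P E \<mu> (snd c)) * subst_var (fst c) (ppoly \<Lambda> (snd c)) else 0)"
  unfolding child_series_def fps_mult_left_const_nth fps_X_power_nth by simp

lemma prod_child_series_nth:
  "fps_nth (\<Prod>c\<leftarrow>cs. child_series c) n = (if n = (\<Sum>c\<leftarrow>cs. pweight w (snd c))
    then mconst (\<Prod>c\<leftarrow>cs. pfactor I P E \<mu> (snd c)) * (\<Prod>c\<leftarrow>cs. subst_var (fst c) (ppoly \<Lambda> (snd c))) else 0)"
proof -
  have "(\<Prod>c\<leftarrow>cs. child_series c) =
      fps_const (mconst (\<Prod>c\<leftarrow>cs. pfactor I P E \<mu> (snd c)) * (\<Prod>c\<leftarrow>cs. subst_var (fst c) (ppoly \<Lambda> (snd c)))) *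
      fps_X ^ (\<Sum>c\<leftarrow>cs. pweight w (snd c))"
    by (induction cs)
      (simp_all add: child_series_def mconst_1 mconst_mult power_add mult_ac flip: fps_const_mult)
  then show ?thesis
    by (simp add: fps_X_power_nth)
qed

text \<open>The trees counted by the j-th series, attached along \<open>e\<close>, are the children
  of colour \<open>(e, j)\<close>. Truncation to weight at most n leaves the finite set
  \<open>V\<close> on which the sums over lists are defined.\<close>

lemma subst_var_tree_series_agree:
  fixes n :: nat
  assumes j: "j \<in> I" and e: "e \<in> E p"
  defines "V \<equiv> {T. tree_ok T \<and> pweight w T \<le> n}"
  shows "agree n (fps_map (subst_var e) (tree_series j) - 1)
    (\<Sum>c | c \<in> E p \<times> V \<and> (fst c, index (deco (snd c))) = (e, j). child_series c)"
  unfolding agree_def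
proof (intro allI impI)
  fix m assume m: "m \<le> n"
  have fin: "finite V" unfolding V_def by (rule finite_trees)
  have set: "{c. c \<in> E p \<times> V \<and> (fst c, index (deco (snd c))) = (e, j)} =
      Pair e ` {T \<in> V. deco T \<in> P j}"
  proof -
    have *: "{T \<in> V. deco T \<in> P j} = {T \<in> V. index (deco T) = j}"
      using index_unique[OF valid_deco j] by (intro Collect_cong) (auto simp: V_def)
    show ?thesis unfolding * using e by auto
  qed
  have "fps_nth (\<Sum>c | c \<in> E p \<times> V \<and> (fst c, index (deco (snd c))) = (e, j). child_series c) m =
      (\<Sum>T | T \<in> V \<and> deco T \<in> P j. if m = pweight w T then
        mconst (pfactor I P E \<mu> T) * subst_var e (ppoly \<Lambda> T) else 0)"
    unfolding set fps_sum_nth by (subst sum.reindex) (auto simp: inj_on_def child_series_nth intro!: sum.cong)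
  also have "\<dots> = (\<Sum>T | tree_ok T \<and> deco T \<in> P j \<and> pweight w T = m.
      mconst (pfactor I P E \<mu> T) * subst_var e (ppoly \<Lambda> T))"
    using m by (intro sum.mono_neutral_cong_right)
      (auto simp: V_def intro: finite_subset[OF _ finite_trees[of n]])
  also have "\<dots> = fps_nth (fps_map (subst_var e) (tree_series j) - 1) m"
    by (simp add: fps_map_def tree_series_def subst_var_add subst_var_sum subst_var_smult subst_var_1 subst_var_0)
  finally show "fps_nth (fps_map (subst_var e) (tree_series j) - 1) m =
      fps_nth (\<Sum>c | c \<in> E p \<times> V \<and> (fst c, index (deco (snd c))) = (e, j). child_series c) m" ..
qed

text \<open>The product over \<open>e\<close> and \<open>j\<close> is one over colours, to which
  \<open>prod_binom_series_nth\<close> applies after truncation. Falling factorials and the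
  factorial of the length form the root's share of \<open>pfactor\<close>; the rest is contributed
  by the children.\<close>

lemma insertion_product_tree_series:
  assumes p: "p \<in> PP"
  shows "fps_nth (insertion_product I \<mu> (E p) tree_series) n = (\<Sum>cs\<in>child_lists p n.
    mconst (pfactor I P E \<mu> (Node () p cs)) * (\<Prod>c\<leftarrow>cs. subst_var (fst c) (ppoly \<Lambda> (snd c))))"
proof -
  define V where "V = {T. tree_ok T \<and> pweight w T \<le> n}"
  let ?A = "E p \<times> V" and ?Q = "E p \<times> I"
  let ?col = "\<lambda>c. (fst c, index (deco (snd c)))"
  let ?S = "\<lambda>q. \<Sum>c | c \<in> ?A \<and> ?col c = q. child_series c"
  let ?\<mu> = "\<lambda>q. \<mu> (fst q) (snd q)"
  let ?f = "\<lambda>cs. \<Prod>q\<in>?Q. ffact (?\<mu> q) (length (filter (\<lambda>c. ?col c = q) cs))"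
    and ?g = "\<lambda>cs. \<Prod>c\<leftarrow>cs. subst_var (fst c) (ppoly \<Lambda> (snd c))"
    and ?h = "\<lambda>cs. \<Prod>c\<leftarrow>cs. pfactor I P E \<mu> (snd c)"
  have fin: "finite V" "finite (E p)" using finite_trees finite_E[OF p] by (simp_all add: V_def)
  have Q: "finite ?Q" and A: "finite ?A" using fin finite_I by auto
  have col: "?col c \<in> ?Q" if "c \<in> ?A" for c
    using that index_I[OF valid_deco] by (auto simp: V_def)
  have s0: "fps_nth (child_series c) 0 = 0" if "c \<in> ?A" for c
    using that pweight_pos[of "snd c"] by (auto simp: child_series_nth V_def)
  have "insertion_product I \<mu> (E p) tree_series =
      (\<Prod>q\<in>?Q. fps_map mconst (fps_binomial (?\<mu> q)) oo (fps_map (subst_var (fst q)) (tree_series (snd q)) - 1))"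
    by (simp add: insertion_product_def fps_cpow_def prod.cartesian_product case_prod_beta)
  also have "agree n \<dots> (\<Prod>q\<in>?Q. fps_map mconst (fps_binomial (?\<mu> q)) oo ?S q)"
  proof (intro agree_prod agree_compose)
    fix q assume "q \<in> ?Q"
    then show "agree n (fps_map (subst_var (fst q)) (tree_series (snd q)) - 1) (?S q)"
      using subst_var_tree_series_agree[of "snd q" "fst q" p n] by (simp add: V_def mem_Times_iff)
  qed
  finally have "fps_nth (insertion_product I \<mu> (E p) tree_series) n =
      fps_nth (\<Prod>q\<in>?Q. fps_map mconst (fps_binomial (?\<mu> q)) oo ?S q) n"
    by (simp add: agree_def)
  also have "\<dots> = (\<Sum>cs | set cs \<subseteq> ?A \<and> length cs \<le> n.
      mconst (?f cs / fact (length cs)) *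
      fps_nth (\<Prod>c\<leftarrow>cs. child_series c) n)"
    by (rule prod_binom_series_nth[OF Q A col s0])
  also have "\<dots> = (\<Sum>cs\<in>child_lists p n.
      mconst (?f cs / fact (length cs)) *
      (mconst (?h cs) * ?g cs))"
  proof (rule sum.mono_neutral_cong_right)
    show "finite {cs. set cs \<subseteq> ?A \<and> length cs \<le> n}" by (rule finite_lists_length_le[OF A])
    show "child_lists p n \<subseteq> {cs. set cs \<subseteq> ?A \<and> length cs \<le> n}"
      using child_lists_subset by (simp add: V_def)
    show "\<forall>cs\<in>{cs. set cs \<subseteq> ?A \<and> length cs \<le> n} - child_lists p n.
      mconst (?f cs / fact (length cs)) *
      fps_nth (\<Prod>c\<leftarrow>cs. child_series c) n = 0"
    proof
      fix cs assume cs: "cs \<in> {cs. set cs \<subseteq> ?A \<and> length cs \<le> n} - child_lists p n"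
      then have "\<forall>x\<in>set cs. fst x \<in> E p \<and> tree_ok (snd x)"
        by (auto simp: V_def subset_iff mem_Times_iff)
      then have "(\<Sum>x\<leftarrow>cs. pweight w (snd x)) \<noteq> n"
        using cs by (auto simp: child_lists_def)
      then show "mconst (?f cs / fact (length cs)) *
        fps_nth (\<Prod>c\<leftarrow>cs. child_series c) n = 0"
        by (simp add: prod_child_series_nth)
    qed
  qed (simp add: prod_child_series_nth child_lists_def)
  also have "\<dots> = (\<Sum>cs\<in>child_lists p n.
    mconst (pfactor I P E \<mu> (Node () p cs)) * ?g cs)"
  proof (rule sum.cong[OF refl])
    fix cs assume cs: "cs \<in> child_lists p n"
    have "filter (\<lambda>c. ?col c = (e, j)) cs = filter (\<lambda>x. deco (snd x) \<in> P j \<and> fst x = e) cs"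
      if "j \<in> I" for e j
      using cs index_unique[OF valid_deco that] by (intro filter_cong) (auto simp: child_lists_def)
    then have "?f cs = root_factor I P E \<mu> p cs"
      unfolding root_factor_def prod.cartesian_product by (intro prod.cong) auto
    then show "mconst (?f cs / fact (length cs)) *
      (mconst (?h cs) * ?g cs) =
      mconst (pfactor I P E \<mu> (Node () p cs)) * ?g cs"
      by (simp only: pfactor.simps mconst_mult mult.assoc)
  qed
  finally show ?thesis .
qed

text \<open>A 1-cocycle is linear on \<open>mpolys (E p)\<close>, so each summand has to be
  recognised as a polynomial in the variables of \<open>E p\<close>.\<close>

lemma cocycle_insertion_product:
  assumes p: "p \<in> PP"
  shows "\<Lambda> p (fps_nth (insertion_product I \<mu> (E p) tree_series) n) =
    (\<Sum>cs\<in>child_lists p n. smult (pfactor I P E \<mu> (Node () p cs)) (ppoly \<Lambda> (Node () p cs)))"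
proof -
  interpret cocycle "E p" "\<Lambda> p"
    using finite_E[OF p] cocycles[OF p] by unfold_locales
  have mem: "(\<Prod>c\<leftarrow>cs. subst_var (fst c) (ppoly \<Lambda> (snd c))) \<in> mpolys (E p)" if "cs \<in> child_lists p n" for cs
  proof -
    have "\<forall>c\<in>set cs. fst c \<in> E p" using that by (simp add: child_lists_def)
    then show ?thesis
      by (induction cs) (auto intro: mpolys_mult mpolys_1 mpolys_subst_var)
  qed
  show ?thesis
    unfolding insertion_product_tree_series[OF p]
    by (subst sum) (auto intro!: sum.cong scale mem mpolys_mult mpolys_mconst simp del: pfactor.simps)
qed

text \<open>A planar tree of weight n is a root decoration \<open>p\<close> with a list of children
  of total weight \<open>n - w p\<close>; this sorts the trees by the summands of the right-hand
  side.\<close>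

lemma rhs_tree_series:
  assumes i: "i \<in> I"
  shows "tree_series i = 1 + rhs_series tree_series i"
proof (rule fps_ext)
  fix n
  let ?f = "\<lambda>T. smult (pfactor I P E \<mu> T) (ppoly \<Lambda> T)"
  let ?B = "{p. p \<in> P i \<and> w p \<le> n}"
  have PB: "p \<in> PP" if "p \<in> ?B" for p using that P_PP[OF i] by blast
  have set: "{T. tree_ok T \<and> deco T \<in> P i \<and> pweight w T = n} =
      (\<Union>p\<in>?B. Node () p ` child_lists p (n - w p))"
  proof (intro equalityI subsetI)
    fix T assume T: "T \<in> {T. tree_ok T \<and> deco T \<in> P i \<and> pweight w T = n}"
    obtain p cs where T': "T = Node () p cs" by (cases T) auto
    have "p \<in> ?B" "cs \<in> child_lists p (n - w p)" using T by (auto simp: T' child_lists_def)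
    then show "T \<in> (\<Union>p\<in>?B. Node () p ` child_lists p (n - w p))" using T' by blast
  next
    fix T assume "T \<in> (\<Union>p\<in>?B. Node () p ` child_lists p (n - w p))"
    then obtain p cs where p: "p \<in> ?B" and cs: "cs \<in> child_lists p (n - w p)" and T: "T = Node () p cs" by blast
    show "T \<in> {T. tree_ok T \<and> deco T \<in> P i \<and> pweight w T = n}"
      using p cs PB[OF p] by (auto simp: T child_lists_def)
  qed
  have "(\<Sum>T | tree_ok T \<and> deco T \<in> P i \<and> pweight w T = n. ?f T) =
      (\<Sum>p\<in>?B. \<Sum>T\<in>Node () p ` child_lists p (n - w p). ?f T)"
    unfolding set using finite_P_weight_le[OF i] finite_child_lists PB
    by (intro sum.UNION_disjoint) auto
  also have "\<dots> = (\<Sum>p\<in>?B. \<Sum>cs\<in>child_lists p (n - w p). ?f (Node () p cs))"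
    by (intro sum.cong refl) (subst sum.reindex, auto simp: inj_on_def)
  also have "\<dots> = fps_nth (rhs_series tree_series i) n"
    unfolding rhs_series_def fps_nth_Abs_fps
    by (intro sum.cong refl cocycle_insertion_product[symmetric] PB)
  finally show "fps_nth (tree_series i) n = fps_nth (1 + rhs_series tree_series i) n"
    by (simp add: tree_series_def)
qed

section \<open>The system as a recursion on coefficients, and the return to isomorphism
  classes\<close>

lemma has_sum_rhs_series:
  assumes i: "i \<in> I"
  shows "((\<lambda>p. fps_X ^ w p * fps_map (\<Lambda> p) (insertion_product I \<mu> (E p) G)) has_sum rhs_series G i) (P i)"
proof (rule has_sum_fpsI[where N = "\<lambda>n. {p. p \<in> P i \<and> w p \<le> n}"])
  show "fps_nth (rhs_series G i) n = (\<Sum>p | p \<in> P i \<and> w p \<le> n.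
      fps_nth (fps_X ^ w p * fps_map (\<Lambda> p) (insertion_product I \<mu> (E p) G)) n)" for n
    unfolding rhs_series_def fps_nth_Abs_fps
    by (intro sum.cong refl) (simp add: fps_X_power_mult_nth fps_map_def)
qed (use finite_P_weight_le[OF i] in \<open>auto simp: fps_X_power_mult_nth\<close>)

lemma dse_solution_iff_rhs: "dse_solution I P w E \<mu> \<Lambda> G \<longleftrightarrow> (\<forall>i\<in>I. G i = 1 + rhs_series G i)"
  unfolding dse_solution_def using infsumI[OF has_sum_rhs_series, of _ G] by simp

lemma rhs_series_agree:
  assumes i: "i \<in> I" and agree: "\<And>j m. j \<in> I \<Longrightarrow> m < n \<Longrightarrow> fps_nth (G j) m = fps_nth (G' j) m"
  shows "fps_nth (rhs_series G i) n = fps_nth (rhs_series G' i) n"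
  unfolding rhs_series_def fps_nth_Abs_fps
proof (rule sum.cong[OF refl])
  fix p assume p: "p \<in> {p. p \<in> P i \<and> w p \<le> n}"
  then have "w p \<ge> 1" using weight_pos P_PP[OF i] by blast
  then have "agree (n - w p) (G j) (G' j)" if "j \<in> I" for j
    using agree[OF that] p by (auto simp: agree_def)
  then have "agree (n - w p) (insertion_product I \<mu> (E p) G) (insertion_product I \<mu> (E p) G')"
    by (rule agree_insertion_product)
  then show "\<Lambda> p (fps_nth (insertion_product I \<mu> (E p) G) (n - w p)) =
      \<Lambda> p (fps_nth (insertion_product I \<mu> (E p) G') (n - w p))"
    by (simp add: agree_def)
qed

lemma dse_solution_iff: "dse_solution I P w E \<mu> \<Lambda> G \<longleftrightarrow> (\<forall>i\<in>I. G i = tree_series i)"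
proof
  assume "dse_solution I P w E \<mu> \<Lambda> G"
  then have G: "G i = 1 + rhs_series G i" if "i \<in> I" for i
    using that by (simp add: dse_solution_iff_rhs)
  have "\<forall>i\<in>I. fps_nth (G i) n = fps_nth (tree_series i) n" for n
  proof (induction n rule: less_induct)
    case (less n)
    show ?case
    proof
      fix i assume i: "i \<in> I"
      have "fps_nth (rhs_series G i) n = fps_nth (rhs_series tree_series i) n"
        using less by (intro rhs_series_agree[OF i]) blast
      then show "fps_nth (G i) n = fps_nth (tree_series i) n"
        by (subst G[OF i], subst rhs_tree_series[OF i]) simp
    qed
  qed
  then show "\<forall>i\<in>I. G i = tree_series i"
    by (auto intro: fps_ext)
next
  assume G: "\<forall>i\<in>I. G i = tree_series i"
  then have "rhs_series G i = rhs_series tree_series i" if "i \<in> I" for i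
    using that by (intro fps_ext rhs_series_agree) auto
  then show "dse_solution I P w E \<mu> \<Lambda> G"
    unfolding dse_solution_iff_rhs using G rhs_tree_series by simp
qed

lemma pterm_nth: "fps_nth (pterm I P w E \<mu> \<Lambda> T) n =
  (if pweight w T = n then smult (pfactor I P E \<mu> T) (ppoly \<Lambda> T) else 0)"
  unfolding pterm_def fps_mult_left_const_nth fps_X_power_nth by simp

text \<open>Each class contributes the sum of \<open>pterm\<close> over its shapes, and the shape
  sets partition the valid planar trees with root decoration in \<open>P i\<close>.\<close>

lemma has_sum_tree_terms:
  assumes i: "i \<in> I"
  shows "((\<lambda>C. tree_term I P w E \<mu> (\<lambda>p. cocycle_coeffs (E p) (\<Lambda> p)) (SOME t. t \<in> C)) has_sum (tree_series i - 1))
    (tree_classes PP E (P i))"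
proof -
  let ?t = "\<lambda>C. tree_term I P w E \<mu> (\<lambda>p. cocycle_coeffs (E p) (\<Lambda> p)) (SOME t. t \<in> C)"
  let ?K = "tree_classes PP E (P i)"
  let ?N = "\<lambda>n. {C \<in> ?K. \<exists>T\<in>class_shapes C. pweight w T = n}"
  let ?V = "\<lambda>n. {T. tree_ok T \<and> deco T \<in> P i \<and> pweight w T = n}"
  have fin: "\<forall>p\<in>PP. finite (E p)"
    using finite_E by blast
  note shapes = class_shapes_finite_nonempty[OF fin, where Q = "P i"] class_shapes_disjoint[OF fin, where Q = "P i"]
    Union_class_shapes[OF fin, of "P i"]
  have tree_term: "?t C =
      (\<Sum>T\<in>class_shapes C. pterm I P w E \<mu> \<Lambda> T)" if C: "C \<in> ?K" for C
  proof -
    interpret decorated_rtree "SOME t. t \<in> C" PP E "\<lambda>p. cocycle_coeffs (E p) (\<Lambda> p)"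
      using tree_class(1)[OF fin C] finite_E by unfold_locales (auto simp: decorated_tree_def)
    show ?thesis
      unfolding class_shapes_def using cocycles by (intro tree_term_eq_sum_shapes) auto
  qed
  have shape_ok: "tree_ok T \<and> deco T \<in> P i" if "C \<in> ?K" "T \<in> class_shapes C" for C T
  proof -
    have "T \<in> (\<Union>C\<in>?K. class_shapes C)" using that by (rule UN_I)
    also have "\<dots> = {T. tree_ok T \<and> deco T \<in> P i}" by (rule Union_class_shapes[OF fin])
    finally show ?thesis by simp
  qed
  have finV: "finite (?V n)" for n
    by (rule finite_subset[OF _ finite_trees[of n]]) auto
  \<comment> \<open>Only finitely many planar trees have weight n, and disjointness of the shape
    sets assigns each of them to at most one class.\<close>
  have finN: "finite (?N n)" for n
  proof -
    have "?N n \<subseteq> (\<Union>T\<in>?V n. {C \<in> ?K. T \<in> class_shapes C})"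
      using shape_ok by auto
    moreover have "finite {C \<in> ?K. T \<in> class_shapes C}" for T
    proof (cases "\<exists>C\<in>?K. T \<in> class_shapes C")
      case True
      then obtain C where C: "C \<in> ?K" "T \<in> class_shapes C" by blast
      have "{C \<in> ?K. T \<in> class_shapes C} \<subseteq> {C}"
        using shapes(3)[OF C(1)] C(2) by blast
      then show ?thesis by (rule finite_subset) simp
    next
      case False
      then have "{C \<in> ?K. T \<in> class_shapes C} = {}" by blast
      then show ?thesis by (simp only: finite.emptyI)
    qed
    ultimately show ?thesis using finV by (meson finite_UN_I finite_subset)
  qed
  show ?thesis
  proof (rule has_sum_fpsI[where N = ?N])
    fix n C assume "C \<in> ?K - ?N n"
    then show "fps_nth (?t C) n = 0"
      by (auto simp: tree_term fps_sum_nth pterm_nth intro!: sum.neutral)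
  next
    fix n
    have "(\<Sum>C\<in>?N n. fps_nth (?t C) n) =
        (\<Sum>C\<in>?N n. \<Sum>T\<in>class_shapes C. fps_nth (pterm I P w E \<mu> \<Lambda> T) n)"
      by (intro sum.cong refl) (simp add: tree_term fps_sum_nth)
    also have "\<dots> = (\<Sum>T\<in>(\<Union>C\<in>?N n. class_shapes C). fps_nth (pterm I P w E \<mu> \<Lambda> T) n)"
      by (intro sum.UNION_disjoint[symmetric] finN ballI impI shapes(1,3)) simp_all
    also have "\<dots> = (\<Sum>T\<in>?V n. smult (pfactor I P E \<mu> T) (ppoly \<Lambda> T))"
    proof (rule sum.mono_neutral_cong_right)
      show "finite (\<Union>C\<in>?N n. class_shapes C)" using finN shapes(1) by auto
      show "?V n \<subseteq> (\<Union>C\<in>?N n. class_shapes C)"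
      proof
        fix T assume T: "T \<in> ?V n"
        then have "T \<in> (\<Union>C\<in>?K. class_shapes C)" unfolding shapes(4) by simp
        then show "T \<in> (\<Union>C\<in>?N n. class_shapes C)" using T by auto
      qed
      show "\<forall>T\<in>(\<Union>C\<in>?N n. class_shapes C) - ?V n. fps_nth (pterm I P w E \<mu> \<Lambda> T) n = 0"
      proof
        fix T assume T: "T \<in> (\<Union>C\<in>?N n. class_shapes C) - ?V n"
        then obtain C where "C \<in> ?K" "T \<in> class_shapes C" by blast
        from shape_ok[OF this] show "fps_nth (pterm I P w E \<mu> \<Lambda> T) n = 0" using T by (simp add: pterm_nth)
      qed
    qed (simp add: pterm_nth)
    also have "\<dots> = fps_nth (tree_series i - 1) n"
      by (simp add: tree_series_def)
    finally show "fps_nth (tree_series i - 1) n =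
      (\<Sum>C\<in>?N n. fps_nth (?t C) n)" ..
  qed (use finN in auto)
qed

end

text \<open>\<open>infsum\<close> has a default value on families that are not summable, so
  summability is asserted alongside. The equivalence says both that the formula solves the system
  and that no other family on \<open>I\<close> does.\<close>

theorem theorem3p17:
  fixes I :: "'i set"
    and P :: "'i \<Rightarrow> 'p set"
    and w :: "'p \<Rightarrow> nat"
    and E :: "'p \<Rightarrow> 'e set"
    and \<mu> :: "'e \<Rightarrow> 'i \<Rightarrow> 'k::field_char_0"
    and \<Lambda> :: "'p \<Rightarrow> ('e, 'k) mpoly \<Rightarrow> 'k poly"
    and G :: "'i \<Rightarrow> 'k poly fps"
  defines "PP \<equiv> (\<Union>i\<in>I. P i)"
  defines "a \<equiv> (\<lambda>p. cocycle_coeffs (E p) (\<Lambda> p))"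
  assumes "finite I"
    and "disjoint_family_on P I"
    and "\<And>p. p \<in> PP \<Longrightarrow> w p \<ge> 1"
    and "\<And>n. finite {p \<in> PP. w p = n}"
    and "\<And>p. p \<in> PP \<Longrightarrow> finite (E p)"
    and "disjoint_family_on E PP"
    and "\<And>p. p \<in> PP \<Longrightarrow> one_cocycle (E p) (\<Lambda> p)"
  shows "(\<forall>i\<in>I. (\<lambda>T. tree_term I P w E \<mu> a (SOME t. t \<in> T)) summable_on tree_classes PP E (P i)) \<and>
    (dse_solution I P w E \<mu> \<Lambda> G \<longleftrightarrow>
      (\<forall>i\<in>I. G i = 1 + (\<Sum>\<^sub>\<infinity>T\<in>tree_classes PP E (P i). tree_term I P w E \<mu> a (SOME t. t \<in> T))))"
proof -
  interpret dyson_schwinger I P w E \<mu> \<Lambda> PP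
    using assms by unfold_locales auto
  have sum: "((\<lambda>T. tree_term I P w E \<mu> a (SOME t. t \<in> T)) has_sum (tree_series i - 1)) (tree_classes PP E (P i))"
    if "i \<in> I" for i
    unfolding a_def by (rule has_sum_tree_terms[OF that])
  then show ?thesis
    unfolding dse_solution_iff using infsumI[OF sum] by (auto simp: summable_on_def)
qed

end
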